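(* Assume $\varpi_s=0$. Fix $\beta\in\mathbb{R}$. In the asymptotic regime $\sigma\to0$, $L=L(\sigma)$ of order $\sigma^{-2}$, $x=x(\sigma)\in\mathbb{Z}$ with $x>L$, the mean field at times close to $x$ satisfies $$\mathbb{E}\big[u_x(x+\sqrt[3]{x}\,\beta)\big]=\frac{1}{\sqrt[3]{x}}\,\mathrm{Ai}(-2\beta)+o\Big(\frac{1}{\sqrt[3]{x}}\Big),$$ where $\mathrm{Ai}$ is the Airy function.
   Context: Random lattice problem. Let $\varpi_s\ge 0$ (here $\varpi_s=0$) and let $L\ge1$ be an integer. Let $\mathfrak{m}_x$, $x\in\mathbb{Z}$, be real random variables with $\mathfrak{m}_x=0$ for $x\notin[1,L]\cap\mathbb{Z}$ and with $\mathfrak{m}_x$, $x\in[1,L]\cap\mathbb{Z}$, independent and identically distributed with mean zero and variance $\sigma^2$; the numbers $1+\mathfrak{m}_x$ are masses of particles and are positive. As $\sigma$ varies, $\mathfrak{m}_x=\sigma\nu_x$ on $[1,L]\cap\mathbb{Z}$, where the law of the i.i.d. variables $\nu_x$ (mean zero, variance one) does not depend on $\sigma$. Let $u:\mathbb{Z}\times\mathbb{R}\to\mathbb{R}$ be the solution, with $u(t)\in\ell^2(\mathbb{Z})$ for all $t$, of $$(1+\mathfrak{m}_x)\ddot u_x(t)=u_{x+1}(t)+u_{x-1}(t)-(2+\varpi_s)u_x(t),\quad x\in\mathbb{Z},\ t\in\mathbb{R},$$ with $u_0(0)=1$, $u_x(0)=0$ for $x\ne0$, and $\dot u_x(0)=0$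 for all $x\in\mathbb{Z}$. Meaning of the asymptotic regime: $L$ of order $\sigma^{-2}$ means that there are constants $0<c\le C<\infty$ with $c\le\sigma^2L\le C$; $o(\cdot)$ is understood along any sequence of parameters $(\sigma,L,x)$ with $\sigma\to0$, $c\le\sigma^2L\le C$ and $x>L$ (so that $L,x\to+\infty$), with $\beta$ fixed. *)

theory Defs
  imports "HOL-Probability.Probability" "HOL-Library.Landau_Symbols"
begin

text \<open>The Airy function as a conditionally convergent (improper) integral.\<close>

definition Ai :: "real \<Rightarrow> real" where
  "Ai y = (1 / pi) * Lim at_top (\<lambda>R. integral {0..R} (\<lambda>s. cos (s ^ 3 / 3 + y * s)))"

definition ell2 :: "(int \<Rightarrow> real) \<Rightarrow> bool" where
  "ell2 f \<longleftrightarrow> (\<lambda>x. (f x)\<^sup>2) summable_on UNIV"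

text \<open>The field \<open>u x t\<close> of the harmonic lattice with on-site pinning \<open>w\<close> and masses
  \<open>1 + m x\<close>, started at rest from a unit displacement of the site \<open>0\<close>.
  Here \<open>v\<close> and \<open>a\<close> are the velocity and the acceleration.\<close>

definition lattice_solution ::
    "real \<Rightarrow> (int \<Rightarrow> real) \<Rightarrow> (int \<Rightarrow> real \<Rightarrow> real) \<Rightarrow> bool" where
  "lattice_solution w m u \<longleftrightarrow>
     (\<forall>t. ell2 (\<lambda>x. u x t)) \<and>
     (\<exists>v a. (\<forall>x t. (u x has_real_derivative v x t) (at t)) \<and>
            (\<forall>x t. (v x has_real_derivative a x t) (at t)) \<and>
            (\<forall>x t. (1 + m x) * a x t = u (x + 1) t + u (x - 1) t - (2 + w) * u x t) \<and>
            (\<forall>x. u x 0 = (if x = 0 then 1 else 0)) \<and>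
            (\<forall>x. v x 0 = 0))"

definition mass_defect :: "real \<Rightarrow> int \<Rightarrow> (int \<Rightarrow> real) \<Rightarrow> int \<Rightarrow> real" where
  "mass_defect \<sigma> L \<nu> x = (if x \<in> {1..L} then \<sigma> * \<nu> x else 0)"

end

theory Submission
  imports Defs "HOL-Complex_Analysis.Complex_Analysis" "HOL-Real_Asymp.Real_Asymp"
begin

text \<open>By finite speed of propagation the field is an entire series in \<open>t\<close> whose Borel transform
  \<open>f y s\<close> solves the resolvent equation, so that \<open>u x t\<close> is the integral of \<open>exp (s * t) * f x s\<close> over
  a large circle. In the right half plane \<open>f x s\<close> equals the resolvent of the homogeneous lattice
  times a transmission factor, which is a product over the sites of the slab. Deforming the
  circle to the line \<open>Re s = B / root 3 x\<close>, the homogeneous integrand gets a Gaussian bound in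
  \<open>Im s * root 3 x\<close>. Each site changes the transmission factor \<open>T\<close> by a relative amount which is, to
  first order, linear in a mass of mean zero that is independent of the sites to its right; hence
  the mean of \<open>\<bar>T - 1\<bar>\<^sup>2\<close> is at most \<open>exp (C * \<bar>s\<bar>\<^sup>2) - 1\<close> up to constants at low frequency, and
  replacing \<open>T\<close> by \<open>1\<close> costs only a relative factor of order \<open>1 / root 3 x\<close>. What is left is the
  homogeneous lattice, where the rescaled integrand converges to that of the Airy function.\<close>

section \<open>Uniqueness of lattice motions\<close>

text \<open>The scale \<open>X = root 3 x\<close> comes from the phase. With
  \<open>b = decay_root s\<close> one has \<open>ln b = s / 2 - s ^ 3 / 48 + ...\<close>, so at
  \<open>t = x + X * \<beta>\<close> the exponent \<open>s * t - 2 * x * ln b\<close> has no part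
  \<open>s * x\<close> left, and \<open>s = S / X\<close> gives
  \<open>\<beta> * S + S ^ 3 / 24\<close> in the limit; \<open>S = 2 * z\<close> turns this into the
  Airy exponent at \<open>- 2 * \<beta>\<close>. Mean zero is what tames the disorder. Adding the
  moduli of \<open>L\<close> changes of size \<open>\<sigma> * \<bar>s\<bar>\<close> gives the order
  \<open>\<bar>s\<bar> / \<sigma>\<close>, which need not be small. With the linear terms gone on
  average only variances add up, to about
  \<open>\<sigma>\<^sup>2 * L * \<bar>s\<bar>\<^sup>2\<close>, whose root is of order
  \<open>1 / X\<close>. The estimate is made at each frequency separately and Fubini exchanges
  expectation and frequency integral, so no uniformity in \<open>s\<close> along a sample is
  required. Nothing is known about the dependence of \<open>u\<close> on the sample beyond its
  equation. Measurability comes from the explicit series for the field, integrability from the error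
  bound itself.\<close>

lemma bound_by_halving:
  fixes F :: "'i \<Rightarrow> real"
  assumes bdd: "\<exists>S. \<forall>i\<in>I. F i \<le> S"
    and half: "\<And>S. \<forall>i\<in>I. F i \<le> S \<Longrightarrow> \<forall>i\<in>I. F i \<le> c + S / 2"
    and i: "i \<in> I"
  shows "F i \<le> 2 * c"
proof -
  from bdd obtain S where "\<forall>i\<in>I. F i \<le> S" by blast
  then have "bdd_above (F ` I)" by (auto intro!: bdd_aboveI)
  then have "\<forall>i\<in>I. F i \<le> Sup (F ` I)" by (auto intro: cSup_upper)
  \<comment> \<open>Applied to the supremum itself, \<open>half\<close> can be solved for it. This
    requires the supremum to be finite beforehand, which is why the estimates built on this lemma
    take \<open>bdd_on\<close> as a hypothesis.\<close>
  from half[OF this] have "\<forall>i\<in>I. F i \<le> c + Sup (F ` I) / 2" .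
  then have "Sup (F ` I) \<le> c + Sup (F ` I) / 2"
    using i by (intro cSup_least) auto
  moreover have "F i \<le> Sup (F ` I)" using \<open>\<forall>i\<in>I. F i \<le> Sup (F ` I)\<close> i by blast
  ultimately show ?thesis by linarith
qed

text \<open>No bound on \<open>w\<close> that is uniform in time is assumed below; it is recovered by a
  Baire category argument.\<close>

locale bounded_lattice_motion =
  fixes m :: "int \<Rightarrow> real" and w v a :: "int \<Rightarrow> real \<Rightarrow> real"
  assumes mass: "\<And>y. m y \<ge> - 1 / 2"
    and w_deriv: "\<And>y t. (w y has_real_derivative v y t) (at t)"
    and v_deriv: "\<And>y t. (v y has_real_derivative a y t) (at t)"
    and motion: "\<And>y t. (1 + m y) * a y t = w (y + 1) t + w (y - 1) t - 2 * w y t"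
    and pointwise_bounded: "\<And>t. \<exists>M. \<forall>y. \<bar>w y t\<bar> \<le> M"
begin

definition bdd_on :: "real set \<Rightarrow> bool" where
  "bdd_on I \<longleftrightarrow> (\<exists>S. \<forall>y. \<forall>t\<in>I. \<bar>w y t\<bar> \<le> S)"

text \<open>The constant is the bound 4 for the discrete Laplacian on bounded sequences divided by
  the least mass \<open>1 / 2\<close>.\<close>

lemma acceleration_bound:
  assumes "\<And>y. \<bar>w y t\<bar> \<le> S"
  shows "\<bar>a y t\<bar> \<le> 8 * S"
proof -
  have "(1 / 2) * \<bar>a y t\<bar> \<le> (1 + m y) * \<bar>a y t\<bar>"
    using mass[of y] by (intro mult_right_mono) auto
  also have "\<dots> = \<bar>w (y + 1) t + w (y - 1) t - 2 * w y t\<bar>"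
    using motion[of y t] mass[of y] by (simp add: abs_mult flip: motion)
  also have "\<dots> \<le> 4 * S" using assms[of "y+1"] assms[of "y-1"] assms[of y] by linarith
  finally show ?thesis by linarith
qed

lemma velocity_increment:
  assumes "\<And>y t. t \<in> {p..q} \<Longrightarrow> \<bar>w y t\<bar> \<le> S" and t: "t \<in> {p..q}" "t' \<in> {p..q}"
  shows "\<bar>v y t - v y t'\<bar> \<le> 8 * S * (q - p)"
proof -
  have "norm (v y t - v y t') \<le> 8 * S * norm (t - t')"
  proof (rule field_differentiable_bound[where S = "{p..q}" and f' = "a y"])
    show "(v y has_field_derivative a y z) (at z within {p..q})" for z
      using v_deriv by (rule has_field_derivative_at_within)
    show "norm (a y z) \<le> 8 * S" if "z \<in> {p..q}" for z
      using acceleration_bound[of z S] assms(1) that by simp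
  qed (use t in auto)
  also have "\<dots> \<le> 8 * S * (q - p)"
  proof (intro mult_left_mono)
    have "0 \<le> S" using assms(1)[of t 0] t by (smt (verit))
    then show "0 \<le> 8 * S" by simp
  qed (use t in auto)
  finally show ?thesis by simp
qed

lemma displacement_increment:
  assumes "\<And>t. t \<in> {p..q} \<Longrightarrow> \<bar>v y t\<bar> \<le> V" and t: "t \<in> {p..q}" "t' \<in> {p..q}"
  shows "\<bar>w y t - w y t'\<bar> \<le> V * (q - p)"
proof -
  have "norm (w y t - w y t') \<le> V * norm (t - t')"
  proof (rule field_differentiable_bound[where S = "{p..q}" and f' = "v y"])
    show "(w y has_field_derivative v y z) (at z within {p..q})" for z
      using w_deriv by (rule has_field_derivative_at_within)
  qed (use t assms in auto)
  also have "\<dots> \<le> V * (q - p)"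
  proof (intro mult_left_mono)
    show "0 \<le> V" using assms(1)[of t] t by (smt (verit))
  qed (use t in auto)
  finally show ?thesis by simp
qed

text \<open>Integrating the acceleration twice over a length of at most \<open>1 / 4\<close>
  produces \<open>8 * S / 16 = S / 2\<close>, which the halving argument absorbs; what remains
  depends only on the data at \<open>t0\<close>.\<close>

lemma bound_from_initial_data:
  assumes pq: "q - p \<le> 1 / 4" "t0 \<in> {p..q}"
    and bdd: "bdd_on {p..q}"
    and W: "\<And>y. \<bar>w y t0\<bar> \<le> W" and V: "\<And>y. \<bar>v y t0\<bar> \<le> V"
    and t: "t \<in> {p..q}"
  shows "\<bar>w y t\<bar> \<le> 2 * (W + V)"
proof -
  let ?F = "\<lambda>i. \<bar>w (fst i) (snd i)\<bar>"
  have "?F (y, t) \<le> 2 * (W + V)"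
  proof (rule bound_by_halving[where I = "UNIV \<times> {p..q}"])
    show "\<exists>S. \<forall>i\<in>UNIV \<times> {p..q}. ?F i \<le> S" using bdd by (auto simp: bdd_on_def)
    fix S assume S: "\<forall>i\<in>UNIV \<times> {p..q}. ?F i \<le> S"
    have Vpos: "0 \<le> V" using V[of 0] by linarith
    have Spos: "0 \<le> S" using S t by force
    show "\<forall>i\<in>UNIV \<times> {p..q}. ?F i \<le> (W + V) + S / 2"
    proof safe
      fix y' t' assume t': "t' \<in> {p..q}"
      have "\<bar>v y' r\<bar> \<le> V + 8 * S * (q - p)" if "r \<in> {p..q}" for r
        using velocity_increment[of p q S r t0 y'] S that pq V[of y'] by fastforce
      from displacement_increment[OF this t' pq(2)]
      have "\<bar>w y' t' - w y' t0\<bar> \<le> (V + 8 * S * (q - p)) * (q - p)" .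
      also have "\<dots> \<le> (V + 8 * S * (1 / 4)) * (1 / 4)"
        using pq Vpos Spos by (intro mult_mono add_mono) auto
      also have "\<dots> \<le> V + S / 2" using Vpos by simp
      finally show "?F (y', t') \<le> (W + V) + S / 2" using W[of y'] by simp
    qed
  qed (use t in auto)
  then show ?thesis by simp
qed

text \<open>No velocity bound is at hand, but each site has a time \<open>\<xi>\<close> at which
  \<open>(q - p) * v\<close> is the difference of the endpoint values, hence at most
  \<open>2 * M\<close>. There is never a division by \<open>q - p\<close>, so the constant 6 holds
  for arbitrarily short intervals.\<close>

lemma bound_from_endpoints:
  assumes pq: "p < q" "q - p \<le> 1 / 4" and bdd: "bdd_on {p..q}"
    and M: "\<And>y. \<bar>w y p\<bar> \<le> M" "\<And>y. \<bar>w y q\<bar> \<le> M" and t: "t \<in> {p..q}"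
  shows "\<bar>w y t\<bar> \<le> 6 * M"
proof -
  let ?F = "\<lambda>i. \<bar>w (fst i) (snd i)\<bar>"
  have "?F (y, t) \<le> 2 * (3 * M)"
  proof (rule bound_by_halving[where I = "UNIV \<times> {p..q}"])
    show "\<exists>S. \<forall>i\<in>UNIV \<times> {p..q}. ?F i \<le> S" using bdd by (auto simp: bdd_on_def)
    fix S assume S: "\<forall>i\<in>UNIV \<times> {p..q}. ?F i \<le> S"
    have Spos: "0 \<le> S" using S t by force
    show "\<forall>i\<in>UNIV \<times> {p..q}. ?F i \<le> 3 * M + S / 2"
    proof safe
      fix y' t' assume t': "t' \<in> {p..q}"
      from MVT2[OF pq(1), of "w y'" "v y'"] w_deriv
      obtain \<xi> where \<xi>: "p < \<xi>" "\<xi> < q" "w y' q - w y' p = (q - p) * v y' \<xi>" by blast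
      have "\<bar>v y' r\<bar> \<le> \<bar>v y' \<xi>\<bar> + 8 * S * (q - p)" if "r \<in> {p..q}" for r
        using velocity_increment[of p q S r \<xi> y'] S that \<xi> by fastforce
      from displacement_increment[OF this t', of p]
      have "\<bar>w y' t' - w y' p\<bar> \<le> (\<bar>v y' \<xi>\<bar> + 8 * S * (q - p)) * (q - p)" using pq by auto
      also have "\<dots> = \<bar>(q - p) * v y' \<xi>\<bar> + 8 * S * ((q - p) * (q - p))"
        using pq by (simp only: abs_mult) (simp add: algebra_simps)
      also have "\<dots> \<le> 2 * M + 8 * S * ((1/4) * (1/4))"
        using pq M[of y'] Spos unfolding \<xi>(3)[symmetric]
        by (intro add_mono mult_left_mono mult_mono) (auto simp: abs_le_iff)
      finally show "?F (y', t') \<le> 3 * M + S / 2" using M(1)[of y'] by simp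
    qed
  qed (use t in auto)
  then show ?thesis by simp
qed

text \<open>Some velocity at a nearby time is a difference quotient of bounded displacements, and
  the bounded acceleration carries the bound over to \<open>t\<close>.\<close>

lemma velocity_bounded:
  assumes "\<delta> > 0" "bdd_on (ball t \<delta>)"
  shows "\<exists>V. \<forall>y. \<bar>v y t\<bar> \<le> V"
proof -
  from assms obtain S where S: "\<And>y r. r \<in> ball t \<delta> \<Longrightarrow> \<bar>w y r\<bar> \<le> S"
    unfolding bdd_on_def by blast
  let ?q = "t + \<delta> / 2"
  have in_ball: "r \<in> ball t \<delta>" if "r \<in> {t..?q}" for r using that assms(1) by (auto simp: dist_real_def)
  have "\<bar>v y t\<bar> \<le> 4 * S / \<delta> + 8 * S * (\<delta> / 2)" for y
  proof -
    from MVT2[of t ?q "w y" "v y"] w_deriv assms(1)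
    obtain \<xi> where \<xi>: "t < \<xi>" "\<xi> < ?q" "w y ?q - w y t = (?q - t) * v y \<xi>" by auto
    have "\<bar>w y ?q - w y t\<bar> \<le> 2 * S"
      using S[OF in_ball[of ?q], of y] S[OF in_ball[of t], of y] assms(1) by auto
    then have "\<bar>\<delta> / 2 * v y \<xi>\<bar> \<le> 2 * S" using \<xi> by simp
    then have "\<bar>v y \<xi>\<bar> \<le> 4 * S / \<delta>" using assms(1) by (simp add: abs_mult field_simps)
    moreover have "\<bar>v y t - v y \<xi>\<bar> \<le> 8 * S * (?q - t)"
      using \<xi> S in_ball by (intro velocity_increment) auto
    ultimately show ?thesis by simp
  qed
  then show ?thesis by blast
qed

lemma bdd_on_compact_interval:
  assumes "p \<le> q" "\<And>t. t \<in> {p..q} \<Longrightarrow> \<exists>\<delta>>0. bdd_on (ball t \<delta>)"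
  shows "bdd_on {p..q}"
  using assms(1)
proof (induction rule: Bolzano)
  case (trans r s t)
  then obtain S S' where "\<forall>y. \<forall>t\<in>{r..s}. \<bar>w y t\<bar> \<le> S" "\<forall>y. \<forall>t\<in>{s..t}. \<bar>w y t\<bar> \<le> S'"
    unfolding bdd_on_def by blast
  then have "\<forall>y. \<forall>t\<in>{r..t}. \<bar>w y t\<bar> \<le> max S S'"
    by (metis atLeastAtMost_iff linorder_le_cases max.coboundedI1 max.coboundedI2)
  then show ?case unfolding bdd_on_def by blast
next
  case (local r)
  then obtain \<delta> where \<delta>: "\<delta> > 0" "bdd_on (ball r \<delta>)" using assms(2) by auto
  have "bdd_on {\<alpha>..\<beta>}" if "\<alpha> \<le> r" "r \<le> \<beta>" "\<beta> - \<alpha> < \<delta>" for \<alpha> \<beta>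
  proof -
    have "{\<alpha>..\<beta>} \<subseteq> ball r \<delta>" using that by (auto simp: dist_real_def)
    then show ?thesis using \<delta>(2) unfolding bdd_on_def by blast
  qed
  then show ?case using \<delta>(1) by blast
qed

text \<open>Local bounds inside the gap give a finite velocity at its midpoint, and
  \<open>bound_from_initial_data\<close> spreads this over the whole open gap with one constant.
  That constant is uncontrolled, but it makes \<open>bdd_on\<close> available up to the ends, after
  which \<open>bound_from_endpoints\<close> replaces it by \<open>6 * M\<close>.\<close>

lemma gap_bound:
  assumes pq: "p < q" "q - p \<le> 1 / 4"
    and loc: "\<And>t. t \<in> {p<..<q} \<Longrightarrow> \<exists>\<delta>>0. bdd_on (ball t \<delta>)"
    and M: "\<And>y. \<bar>w y p\<bar> \<le> M" "\<And>y. \<bar>w y q\<bar> \<le> M" and t: "t \<in> {p..q}"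
  shows "\<bar>w y t\<bar> \<le> 6 * M"
proof (rule bound_from_endpoints[OF pq _ M t])
  define t0 where "t0 = (p + q) / 2"
  have t0: "t0 \<in> {p<..<q}" using pq by (auto simp: t0_def)
  from loc[OF t0] velocity_bounded obtain V where V: "\<And>y. \<bar>v y t0\<bar> \<le> V" by blast
  from pointwise_bounded obtain W where W: "\<And>y. \<bar>w y t0\<bar> \<le> W" by blast
  have *: "\<bar>w y r\<bar> \<le> 2 * (W + V)" if r: "r \<in> {p<..<q}" for y r
  proof (rule bound_from_initial_data[OF _ _ _ W V])
    show "bdd_on {min r t0..max r t0}"
    proof (rule bdd_on_compact_interval)
      fix z assume "z \<in> {min r t0..max r t0}"
      then show "\<exists>\<delta>>0. bdd_on (ball z \<delta>)" using r t0 by (intro loc) auto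
    qed auto
  qed (use r t0 pq in auto)
  have "\<bar>w y r\<bar> \<le> max M (2 * (W + V))" if "r \<in> {p..q}" for y r
    using *[of r y] M(1)[of y] M(2)[of y] that by (cases "r = p \<or> r = q") auto
  then show "bdd_on {p..q}" unfolding bdd_on_def by blast
qed

text \<open>Let \<open>K\<close> be the closed set of bad times. The closed sets \<open>E M\<close>
  cover it, so by Baire one of them contains a relative neighbourhood in \<open>K\<close> of some
  bad time \<open>k0\<close>. Near \<open>k0\<close> the motion is then bounded on \<open>K\<close>,
  and on each gap of \<open>K\<close> by \<open>gap_bound\<close> with the same constant, so
  \<open>k0\<close> is not bad after all.\<close>

lemma locally_bounded: "\<exists>\<delta>>0. bdd_on (ball t \<delta>)"
proof (rule ccontr)
  assume not: "\<not> ?thesis"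
  define K where "K = {t. \<not> (\<exists>\<delta>>0. bdd_on (ball t \<delta>))}"
  have "open (- K)"
  proof (rule openI)
    fix r assume "r \<in> - K"
    then obtain \<delta> where \<delta>: "\<delta> > 0" "bdd_on (ball r \<delta>)" by (auto simp: K_def)
    have "ball r (\<delta> / 2) \<subseteq> - K"
    proof
      fix z assume z: "z \<in> ball r (\<delta> / 2)"
      have "ball z (\<delta> / 2) \<subseteq> ball r \<delta>"
      proof
        fix z' assume "z' \<in> ball z (\<delta> / 2)"
        with z show "z' \<in> ball r \<delta>"
          unfolding mem_ball dist_real_def by linarith
      qed
      then have "bdd_on (ball z (\<delta> / 2))" using \<delta>(2) unfolding bdd_on_def by blast
      then show "z \<in> - K" using \<delta>(1) by (auto simp: K_def intro!: exI[of _ "\<delta> / 2"])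
    qed
    then show "\<exists>e>0. ball r e \<subseteq> - K" using \<delta>(1) by (intro exI[of _ "\<delta> / 2"]) auto
  qed
  then have closed_K: "closed K" by (simp add: closed_def)
  have t_K: "t \<in> K" using not by (simp add: K_def)
  define E where "E M = {t. \<forall>y. \<bar>w y t\<bar> \<le> real M}" for M :: nat
  have w_cont: "continuous_on UNIV (w y)" for y
    by (intro DERIV_continuous_on[where D = "v y"]) (use w_deriv in auto)
  have closed_E: "closed (E M)" for M
  proof -
    have "E M = (\<Inter>y. {t. \<bar>w y t\<bar> \<le> real M})" by (auto simp: E_def)
    moreover have "closed {t. \<bar>w y t\<bar> \<le> real M}" for y
      by (intro closed_Collect_le continuous_intros w_cont)
    ultimately show ?thesis by auto
  qed
  have "\<exists>M k0 \<epsilon>. \<epsilon> > 0 \<and> k0 \<in> K \<and> K \<inter> ball k0 \<epsilon> \<subseteq> E M"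
  proof (rule ccontr)
    assume none: "\<not> ?thesis"
    have "K \<subseteq> closure (\<Inter> (range (\<lambda>M. K - E M)))"
    proof (rule Baire[OF closed_K])
      fix T assume "T \<in> range (\<lambda>M. K - E M)"
      then obtain M where T: "T = K - E M" by auto
      have "openin (top_of_set K) T"
        unfolding T openin_open using closed_E[of M] by (intro exI[of _ "- E M"]) auto
      moreover have "K \<subseteq> closure T"
      proof
        fix k assume k: "k \<in> K"
        show "k \<in> closure T"
          unfolding closure_approachable
        proof safe
          fix e :: real assume "e > 0"
          with none k have "\<not> K \<inter> ball k e \<subseteq> E M" by blast
          then show "\<exists>y\<in>T. dist y k < e" by (auto simp: T dist_commute)
        qed
      qed
      ultimately show "openin (top_of_set K) T \<and> K \<subseteq> closure T" by blast
    qed auto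
    moreover have Inter_empty: "\<Inter> (range (\<lambda>M. K - E M)) = {}"
    proof -
      have "\<exists>M. r \<in> E M" for r
      proof -
        obtain M where "\<And>y. \<bar>w y r\<bar> \<le> M" using pointwise_bounded by blast
        then have "r \<in> E (nat \<lceil>M\<rceil>)"
          unfolding E_def using of_nat_ceiling[of M] order_trans by blast
        then show ?thesis by blast
      qed
      then show ?thesis by blast
    qed
    ultimately show False using t_K unfolding Inter_empty by simp
  qed
  then obtain M k0 \<epsilon> where k0: "\<epsilon> > 0" "k0 \<in> K" "K \<inter> ball k0 \<epsilon> \<subseteq> E M" by blast
  \<comment> \<open>At most \<open>1 / 8\<close>, so that no gap inside
    \<open>{\<alpha>..\<beta>}\<close> exceeds the length \<open>1 / 4\<close> allowed in
    \<open>gap_bound\<close>.\<close>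
  define \<eta> where "\<eta> = min (\<epsilon> / 2) (1 / 8)"
  have \<eta>: "0 < \<eta>" "\<eta> < \<epsilon>" "\<eta> \<le> 1 / 8" using k0(1) by (auto simp: \<eta>_def)
  define \<alpha> \<beta> where "\<alpha> = k0 - \<eta>" and "\<beta> = k0 + \<eta>"
  obtain A1 where A1: "\<And>y. \<bar>w y \<alpha>\<bar> \<le> A1" using pointwise_bounded by blast
  obtain A2 where A2: "\<And>y. \<bar>w y \<beta>\<bar> \<le> A2" using pointwise_bounded by blast
  define M' where "M' = max (real M) (max A1 A2)"
  \<comment> \<open>The two endpoints are adjoined so that every gap has both ends at times where
    \<open>M'\<close> is a bound, also next to the boundary of the interval.\<close>
  define K' where "K' = K \<inter> {\<alpha>..\<beta>} \<union> {\<alpha>, \<beta>}"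
  have closed_K': "closed K'" unfolding K'_def using closed_K by (intro closed_Un closed_Int) auto
  have K'_bound: "\<bar>w y k\<bar> \<le> M'" if "k \<in> K'" for y k
  proof -
    consider "k = \<alpha>" | "k = \<beta>" | "k \<in> K" "k \<in> {\<alpha>..\<beta>}" using \<open>k \<in> K'\<close> by (auto simp: K'_def)
    then show ?thesis
    proof cases
      case 3
      then have "k \<in> ball k0 \<epsilon>" using \<eta> by (auto simp: \<alpha>_def \<beta>_def dist_real_def)
      then have "k \<in> E M" using 3 k0 by auto
      then show ?thesis unfolding E_def M'_def by (auto simp: le_max_iff_disj)
    qed (use A1[of y] A2[of y] in \<open>auto simp: M'_def\<close>)
  qed
  have "\<bar>w y r\<bar> \<le> max M' (6 * M')" if r: "r \<in> {\<alpha>..\<beta>}" for y r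
  proof (cases "r \<in> K'")
    case True
    then show ?thesis using K'_bound by (simp add: le_max_iff_disj)
  next
    case False
    define p where "p = Sup (K' \<inter> {..r})"
    define q where "q = Inf (K' \<inter> {r..})"
    have ne: "K' \<inter> {..r} \<noteq> {}" "K' \<inter> {r..} \<noteq> {}" using r by (auto simp: K'_def)
    have ba: "bdd_above (K' \<inter> {..r})" "bdd_below (K' \<inter> {r..})" by (auto intro: bdd_aboveI bdd_belowI)
    have p: "p \<in> K' \<inter> {..r}"
      unfolding p_def using closed_K' by (intro closed_contains_Sup ne ba closed_Int) auto
    have q: "q \<in> K' \<inter> {r..}"
      unfolding q_def using closed_K' by (intro closed_contains_Inf ne ba closed_Int) auto
    have K'_sub: "K' \<subseteq> {\<alpha>..\<beta>}" using \<eta> by (auto simp: K'_def \<alpha>_def \<beta>_def)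
    have gap: "z \<notin> K" if "z \<in> {p<..<q}" for z
    proof
      assume "z \<in> K"
      then have z: "z \<in> K'" using that p q K'_sub by (auto simp: K'_def)
      show False
      proof (cases "z \<le> r")
        case True
        then have "z \<le> p" unfolding p_def using z ba by (intro cSup_upper) auto
        then show False using that by auto
      next
        case False
        then have "q \<le> z" unfolding q_def using z ba by (intro cInf_lower) auto
        then show False using that by auto
      qed
    qed
    have "p \<noteq> r" "q \<noteq> r" using False p q by auto
    have "\<bar>w y r\<bar> \<le> 6 * M'"
    proof (rule gap_bound[of p q])
      have "\<alpha> \<le> p" "q \<le> \<beta>" using p q K'_sub by auto
      then show "q - p \<le> 1 / 4" using \<eta> unfolding \<alpha>_def \<beta>_def by linarith
      show "\<exists>\<delta>>0. bdd_on (ball z \<delta>)" if "z \<in> {p<..<q}" for z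
        using gap[OF that] by (simp add: K_def)
    qed (use p q \<open>p \<noteq> r\<close> \<open>q \<noteq> r\<close> K'_bound in auto)
    then show ?thesis by simp
  qed
  moreover have "ball k0 \<eta> \<subseteq> {\<alpha>..\<beta>}" by (auto simp: \<alpha>_def \<beta>_def dist_real_def)
  ultimately have "bdd_on (ball k0 \<eta>)" unfolding bdd_on_def by blast
  then show False using k0(2) \<eta> by (auto simp: K_def)
qed

text \<open>Each passage through the equation of motion and two integrations improves the bound to
  the next term \<open>8 ^ n * r ^ (2 * n) / fact (2 * n)\<close>, and these tend to zero.\<close>

lemma zero_of_zero_data:
  assumes zero: "\<And>y. w y 0 = 0" "\<And>y. v y 0 = 0" and t: "t \<ge> 0"
  shows "w y t = 0"
proof -
  from bdd_on_compact_interval[OF t] locally_bounded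
  obtain S where S: "\<And>y r. r \<in> {0..t} \<Longrightarrow> \<bar>w y r\<bar> \<le> S" unfolding bdd_on_def by blast
  have *: "\<bar>w y r\<bar> \<le> S * (8 ^ n * r ^ (2 * n) / fact (2 * n))" if "r \<in> {0..t}" for n y r
    using that
  proof (induction n arbitrary: y r)
    case 0
    then show ?case using S by simp
  next
    case (Suc n)
    have acc: "\<bar>a y z\<bar> \<le> S * (8 ^ Suc n * z ^ (2 * n) / fact (2 * n))" if "z \<in> {0..t}" for y z
      using acceleration_bound[OF Suc.IH[OF that]] by (simp add: field_simps)
    have pow_deriv: "((\<lambda>z. S * (8 ^ Suc n * z ^ Suc k / fact (Suc k))) has_real_derivative
        S * (8 ^ Suc n * z ^ k / fact k)) (at z)" for k z
    proof -
      have "((\<lambda>z. (S * 8 ^ Suc n / fact (Suc k)) * z ^ Suc k) has_real_derivative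
        (S * 8 ^ Suc n / fact (Suc k)) * (real (Suc k) * z ^ k)) (at z)"
        by (rule DERIV_cmult, rule DERIV_cong[OF DERIV_pow]) simp
      moreover have "(S * 8 ^ Suc n / fact (Suc k)) * (real (Suc k) * z ^ k) = S * (8 ^ Suc n * z ^ k / fact k)"
        by (simp add: fact_Suc del: of_nat_Suc)
      ultimately show ?thesis by (simp only: mult.assoc times_divide_eq_left times_divide_eq_right)
    qed
    have compare: "\<bar>f z\<bar> \<le> S * (8 ^ Suc n * z ^ Suc k / fact (Suc k))"
      if f: "\<And>z. (f has_real_derivative f' z) (at z)" "f 0 = 0" and z: "z \<in> {0..t}"
        and f': "\<And>z. z \<in> {0..t} \<Longrightarrow> \<bar>f' z\<bar> \<le> S * (8 ^ Suc n * z ^ k / fact k)" for f f' k z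
    proof -
      let ?g = "\<lambda>z. S * (8 ^ Suc n * z ^ Suc k / fact (Suc k))"
      let ?g' = "\<lambda>z. S * (8 ^ Suc n * z ^ k / fact k)"
      have "?g 0 - f 0 \<le> ?g z - f z"
      proof (rule deriv_nonneg_imp_mono[where g = "\<lambda>x. ?g x - f x" and g' = "\<lambda>x. ?g' x - f' x"])
        show "0 \<le> ?g' r - f' r" if "r \<in> {0..z}" for r
          using abs_le_iff[THEN iffD1, OF f'[of r]] that z by auto
        show "((\<lambda>x. ?g x - f x) has_real_derivative ?g' r - f' r) (at r)" for r
          by (intro DERIV_diff pow_deriv f(1))
      qed (use z in auto)
      moreover have "?g 0 + f 0 \<le> ?g z + f z"
      proof (rule deriv_nonneg_imp_mono[where g = "\<lambda>x. ?g x + f x" and g' = "\<lambda>x. ?g' x + f' x"])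
        show "0 \<le> ?g' r + f' r" if "r \<in> {0..z}" for r
          using abs_le_iff[THEN iffD1, OF f'[of r]] that z by auto
        show "((\<lambda>x. ?g x + f x) has_real_derivative ?g' r + f' r) (at r)" for r
          by (intro DERIV_add pow_deriv f(1))
      qed (use z in auto)
      ultimately show ?thesis using f(2) by (simp add: abs_le_iff)
    qed
    have vel: "\<bar>v y z\<bar> \<le> S * (8 ^ Suc n * z ^ Suc (2 * n) / fact (Suc (2 * n)))" if z: "z \<in> {0..t}" for y z
      using compare[OF v_deriv zero(2) z acc] .
    have "\<bar>w y r\<bar> \<le> S * (8 ^ Suc n * r ^ Suc (Suc (2 * n)) / fact (Suc (Suc (2 * n))))"
      using compare[OF w_deriv zero(1) Suc.prems vel] .
    then show ?case by (simp only: mult_Suc_right add_2_eq_Suc)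
  qed
  have "(\<lambda>n. (3 * t) ^ n /\<^sub>R fact n) \<longlonglongrightarrow> 0"
    by (rule summable_LIMSEQ_zero[OF summable_exp_generic])
  from LIMSEQ_subseq_LIMSEQ[OF this, of "\<lambda>n. 2 * n"]
  have lim: "(\<lambda>n. S * ((3 * t) ^ (2 * n) / fact (2 * n))) \<longlonglongrightarrow> 0"
    by (intro tendsto_mult_right_zero) (simp add: o_def strict_mono_def divide_inverse mult.commute)
  have Spos: "0 \<le> S" using S[of 0 0] t by force
  have "\<bar>w y t\<bar> \<le> S * ((3 * t) ^ (2 * n) / fact (2 * n))" for n
  proof -
    \<comment> \<open>The square 9 replaces 8 so that the bound becomes a term of the series of
      \<open>exp (3 * t)\<close>.\<close>
    have "(8::real) ^ n \<le> 9 ^ n" by (intro power_mono) auto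
    then have "8 ^ n * t ^ (2 * n) \<le> (3 * t) ^ (2 * n)"
      using t by (simp add: power_mult_distrib power_mult mult_right_mono)
    then have "S * (8 ^ n * t ^ (2 * n) / fact (2 * n)) \<le> S * ((3 * t) ^ (2 * n) / fact (2 * n))"
      using Spos by (intro mult_left_mono divide_right_mono) auto
    then show ?thesis using *[of t y n] t by auto
  qed
  then have "\<bar>w y t\<bar> \<le> 0" by (intro LIMSEQ_le_const[OF lim]) auto
  then show ?thesis by simp
qed

end

section \<open>Power series solution\<close>

lemma norm_term_bound:
  fixes c :: "nat \<Rightarrow> real"
  assumes "\<bar>c n\<bar> \<le> 3 ^ n"
  shows "norm (c n / fact n * t ^ n) \<le> (3 * \<bar>t\<bar>) ^ n / fact n"
  using mult_right_mono[OF assms, of "\<bar>t\<bar> ^ n"]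
  by (simp add: abs_mult power_abs power_mult_distrib divide_right_mono)

lemma exp_type_summable:
  fixes c :: "nat \<Rightarrow> real"
  assumes "\<And>n. \<bar>c n\<bar> \<le> 3 ^ n"
  shows "summable (\<lambda>n. c n / fact n * t ^ n)"
proof (rule summable_comparison_test)
  show "summable (\<lambda>n. (3 * \<bar>t\<bar>) ^ n / fact n)"
    using summable_exp[of "3 * \<bar>t\<bar>"] by (simp add: divide_inverse mult.commute)
  show "\<exists>N. \<forall>n\<ge>N. norm (c n / fact n * t ^ n) \<le> (3 * \<bar>t\<bar>) ^ n / fact n"
    using norm_term_bound assms by blast
qed

lemma exp_type_bound:
  fixes c :: "nat \<Rightarrow> real"
  assumes "\<And>n. \<bar>c n\<bar> \<le> 3 ^ n"
  shows "\<bar>\<Sum>n. c n / fact n * t ^ n\<bar> \<le> exp (3 * \<bar>t\<bar>)"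
proof -
  have "norm (\<Sum>n. c n / fact n * t ^ n) \<le> (\<Sum>n. (3 * \<bar>t\<bar>) ^ n / fact n)"
    using norm_term_bound assms summable_exp[of "3 * \<bar>t\<bar>"]
    by (intro norm_suminf_le) (auto simp: divide_inverse mult.commute)
  then show ?thesis by (simp add: exp_def divide_inverse mult.commute)
qed

text \<open>\<open>site_coeff m n y\<close> is the \<open>n\<close>-th time derivative at \<open>t = 0\<close> of the field at the site \<open>y\<close>.\<close>

fun site_coeff :: "(int \<Rightarrow> real) \<Rightarrow> nat \<Rightarrow> int \<Rightarrow> real" where
  "site_coeff m 0 y = (if y = 0 then 1 else 0)"
| "site_coeff m (Suc 0) y = 0"
| "site_coeff m (Suc (Suc n)) y =
     (site_coeff m n (y + 1) + site_coeff m n (y - 1) - 2 * site_coeff m n y) / (1 + m y)"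

text \<open>Two derivatives cost the factor \<open>4 / (1 / 2) = 8\<close>, which is below
  \<open>3 ^ 2\<close>.\<close>

lemma site_coeff_bound:
  assumes "\<And>y. m y \<ge> - 1 / 2"
  shows "\<bar>site_coeff m n y\<bar> \<le> 3 ^ n"
  using assms
proof (induction m n y rule: site_coeff.induct)
  case (3 m n y)
  have "\<bar>site_coeff m n (y + 1) + site_coeff m n (y - 1) - 2 * site_coeff m n y\<bar> \<le> 4 * 3 ^ n"
    using 3(1,2,3)[OF 3(4)] by (simp add: abs_le_iff)
  also have "\<dots> \<le> 3 ^ Suc (Suc n) * (1 + m y)"
    using 3(4)[of y] mult_left_mono[of "1/2" "1 + m y" "9 * 3 ^ n"] by simp
  finally show ?case using 3(4)[of y] by (simp add: divide_le_eq abs_of_pos)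
qed auto

text \<open>Finite speed of propagation: the equation has second order and couples neighbours, so
  the disturbance needs two more derivatives for each further site.\<close>

lemma site_coeff_eq_0: "int n < 2 * \<bar>y\<bar> \<Longrightarrow> site_coeff m n y = 0"
proof (induction m n y rule: site_coeff.induct)
  case (3 m n y)
  have "int n < 2 * \<bar>y + 1\<bar>" "int n < 2 * \<bar>y - 1\<bar>" "int n < 2 * \<bar>y\<bar>"
    using 3(4) by simp_all arith+
  with 3 have "site_coeff m n (y + 1) = 0" "site_coeff m n (y - 1) = 0" "site_coeff m n y = 0"
    by auto
  then show ?case by simp
qed auto

definition lattice_field :: "(int \<Rightarrow> real) \<Rightarrow> int \<Rightarrow> real \<Rightarrow> real" where
  "lattice_field m y t = (\<Sum>n. site_coeff m n y / fact n * t ^ n)"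

lemma suminf_0_only:
  fixes c :: "nat \<Rightarrow> real"
  shows "(\<Sum>n. c n / fact n * 0 ^ n) = c 0"
  using powser_zero[of "\<lambda>n. c n / fact n"] by simp

lemma ell2_bounded:
  assumes "ell2 f"
  shows "\<exists>M. \<forall>y. \<bar>f y\<bar> \<le> M"
proof -
  have "\<bar>f y\<bar> \<le> sqrt (\<Sum>\<^sub>\<infinity>y. (f y)\<^sup>2)" for y
  proof -
    have "(\<Sum>\<^sub>\<infinity>y\<in>{y}. (f y)\<^sup>2) \<le> (\<Sum>\<^sub>\<infinity>y. (f y)\<^sup>2)"
      using assms unfolding ell2_def by (intro infsum_mono_neutral) auto
    then show ?thesis by (intro real_le_rsqrt) auto
  qed
  then show ?thesis by blast
qed


lemma lattice_solution_eq_lattice_field: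
  assumes sol: "lattice_solution 0 m u" and mass: "\<And>y. m y \<ge> - 1 / 2" and t: "t \<ge> 0"
  shows "u y t = lattice_field m y t"
proof -
  from sol obtain v a where
    ell2: "\<And>t. ell2 (\<lambda>x. u x t)" and
    u_deriv: "\<And>y t. (u y has_real_derivative v y t) (at t)" and
    v_deriv: "\<And>y t. (v y has_real_derivative a y t) (at t)" and
    motion: "\<And>y t. (1 + m y) * a y t = u (y + 1) t + u (y - 1) t - 2 * u y t" and
    u0: "\<And>y. u y 0 = (if y = 0 then 1 else 0)" and v0: "\<And>y. v y 0 = 0"
    unfolding lattice_solution_def by auto
  define d where "d k y t = (\<Sum>n. site_coeff m (n + k) y / fact n * t ^ n)" for k y and t :: real
  \<comment> \<open>Shifting the index by \<open>k\<close> may raise the coefficients by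
    \<open>3 ^ k\<close>; dividing this out makes the summability lemma applicable to every
    derivative \<open>d k\<close> of the series.\<close>
  have bound: "\<bar>site_coeff m (n + k) y / 3 ^ k\<bar> \<le> 3 ^ n" for n k y
    using site_coeff_bound[of m, OF mass, of "n + k" y] by (simp add: power_add divide_le_eq)
  have summable: "summable (\<lambda>n. site_coeff m (n + k) y / fact n * t ^ n)" for k y t
    using summable_mult[OF exp_type_summable[OF bound[of _ k y], of t], of "3 ^ k"] by simp
  have d_deriv: "(d k y has_real_derivative d (Suc k) y t) (at t)" for k y t
  proof -
    have "diffs (\<lambda>n. site_coeff m (n + k) y / fact n) = (\<lambda>n. site_coeff m (n + Suc k) y / fact n)"
      by (auto simp: diffs_def fun_eq_iff fact_Suc simp del: of_nat_Suc site_coeff.simps)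
    with termdiffs_strong_converges_everywhere[OF summable[of k y], of t]
    show ?thesis unfolding d_def by simp
  qed
  have d_motion: "(1 + m y) * d 2 y t = d 0 (y + 1) t + d 0 (y - 1) t - 2 * d 0 y t" for y t
  proof -
    have "(1 + m y) * d 2 y t = (\<Sum>n. (1 + m y) * (site_coeff m (n + 2) y / fact n * t ^ n))"
      unfolding d_def by (rule suminf_mult[symmetric, OF summable])
    also have "\<dots> = (\<Sum>n. site_coeff m (n + 0) (y + 1) / fact n * t ^ n + site_coeff m (n + 0) (y - 1) / fact n * t ^ n
        - 2 * (site_coeff m (n + 0) y / fact n * t ^ n))"
    proof (rule suminf_cong)
      fix n
      have "(1 + m y) * site_coeff m (n + 2) y = site_coeff m n (y + 1) + site_coeff m n (y - 1) - 2 * site_coeff m n y"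
        using mass[of y] by (simp add: numeral_2_eq_2)
      then have "(1 + m y) * (site_coeff m (n + 2) y / fact n * t ^ n) =
          (site_coeff m n (y + 1) + site_coeff m n (y - 1) - 2 * site_coeff m n y) / fact n * t ^ n"
        by (simp only: mult.assoc[symmetric] times_divide_eq_right)
      then show "(1 + m y) * (site_coeff m (n + 2) y / fact n * t ^ n) = site_coeff m (n + 0) (y + 1) / fact n * t ^ n + site_coeff m (n + 0) (y - 1) / fact n * t ^ n
        - 2 * (site_coeff m (n + 0) y / fact n * t ^ n)"
        by (simp add: algebra_simps add_divide_distrib diff_divide_distrib)
    qed
    also have "\<dots> = d 0 (y + 1) t + d 0 (y - 1) t - 2 * d 0 y t"
      unfolding d_def
      by (intro sums_unique[symmetric] sums_diff sums_add sums_mult summable_sums summable)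
    finally show ?thesis .
  qed
  \<comment> \<open>The difference of the given motion and the series has zero data. Square
    summability of \<open>u\<close> bounds it at each time separately, which is all that the locale
    asks for.\<close>
  interpret bounded_lattice_motion m "\<lambda>y t. u y t - d 0 y t" "\<lambda>y t. v y t - d 1 y t" "\<lambda>y t. a y t - d 2 y t"
  proof
    show "((\<lambda>t. u y t - d 0 y t) has_real_derivative v y t - d 1 y t) (at t)" for y t
      using DERIV_diff[OF u_deriv d_deriv] by simp
    show "((\<lambda>t. v y t - d 1 y t) has_real_derivative a y t - d 2 y t) (at t)" for y t
      using DERIV_diff[OF v_deriv d_deriv[of 1]] by (simp add: numeral_2_eq_2)
    show "(1 + m y) * (a y t - d 2 y t) =
      u (y + 1) t - d 0 (y + 1) t + (u (y - 1) t - d 0 (y - 1) t) - 2 * (u y t - d 0 y t)" for y t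
      using motion[of y t] d_motion[of y t] by (simp add: algebra_simps)
    show "\<exists>M. \<forall>y. \<bar>u y t - d 0 y t\<bar> \<le> M" for t
    proof -
      from ell2_bounded[OF ell2[of t]] obtain M where M: "\<And>y. \<bar>u y t\<bar> \<le> M" by blast
      have d0: "\<bar>d 0 y t\<bar> \<le> exp (3 * \<bar>t\<bar>)" for y
        using exp_type_bound[of "\<lambda>n. site_coeff m n y"] site_coeff_bound[OF mass] by (simp add: d_def)
      have "\<bar>u y t - d 0 y t\<bar> \<le> M + exp (3 * \<bar>t\<bar>)" for y
        using M[of y] d0[of y] by linarith
      then show ?thesis by blast
    qed
  qed (use mass in auto)
  have "u y t - d 0 y t = 0"
    using zero_of_zero_data[OF _ _ t, of y] u0 v0
      suminf_0_only[of "\<lambda>n. site_coeff m (n + 0) _"] suminf_0_only[of "\<lambda>n. site_coeff m (n + 1) _"]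
    by (simp add: d_def)
  then show ?thesis by (simp add: d_def lattice_field_def)
qed

text \<open>The coefficients are rational functions of finitely many masses. Through the
  identification of \<open>u\<close> with the series, this is what makes the expectation in the
  theorem meaningful.\<close>

lemma borel_measurable_lattice_field:
  assumes "\<And>y. (\<lambda>\<omega>. m \<omega> y) \<in> borel_measurable M"
  shows "(\<lambda>\<omega>. lattice_field (m \<omega>) y t) \<in> borel_measurable M"
proof -
  have [measurable]: "(\<lambda>\<omega>. site_coeff (m \<omega>) n y) \<in> borel_measurable M" for n y
  proof (induction n arbitrary: y rule: induct_nat_012)
    case (ge2 n)
    have [measurable]: "(\<lambda>\<omega>. site_coeff (m \<omega>) n y) \<in> borel_measurable M" for y by (rule ge2)
    have [measurable]: "(\<lambda>\<omega>. m \<omega> y) \<in> borel_measurable M" by (rule assms)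
    show ?case by simp
  qed auto
  show ?thesis unfolding lattice_field_def by measurable
qed

lemma site_coeff_scale:
  assumes "\<kappa> > 0" "\<And>y. 1 + m' y = (1 + m y) / \<kappa>\<^sup>2"
  shows "site_coeff m' n y = \<kappa> ^ n * site_coeff m n y"
  using assms
proof (induction m n y rule: site_coeff.induct)
  case (3 m n y)
  have IH: "site_coeff m' n (y + 1) = \<kappa> ^ n * site_coeff m n (y + 1)"
    "site_coeff m' n (y - 1) = \<kappa> ^ n * site_coeff m n (y - 1)"
    "site_coeff m' n y = \<kappa> ^ n * site_coeff m n y"
    using 3 by auto
  show ?case unfolding site_coeff.simps IH 3(5) using 3(4)
    by (simp add: power2_eq_square algebra_simps)
qed auto

text \<open>The realisation of the masses only gives some positive lower bound; rescaling time
  reduces to masses at least \<open>1 / 2\<close>.\<close>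

lemma lattice_solution_unique:
  assumes sol: "lattice_solution 0 m u" and \<delta>: "\<delta> > 0" "\<And>y. \<delta> \<le> 1 + m y" and t: "t \<ge> 0"
  shows "u y t = lattice_field m y t"
proof -
  \<comment> \<open>Chosen so that the rescaled masses \<open>(1 + m y) / \<kappa>\<^sup>2\<close>
    are at least \<open>\<delta> / (2 * \<delta>) = 1 / 2\<close>.\<close>
  define \<kappa> where "\<kappa> = sqrt (2 * \<delta>)"
  have \<kappa>: "\<kappa> > 0" "\<kappa>\<^sup>2 = 2 * \<delta>" using \<delta>(1) by (auto simp: \<kappa>_def)
  define m' where "m' y = (1 + m y) / \<kappa>\<^sup>2 - 1" for y
  define u' where "u' y t = u y (\<kappa> * t)" for y t
  from sol obtain v a where
    ell2: "\<And>t. ell2 (\<lambda>x. u x t)" and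
    u_deriv: "\<And>y t. (u y has_real_derivative v y t) (at t)" and
    v_deriv: "\<And>y t. (v y has_real_derivative a y t) (at t)" and
    motion: "\<And>y t. (1 + m y) * a y t = u (y + 1) t + u (y - 1) t - 2 * u y t" and
    u0: "\<And>y. u y 0 = (if y = 0 then 1 else 0)" and v0: "\<And>y. v y 0 = 0"
    unfolding lattice_solution_def by auto
  have chain: "((\<lambda>t. f (\<kappa> * t)) has_real_derivative f' * \<kappa>) (at t)"
    if "(f has_real_derivative f') (at (\<kappa> * t))" for f f' t
    by (rule DERIV_chain2[where f = f and g = "\<lambda>t. \<kappa> * t" and x = t, OF that]) (auto intro!: derivative_eq_intros)
  define v' a' where "v' y t = v y (\<kappa> * t) * \<kappa>" and "a' y t = a y (\<kappa> * t) * \<kappa> * \<kappa>" for y t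
  have "(u' y has_real_derivative v' y t) (at t)" for y t
    unfolding u'_def[abs_def] v'_def by (rule chain) (rule u_deriv)
  moreover have "(v' y has_real_derivative a' y t) (at t)" for y t
    unfolding v'_def[abs_def] a'_def by (intro DERIV_cmult_right chain v_deriv)
  moreover have "(1 + m' y) * a' y t = u' (y + 1) t + u' (y - 1) t - (2 + 0) * u' y t" for y t
    using motion[of y "\<kappa> * t"] \<kappa>(1) by (simp add: m'_def u'_def a'_def power2_eq_square)
  moreover have "ell2 (\<lambda>x. u' x t)" "u' y 0 = (if y = 0 then 1 else 0)" "v' y 0 = 0" for y t
    using ell2 by (simp_all add: u'_def v'_def u0 v0)
  ultimately have "lattice_solution 0 m' u'"
    unfolding lattice_solution_def by blast
  moreover have "m' y \<ge> - 1 / 2" for y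
    using \<delta>(2)[of y] \<delta>(1) unfolding m'_def \<kappa>(2) by (simp add: field_simps)
  ultimately have "u' y (t / \<kappa>) = lattice_field m' y (t / \<kappa>)"
    using t \<kappa>(1) by (intro lattice_solution_eq_lattice_field) auto
  also have "\<dots> = lattice_field m y t"
  proof -
    have "site_coeff m' n y / fact n * (t / \<kappa>) ^ n = site_coeff m n y / fact n * t ^ n" for n
      using \<kappa>(1) by (subst site_coeff_scale[of \<kappa> m' m]) (auto simp: m'_def power_divide)
    then show ?thesis unfolding lattice_field_def by simp
  qed
  finally show ?thesis using \<kappa>(1) by (simp add: u'_def)
qed

section \<open>Borel transform of the field\<close>

text \<open>The Laplace transform of the series with terms \<open>c n / fact n * t ^ n\<close>,
  expanded at infinity. Coefficients of size \<open>3 ^ n\<close> explain the radius 4 used below: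
  it leaves the convergence ratio \<open>3 / 4\<close>.\<close>

definition z_transform :: "(nat \<Rightarrow> real) \<Rightarrow> complex \<Rightarrow> complex" where
  "z_transform c s = (\<Sum>n. of_real (c n) / s ^ Suc n)"

lemma z_transform_term_bound:
  fixes s :: complex
  assumes "\<bar>c n\<bar> \<le> 3 ^ n" "4 \<le> norm s"
  shows "norm (of_real (c n) / s ^ Suc n) \<le> (3 / 4) ^ n / 4"
proof -
  have "norm (of_real (c n) / s ^ Suc n) = \<bar>c n\<bar> / norm s ^ Suc n"
    by (simp add: norm_divide norm_power norm_mult)
  also have "\<dots> \<le> 3 ^ n / 4 ^ Suc n"
    using assms by (intro frac_le power_mono) auto
  finally show ?thesis by (simp add: power_divide)
qed

lemma geometric_three_quarters: "summable (\<lambda>n. (3 / 4) ^ n / 4 :: real)"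
  "(\<Sum>n. (3 / 4) ^ n / 4 :: real) = 1"
  using suminf_geometric[of "3/4 :: real"] summable_geometric[of "3/4 :: real"]
  by (auto simp: suminf_divide summable_divide)

lemma z_transform_summable:
  fixes s :: complex
  assumes "\<And>n. \<bar>c n\<bar> \<le> 3 ^ n" "4 \<le> norm s"
  shows "summable (\<lambda>n. of_real (c n) / s ^ Suc n)"
  by (rule summable_comparison_test[OF _ geometric_three_quarters(1)])
     (use z_transform_term_bound assms in blast)

text \<open>By finite speed the first \<open>k\<close> coefficients vanish, and the tail of the
  geometric series is small in every direction of \<open>s\<close>. In the left half plane this is
  the estimate that is used.\<close>

lemma z_transform_bound:
  assumes c: "\<And>n. \<bar>c n\<bar> \<le> 3 ^ n" and s: "4 \<le> norm s" and zero: "\<And>n. n < k \<Longrightarrow> c n = 0"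
  shows "norm (z_transform c s) \<le> (3 / 4) ^ k"
proof -
  have "z_transform c s = (\<Sum>n. of_real (c (n + k)) / s ^ Suc (n + k))"
    unfolding z_transform_def
    using suminf_split_initial_segment[OF z_transform_summable[of c s, OF c s], of k] zero by simp
  also have "norm \<dots> \<le> (\<Sum>n. (3 / 4) ^ k * ((3 / 4) ^ n / 4))"
  proof (rule norm_suminf_le)
    show "norm (of_real (c (n + k)) / s ^ Suc (n + k)) \<le> (3 / 4) ^ k * ((3 / 4) ^ n / 4)" for n
      using z_transform_term_bound[OF c s, where n = "n + k"] by (simp add: power_add mult.commute)
    show "summable (\<lambda>n. (3 / 4) ^ k * ((3 / 4) ^ n / 4) :: real)"
      using geometric_three_quarters(1) by (rule summable_mult)
  qed
  also have "\<dots> = (3 / 4) ^ k"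
    using suminf_mult[OF geometric_three_quarters(1), of "(3/4) ^ k"] geometric_three_quarters(2) by simp
  finally show ?thesis .
qed

text \<open>The rule for the Laplace transform of a second derivative, with its two initial
  values.\<close>

lemma z_transform_shift:
  assumes c: "\<And>n. \<bar>c n\<bar> \<le> 3 ^ n" and s: "4 \<le> norm s"
  shows "s ^ 2 * z_transform c s = c 0 * s + c 1 + (\<Sum>n. of_real (c (n + 2)) / s ^ Suc n)"
proof -
  have nz: "s \<noteq> 0" using s by auto
  have sm: "summable (\<lambda>n. of_real (c (n + 2)) / s ^ Suc (n + 2))"
    using summable_ignore_initial_segment[OF z_transform_summable[of c s, OF c s], of 2] .
  have "z_transform c s = c 0 / s + c 1 / s ^ 2 + (\<Sum>n. of_real (c (n + 2)) / s ^ Suc (n + 2))"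
    unfolding z_transform_def
    using suminf_split_initial_segment[OF z_transform_summable[of c s, OF c s], of 2]
    by (simp add: numeral_2_eq_2)
  also have "s ^ 2 * \<dots> = c 0 * s + c 1 + s ^ 2 * (\<Sum>n. of_real (c (n + 2)) / s ^ Suc (n + 2))"
    using nz by (simp add: field_simps power2_eq_square)
  also have "s ^ 2 * (\<Sum>n. of_real (c (n + 2)) / s ^ Suc (n + 2))
      = (\<Sum>n. s ^ 2 * (of_real (c (n + 2)) / s ^ Suc (n + 2)))"
    by (rule suminf_mult[symmetric, OF sm])
  also have "\<dots> = (\<Sum>n. of_real (c (n + 2)) / s ^ Suc n)"
    using nz by (intro suminf_cong) (simp add: field_simps power2_eq_square)
  finally show ?thesis .
qed

lemma higher_deriv_exp_mult: "(deriv ^^ k) (\<lambda>s. exp (s * t)) z = t ^ k * exp (z * t :: complex)"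
proof (induction k arbitrary: z)
  case (Suc k)
  then have *: "(deriv ^^ k) (\<lambda>s. exp (s * t)) = (\<lambda>z. t ^ k * exp (z * t))" by blast
  have "((\<lambda>z. t ^ k * exp (z * t)) has_field_derivative t ^ Suc k * exp (z * t)) (at z)"
    by (auto intro!: derivative_eq_intros)
  then show ?case by (simp add: * DERIV_imp_deriv)
qed simp

text \<open>Each term is Cauchy's formula for the \<open>k\<close>-th derivative of
  \<open>exp (s * t)\<close> at 0; uniform convergence on the circle permits summation under the
  integral.\<close>

lemma exp_series_contour_integral:
  fixes c :: "nat \<Rightarrow> real" and t :: real
  assumes c: "\<And>n. \<bar>c n\<bar> \<le> 3 ^ n"
  shows "(\<lambda>s. exp (s * t) * z_transform c s) contour_integrable_on circlepath 0 4"
    and "contour_integral (circlepath 0 4) (\<lambda>s. exp (s * t) * z_transform c s)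
           = 2 * pi * \<i> * of_real (\<Sum>n. c n / fact n * t ^ n)"
proof -
  let ?f = "\<lambda>k (s::complex). exp (s * t) * (of_real (c k) / s ^ Suc k)"
  have summand: "(?f k has_contour_integral 2 * pi * \<i> * of_real (c k / fact k * t ^ k)) (circlepath 0 4)" for k
  proof -
    have "((\<lambda>u. exp (u * t) / (u - 0) ^ Suc k) has_contour_integral
        2 * pi * \<i> / fact k * (deriv ^^ k) (\<lambda>s. exp (s * complex_of_real t)) 0) (circlepath 0 4)"
      by (rule Cauchy_has_contour_integral_higher_derivative_circlepath)
         (auto intro!: continuous_intros holomorphic_intros)
    from has_contour_integral_lmul[OF this, of "of_real (c k)"]
    show ?thesis by (simp add: higher_deriv_exp_mult field_simps)
  qed
  have partial: "((\<lambda>s. \<Sum>k<n. ?f k s) has_contour_integral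
      (\<Sum>k<n. 2 * pi * \<i> * of_real (c k / fact k * t ^ k))) (circlepath 0 4)" for n
    by (intro has_contour_integral_sum summand) auto
  have unif: "uniform_limit (sphere 0 4) (\<lambda>n s. \<Sum>k<n. ?f k s) (\<lambda>s. \<Sum>k. ?f k s) sequentially"
  proof (rule Weierstrass_m_test)
    show "norm (?f k s) \<le> exp (4 * \<bar>t\<bar>) * ((3 / 4) ^ k / 4)" if "s \<in> sphere 0 4" for k s
    proof -
      have "norm (exp (s * t)) \<le> exp (4 * \<bar>t\<bar>)"
        using norm_exp[of "s * t"] that by (simp add: norm_mult)
      moreover have "norm (of_real (c k) / s ^ Suc k) \<le> (3 / 4) ^ k / 4"
        using that by (intro z_transform_term_bound c) auto
      ultimately show ?thesis unfolding norm_mult by (intro mult_mono) auto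
    qed
    show "summable (\<lambda>k. exp (4 * \<bar>t\<bar>) * ((3 / 4) ^ k / 4))"
      using geometric_three_quarters(1) by (rule summable_mult)
  qed
  have eq: "(\<Sum>k. ?f k s) = exp (s * t) * z_transform c s" if "s \<in> sphere 0 4" for s
    unfolding z_transform_def using that by (intro suminf_mult z_transform_summable c) auto
  have unif': "uniform_limit (sphere 0 4) (\<lambda>n s. \<Sum>k<n. ?f k s)
      (\<lambda>s. exp (s * complex_of_real t) * z_transform c s) sequentially"
    by (rule uniform_limit_cong'[THEN iffD1, OF refl eq unif])
  note lim = contour_integral_uniform_limit_circlepath[OF _ unif']
  show "(\<lambda>s. exp (s * t) * z_transform c s) contour_integrable_on circlepath 0 4"
    by (rule lim(1)) (use partial in \<open>auto simp only: contour_integrable_on_def sequentially_bot intro!: always_eventually\<close>)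
  have "(\<lambda>n. contour_integral (circlepath 0 4) (\<lambda>s. \<Sum>k<n. ?f k s)) \<longlonglongrightarrow>
      contour_integral (circlepath 0 4) (\<lambda>s. exp (s * t) * z_transform c s)"
    by (rule lim(2)) (use partial in \<open>auto simp only: contour_integrable_on_def sequentially_bot intro!: always_eventually\<close>)
  then have l1: "(\<lambda>n. \<Sum>k<n. 2 * pi * \<i> * of_real (c k / fact k * t ^ k)) \<longlonglongrightarrow>
      contour_integral (circlepath 0 4) (\<lambda>s. exp (s * t) * z_transform c s)"
    using contour_integral_unique[OF partial] by simp
  have "(\<lambda>k. 2 * pi * \<i> * of_real (c k / fact k * t ^ k)) sums
      (2 * pi * \<i> * of_real (\<Sum>n. c n / fact n * t ^ n))"
    using c by (intro sums_mult sums_of_real summable_sums exp_type_summable)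
  then show "contour_integral (circlepath 0 4) (\<lambda>s. exp (s * t) * z_transform c s)
           = 2 * pi * \<i> * of_real (\<Sum>n. c n / fact n * t ^ n)"
    using l1 LIMSEQ_unique unfolding sums_def by blast
qed

section \<open>Resolvent and transmission factor\<close>

text \<open>Solution of \<open>b - 1 / b = s\<close> with \<open>\<bar>b\<bar> > 1\<close>: in the homogeneous lattice the resolvent
  at \<open>s\<^sup>2\<close> decays like \<open>b\<close> to the power \<open>-2\<bar>y\<bar>\<close>.\<close>

definition decay_root :: "complex \<Rightarrow> complex" where
  "decay_root s = s / 2 + csqrt (1 + s\<^sup>2 / 4)"

lemma decay_root_mult: "decay_root s * (csqrt (1 + s\<^sup>2 / 4) - s / 2) = 1"
proof -
  have "decay_root s * (csqrt (1 + s\<^sup>2 / 4) - s / 2) = (csqrt (1 + s\<^sup>2 / 4))\<^sup>2 - s\<^sup>2 / 4"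
    by (simp add: decay_root_def algebra_simps power2_eq_square)
  then show ?thesis by (simp only: power2_csqrt) simp
qed

lemma decay_root_nonzero: "decay_root s \<noteq> 0"
  using decay_root_mult[of s] by auto

lemma inverse_decay_root: "1 / decay_root s = csqrt (1 + s\<^sup>2 / 4) - s / 2"
  using decay_root_mult[of s] decay_root_nonzero[of s] by (simp add: field_simps)

lemma decay_root_minus: "decay_root s - 1 / decay_root s = s"
  unfolding inverse_decay_root by (simp add: decay_root_def)

lemma decay_root_plus: "decay_root s + 1 / decay_root s = 2 * csqrt (1 + s\<^sup>2 / 4)"
  unfolding inverse_decay_root by (simp add: decay_root_def)

lemma Re_decay_root_ge_half: "Re s / 2 \<le> Re (decay_root s)"
  using csqrt_principal[of "1 + s\<^sup>2 / 4"] by (auto simp: decay_root_def)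

lemma Re_one_div: "Re (1 / z) = Re z / (norm z)\<^sup>2" and Im_one_div: "Im (1 / z) = - Im z / (norm z)\<^sup>2"
  by (simp_all add: Re_divide Im_divide cmod_power2)

lemma Re_eq_decay_root: "Re s = Re (decay_root s) * (1 - 1 / (norm (decay_root s))\<^sup>2)"
  using arg_cong[OF decay_root_minus[of s], of Re] by (simp add: Re_one_div algebra_simps del: one_divide_eq_0_iff)

lemma Im_eq_decay_root: "Im s = Im (decay_root s) * (1 + 1 / (norm (decay_root s))\<^sup>2)"
  using arg_cong[OF decay_root_minus[of s], of Im] by (simp add: Im_one_div algebra_simps)

context
  fixes s :: complex
  assumes s: "Re s > 0"
begin

lemma Re_decay_root_pos: "Re (decay_root s) > 0"
  using Re_decay_root_ge_half[of s] s by simp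

lemma norm_decay_root_gt_1: "norm (decay_root s) > 1"
proof (rule ccontr)
  assume "\<not> ?thesis"
  then have "(norm (decay_root s))\<^sup>2 \<le> 1" by (simp add: power_le_one)
  then have "1 \<le> 1 / (norm (decay_root s))\<^sup>2"
    using decay_root_nonzero[of s] by (simp add: field_simps)
  then have "Re (decay_root s) * (1 - 1 / (norm (decay_root s))\<^sup>2) \<le> 0"
    using Re_decay_root_pos by (intro mult_nonneg_nonpos) auto
  then show False using Re_eq_decay_root[of s] s by simp
qed

lemma Re_le_Re_decay_root: "Re s \<le> Re (decay_root s)"
proof -
  have "Re (decay_root s) * (1 - 1 / (norm (decay_root s))\<^sup>2) \<le> Re (decay_root s) * 1"
    using Re_decay_root_pos by (intro mult_left_mono) auto
  then show ?thesis using Re_eq_decay_root[of s] by simp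
qed

text \<open>The left side is twice the root of \<open>(s - 2 * \<i>) * (s + 2 * \<i>) / 4\<close>,
  which vanishes at the upper band edge. Both factors have real part \<open>Re s\<close>, so this
  weak bound survives near the edge.\<close>

lemma norm_decay_root_plus: "norm (decay_root s + 1 / decay_root s) \<ge> Re s"
proof -
  have "1 + s\<^sup>2 / 4 = (s - 2 * \<i>) * (s + 2 * \<i>) / 4" by (simp add: algebra_simps power2_eq_square)
  then have "norm (1 + s\<^sup>2 / 4) = norm (s - 2 * \<i>) * norm (s + 2 * \<i>) / 4"
    by (simp only: norm_mult norm_divide) simp
  moreover have "Re s * Re s \<le> norm (s - 2 * \<i>) * norm (s + 2 * \<i>)"
    using complex_Re_le_cmod[of "s - 2 * \<i>"] complex_Re_le_cmod[of "s + 2 * \<i>"] s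
    by (intro mult_mono) auto
  ultimately have "Re s * Re s / 4 \<le> norm (1 + s\<^sup>2 / 4)" by simp
  then have "sqrt ((Re s / 2)\<^sup>2) \<le> sqrt (norm (1 + s\<^sup>2 / 4))"
    by (intro real_sqrt_le_mono) (simp add: power2_eq_square)
  then show ?thesis using s unfolding decay_root_plus norm_mult by (simp add: norm_csqrt)
qed

text \<open>For \<open>\<bar>Im s\<bar> \<le> 1\<close> the band edges \<open>2 * \<i>\<close> and
  \<open>- 2 * \<i>\<close> are far away, so the bounds do not degenerate as \<open>Re s\<close>
  tends to 0, in contrast to \<open>Re_le_Re_decay_root\<close> and
  \<open>norm_decay_root_plus\<close>.\<close>

lemma low_frequency_bounds:
  assumes "\<bar>Im s\<bar> \<le> 1"
  shows "Re (decay_root s) \<ge> 1 / 2" "norm (decay_root s + 1 / decay_root s) \<ge> 1"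
proof -
  let ?z = "1 + s\<^sup>2 / 4"
  have "(Im s)\<^sup>2 \<le> 1" using assms by (simp add: abs_square_le_1)
  moreover have "0 \<le> (Re s)\<^sup>2" by simp
  ultimately have "- 1 \<le> (Re s)\<^sup>2 - (Im s)\<^sup>2" by linarith
  then have "1 / 4 \<le> 1 + ((Re s)\<^sup>2 - (Im s)\<^sup>2) / 4" by argo
  also have "\<dots> = Re ?z" by (simp add: power2_eq_square)
  finally have z: "Re ?z \<ge> 1 / 4" .
  then have "cmod ?z \<ge> 1 / 4" using complex_Re_le_cmod[of ?z] by linarith
  then have "sqrt ((1/2)\<^sup>2) \<le> sqrt (cmod ?z)" by (intro real_sqrt_le_mono) (simp add: power2_eq_square)
  then show "norm (decay_root s + 1 / decay_root s) \<ge> 1"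
    unfolding decay_root_plus norm_mult by (simp add: norm_csqrt)
  have "sqrt ((1/2)\<^sup>2) \<le> sqrt ((cmod ?z + Re ?z) / 2)"
  proof (rule real_sqrt_le_mono)
    have "(1/2)\<^sup>2 \<le> (A + B) / 2" if "1 / 4 \<le> A" "1 / 4 \<le> B" for A B :: real
      using that by (simp add: power2_eq_square)
    then show "(1/2)\<^sup>2 \<le> (cmod ?z + Re ?z) / 2" using z \<open>cmod ?z \<ge> 1 / 4\<close> by blast
  qed
  then have "1 / 2 \<le> Re (csqrt ?z)" by simp
  then show "Re (decay_root s) \<ge> 1 / 2" using s by (simp add: decay_root_def)
qed

end

lemma decay_root_holomorphic: "decay_root holomorphic_on {s. Re s > 0}"
proof -
  have "1 + s\<^sup>2 / 4 \<notin> \<real>\<^sub>\<le>\<^sub>0" if "Re s > 0" for s :: complex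
  proof
    assume "1 + s\<^sup>2 / 4 \<in> \<real>\<^sub>\<le>\<^sub>0"
    then have "Im (s\<^sup>2) = 0" "1 + Re (s\<^sup>2) / 4 \<le> 0" by (auto simp: complex_nonpos_Reals_iff)
    moreover from this have "Im s = 0" using that by (auto simp: power2_eq_square)
    moreover have "0 < Re s * Re s" using that by simp
    ultimately show False by (simp add: power2_eq_square)
  qed
  then show ?thesis unfolding decay_root_def
    by (intro holomorphic_intros) auto
qed

text \<open>With \<open>R = exp \<tau>\<close> and \<open>S = R - 1 / R = 2 * sinh \<tau>\<close>
  this reads \<open>2 * arsinh (S / 2) \<ge> S - S ^ 3 / 24\<close>, the beginning of the Taylor
  series.\<close>

lemma ln_square_lower_bound:
  fixes R :: real
  assumes "R \<ge> 1"
  shows "ln (R\<^sup>2) \<ge> (R - 1 / R) - (R - 1 / R) ^ 3 / 24"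
proof -
  let ?f = "\<lambda>R. 2 * ln R - (R - 1 / R) + (R - 1 / R) ^ 3 / 24"
  let ?f' = "\<lambda>R. (R + 1 / R - 2)\<^sup>2 * (R + 1 / R + 4) / (8 * R)"
  have "?f 1 \<le> ?f R"
  proof (rule deriv_nonneg_imp_mono[where g = ?f and g' = ?f'])
    fix r assume "r \<in> {1..R}"
    then have r: "r > 0" by simp
    have "(?f has_real_derivative 2 * (1 / r) - (1 + 1 / r\<^sup>2) + 3 * (r - 1 / r)\<^sup>2 * (1 + 1 / r\<^sup>2) / 24) (at r)"
      using r by (auto intro!: derivative_eq_intros simp: power2_eq_square)
    moreover have "2 * (1 / r) - (1 + 1 / r\<^sup>2) + 3 * (r - 1 / r)\<^sup>2 * (1 + 1 / r\<^sup>2) / 24 = ?f' r"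
      using r by (simp add: field_simps power2_eq_square power3_eq_cube)
    ultimately show "(?f has_real_derivative ?f' r) (at r)" by simp
    show "0 \<le> ?f' r" using r by simp
  qed (use assms in auto)
  then show ?thesis using assms by (simp add: ln_realpow)
qed

text \<open>The origin of the Gaussian: at \<open>Re s = B / X\<close>,
  \<open>Im s = \<rho> / X\<close>, multiplication by \<open>x = X ^ 3\<close> turns the right side
  into \<open>B * X\<^sup>2 + B * \<rho>\<^sup>2 / 20 - B ^ 3\<close>. The range of
  \<open>Im s\<close> covers the whole chord of the circle of radius 4, beyond the band edge at
  2.\<close>

lemma ln_norm_decay_root_lower_bound:
  assumes s: "Re s > 0" "Re s \<le> 1 / 2" "\<bar>Im s\<bar> \<le> 4"
  shows "ln ((norm (decay_root s))\<^sup>2) \<ge> Re s * (1 + (Im s)\<^sup>2 / 20) - (Re s) ^ 3"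
proof -
  define b a l where "b = decay_root s" and "a = Re s" and "l = Im s"
  define R where "R = norm b"
  define S where "S = R - 1 / R"
  have R: "R > 1" unfolding R_def b_def using s by (intro norm_decay_root_gt_1)
  have "1 / R < 1" using R by simp
  then have Spos: "S > 0" using R unfolding S_def by linarith
  have a: "0 < a" "a \<le> 1 / 2" and l: "l\<^sup>2 \<le> 16"
    using s abs_le_square_iff[of l 4] by (auto simp: a_def l_def)
  have "a = Re b * (1 - 1 / R\<^sup>2)" unfolding a_def b_def R_def by (rule Re_eq_decay_root)
  then have aR: "a * R = Re b * S" using R by (simp add: S_def field_simps power2_eq_square)
  have "l = Im b * (1 + 1 / R\<^sup>2)" unfolding l_def b_def R_def by (rule Im_eq_decay_root)
  then have lR: "l * R = Im b * (R + 1 / R)" using R by (simp add: field_simps power2_eq_square)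
  have C: "(R + 1 / R)\<^sup>2 = 4 + S\<^sup>2" using R by (simp add: S_def field_simps power2_eq_square)
  have b2: "(Re b)\<^sup>2 + (Im b)\<^sup>2 = R\<^sup>2" unfolding R_def cmod_power2 ..
  have "(a * R)\<^sup>2 * (4 + S\<^sup>2) + (l * R)\<^sup>2 * S\<^sup>2 = S\<^sup>2 * (4 + S\<^sup>2) * R\<^sup>2"
    unfolding aR lR power_mult_distrib C b2[symmetric] by (simp add: algebra_simps)
  then have "R\<^sup>2 * (a\<^sup>2 * (4 + S\<^sup>2) + l\<^sup>2 * S\<^sup>2) = R\<^sup>2 * (S\<^sup>2 * (4 + S\<^sup>2))"
    by (simp add: algebra_simps power_mult_distrib)
  \<comment> \<open>If \<open>b\<close> has modulus \<open>R\<close> and argument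
    \<open>\<theta>\<close>, then \<open>a = S * cos \<theta>\<close> and
    \<open>l = (R + 1 / R) * sin \<theta>\<close>. Eliminating the angle puts \<open>(a, l)\<close>
    on the ellipse with half axes \<open>S\<close> and \<open>sqrt (4 + S\<^sup>2)\<close>, from
    which \<open>S\<close> is bounded below.\<close>
  then have key: "a\<^sup>2 * (4 + S\<^sup>2) + l\<^sup>2 * S\<^sup>2 = S\<^sup>2 * (4 + S\<^sup>2)" using R by simp
  have "a * (1 + l\<^sup>2 / 20) - a ^ 3 \<le> ln (R\<^sup>2)"
  proof (cases "S \<le> 1")
    case True
    define S1 where "S1 = a * (1 + l\<^sup>2 / 20)"
    have S2: "S\<^sup>2 \<le> 1" using True Spos by (simp add: power_le_one)
    have "a\<^sup>2 * (4 + S\<^sup>2) \<le> S\<^sup>2 * (4 + S\<^sup>2)" using key by (smt (verit) mult_nonneg_nonneg zero_le_power2)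
    then have aS: "a\<^sup>2 \<le> S\<^sup>2" by (rule mult_right_le_imp_le) (smt (verit) zero_le_power2)
    have "(a\<^sup>2 + l\<^sup>2 * a\<^sup>2 / 5) * (4 + S\<^sup>2) \<le> a\<^sup>2 * (4 + S\<^sup>2) + l\<^sup>2 * a\<^sup>2"
      using mult_left_mono[of "(4 + S\<^sup>2) / 5" 1 "l\<^sup>2 * a\<^sup>2"] S2 by (simp add: algebra_simps)
    also have "\<dots> \<le> S\<^sup>2 * (4 + S\<^sup>2)" using mult_left_mono[OF aS, of "l\<^sup>2"] key by simp
    finally have S2_ge: "a\<^sup>2 + l\<^sup>2 * a\<^sup>2 / 5 \<le> S\<^sup>2" by (rule mult_right_le_imp_le) (smt (verit) zero_le_power2)
    have "(1 + l\<^sup>2 / 20)\<^sup>2 \<le> 1 + l\<^sup>2 / 5"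
    proof -
      have "l\<^sup>2 * l\<^sup>2 \<le> 16 * l\<^sup>2" using l by (intro mult_right_mono) auto
      moreover have "0 \<le> l\<^sup>2" by simp
      moreover have "(1 + l\<^sup>2 / 20)\<^sup>2 = 1 + l\<^sup>2 / 10 + (l\<^sup>2 * l\<^sup>2) / 400"
        by (simp add: power2_eq_square algebra_simps)
      ultimately show ?thesis by linarith
    qed
    then have "S1\<^sup>2 \<le> a\<^sup>2 * (1 + l\<^sup>2 / 5)" unfolding S1_def power_mult_distrib by (intro mult_left_mono) auto
    also have "\<dots> \<le> S\<^sup>2" using S2_ge by (simp add: algebra_simps)
    finally have S1S: "S1 \<le> S" by (rule power2_le_imp_le) (use Spos in simp)
    have S1: "0 \<le> S1" "S1 \<le> 2 * a" using a l unfolding S1_def by auto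
    have "S1 ^ 3 \<le> (2 * a) ^ 3" using S1 by (intro power_mono) auto
    moreover have "0 < a ^ 3" using a by simp
    moreover have "(2 * a) ^ 3 = 8 * a ^ 3" by (simp add: power_mult_distrib)
    ultimately have "S1 ^ 3 / 24 \<le> a ^ 3" by linarith
    moreover have "S1 - S1 ^ 3 / 24 \<le> S - S ^ 3 / 24"
    proof -
      have "S * S \<le> 1" "S * S1 \<le> 1" "S1 * S1 \<le> 1" using S1 S1S True Spos by (auto intro!: mult_le_one)
      then have "0 \<le> (S - S1) * (1 - (S * S + S * S1 + S1 * S1) / 24)"
        using S1S by (intro mult_nonneg_nonneg) auto
      then show ?thesis by (simp add: algebra_simps power3_eq_cube diff_divide_distrib)
    qed
    moreover have "S - S ^ 3 / 24 \<le> ln (R\<^sup>2)" unfolding S_def using R by (intro ln_square_lower_bound) auto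
    ultimately show ?thesis unfolding S1_def by linarith
  next
    case False
    \<comment> \<open>The threshold works because \<open>8 / 5 - 5 / 8 < 1\<close>, while the left
      side of the claim is at most \<open>9 / 10\<close>, which is below
      \<open>ln ((8 / 5)\<^sup>2)\<close>.\<close>
    have "8 / 5 \<le> R"
    proof (rule ccontr)
      assume "\<not> 8 / 5 \<le> R"
      then have "R < 8 / 5" "1 / R > 5 / 8" using R by (auto simp: field_simps)
      then show False using False unfolding S_def by simp
    qed
    have "a * (1 + l\<^sup>2 / 20) - a ^ 3 \<le> a * (1 + l\<^sup>2 / 20)" using a by simp
    also have "\<dots> \<le> 1 / 2 * (1 + 16 / 20)" using a l by (intro mult_mono) auto
    also have "\<dots> \<le> ln ((8 / 5)\<^sup>2)"
      using ln_square_lower_bound[of "8/5"] by (simp add: power3_eq_cube)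
    also have "\<dots> \<le> ln (R\<^sup>2)"
      using \<open>8 / 5 \<le> R\<close> by (subst ln_le_cancel_iff) (auto intro!: power_mono)
    finally show ?thesis .
  qed
  then show ?thesis by (simp add: a_def l_def R_def b_def)
qed


text \<open>Sweeping the slab \<open>{1..l}\<close> from its right end. With \<open>y = l - i\<close>, the field
  \<open>f\<close> of the resolvent satisfies \<open>f (y + 1) = (1 - s * slab_adm m l s i) * f y\<close>, and
  \<open>slab_trans m l s i\<close> is the transmission factor of the sites \<open>{y<..l}\<close> relative to the
  homogeneous lattice.\<close>

primrec slab_adm :: "(int \<Rightarrow> real) \<Rightarrow> int \<Rightarrow> complex \<Rightarrow> nat \<Rightarrow> complex" where
  "slab_adm m l s 0 = 1 / decay_root s"
| "slab_adm m l s (Suc i) = 1 / (1 / (slab_adm m l s i + (1 + m (l - int i)) * s) + s)"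

primrec slab_trans :: "(int \<Rightarrow> real) \<Rightarrow> int \<Rightarrow> complex \<Rightarrow> nat \<Rightarrow> complex" where
  "slab_trans m l s 0 = 1"
| "slab_trans m l s (Suc i) = slab_trans m l s i * ((decay_root s + slab_adm m l s i)
     / (decay_root s + slab_adm m l s i + m (l - int i) * s))"

context
  fixes s :: complex and m :: "int \<Rightarrow> real" and l :: int
  assumes s: "Re s > 0" and mass: "\<And>y. m y \<ge> - 1 / 2"
begin

text \<open>The recursion only adds positive multiples of \<open>s\<close> and inverts. Both
  operations preserve the open right half plane, as for the admittance of a passive ladder
  network.\<close>

lemma Re_slab_adm_pos: "Re (slab_adm m l s i) > 0"
proof (induction i)
  case 0
  then show ?case using Re_decay_root_pos[OF s] decay_root_nonzero[of s] by (simp add: Re_one_div)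
next
  case (Suc i)
  have inv: "Re (1 / z) > 0" if "Re z > 0" for z :: complex
    unfolding Re_one_div using that by (intro divide_pos_pos) (auto simp: complex_eq_iff)
  have "0 < (1 + m (l - int i)) * Re s" using s mass[of "l - int i"] by (intro mult_pos_pos) auto
  then have "Re (slab_adm m l s i + (1 + m (l - int i)) * s) > 0" using Suc by simp
  from inv[OF this] s have "Re (1 / (slab_adm m l s i + (1 + m (l - int i)) * s) + s) > 0" by simp
  from inv[OF this] show ?case by simp
qed

text \<open>A mass defect of \<open>- 1 / 2\<close> removes at most
  \<open>Re s / 2 \<le> Re (decay_root s) / 2\<close>, and the admittance contributes with the good
  sign. The bound is uniform in the masses.\<close>

lemma slab_denominator_lower_bounds:
  "Re (decay_root s) / 2 \<le> Re (decay_root s + slab_adm m l s i)"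
  "Re (decay_root s) / 2 \<le> Re (decay_root s + slab_adm m l s i + m y * s)"
proof -
  show "Re (decay_root s) / 2 \<le> Re (decay_root s + slab_adm m l s i)"
    using Re_slab_adm_pos[of i] Re_decay_root_pos[OF s] by simp
  have "- 1 / 2 * Re s \<le> m y * Re s" using mass[of y] s by (intro mult_right_mono) auto
  then show "Re (decay_root s) / 2 \<le> Re (decay_root s + slab_adm m l s i + m y * s)"
    using Re_slab_adm_pos[of i] Re_le_Re_decay_root[OF s] by simp
qed

lemma slab_denominator_nonzero:
  "decay_root s + slab_adm m l s i \<noteq> 0" "decay_root s + slab_adm m l s i + m y * s \<noteq> 0"
proof -
  show "decay_root s + slab_adm m l s i \<noteq> 0"
    using slab_denominator_lower_bounds(1)[of i] Re_decay_root_pos[OF s] by (metis half_gt_zero not_le zero_complex.sel(1))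
  show "decay_root s + slab_adm m l s i + m y * s \<noteq> 0"
    using slab_denominator_lower_bounds(2)[of i y] Re_decay_root_pos[OF s] by (metis half_gt_zero not_le zero_complex.sel(1))
qed

end

lemma slab_holomorphic:
  assumes mass: "\<And>y. m y \<ge> - 1 / 2"
  shows "(\<lambda>s. slab_adm m l s i) holomorphic_on {s. Re s > 0}"
    "(\<lambda>s. slab_trans m l s i) holomorphic_on {s. Re s > 0}"
proof -
  have nz: "slab_adm m l s i + (1 + m y) * s \<noteq> 0" "1 / (slab_adm m l s i + (1 + m y) * s) + s \<noteq> 0"
    if "Re s > 0" for s :: complex and i y
  proof -
    have "0 < (1 + m y) * Re s" using that mass[of y] by (intro mult_pos_pos) auto
    then have pos: "Re (slab_adm m l s i + (1 + m y) * s) > 0"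
      using Re_slab_adm_pos[OF that, of m l i] mass by simp
    then show "slab_adm m l s i + (1 + m y) * s \<noteq> 0" by (metis less_irrefl zero_complex.sel(1))
    have "0 \<le> Re (1 / (slab_adm m l s i + (1 + m y) * s))"
      unfolding Re_one_div using pos by (intro divide_nonneg_nonneg) auto
    then have "Re (1 / (slab_adm m l s i + (1 + m y) * s) + s) > 0" using that by simp
    then show "1 / (slab_adm m l s i + (1 + m y) * s) + s \<noteq> 0" by (metis less_irrefl zero_complex.sel(1))
  qed
  have adm: "(\<lambda>s. slab_adm m l s i) holomorphic_on {s. Re s > 0}" for i
  proof (induction i)
    case 0
    show ?case using decay_root_nonzero by (auto intro!: holomorphic_intros decay_root_holomorphic)
  next
    case (Suc i)
    show ?case unfolding slab_adm.simps
      by (intro holomorphic_intros Suc) (use nz in auto)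
  qed
  then show "(\<lambda>s. slab_adm m l s i) holomorphic_on {s. Re s > 0}" .
  show "(\<lambda>s. slab_trans m l s i) holomorphic_on {s. Re s > 0}"
  proof (induction i)
    case (Suc i)
    show ?case unfolding slab_trans.simps
      by (intro holomorphic_intros Suc adm decay_root_holomorphic) (use slab_denominator_nonzero mass in auto)
  qed simp
qed

lemma bounded_geometric_recursion_zero:
  fixes e :: "nat \<Rightarrow> complex"
  assumes rec: "\<And>k. e (Suc k) = r * e k" and r: "norm r > 1" and bound: "\<And>k. norm (e k) \<le> K"
  shows "e 0 = 0"
proof (rule ccontr)
  assume e0: "e 0 \<noteq> 0"
  have e: "e k = r ^ k * e 0" for k by (induction k) (auto simp: rec)
  obtain n where "K / norm (e 0) < norm r ^ n" using real_arch_pow[OF r] by blast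
  then have "K < norm (e n)" using e0 by (simp add: e[of n] norm_mult norm_power field_simps)
  then show False using bound[of n] by simp
qed

section \<open>The resolvent on and outside the circle of radius 4, in the right half plane\<close>

context
  fixes m :: "int \<Rightarrow> real" and s :: complex
  assumes mass: "\<And>y. m y \<ge> - 1 / 2" and s4: "4 \<le> norm s" and s: "Re s > 0"
begin

abbreviation "resolvent y \<equiv> z_transform (\<lambda>n. site_coeff m n y) s"

lemma resolvent_bound: "norm (resolvent y) \<le> (3 / 4) ^ nat (2 * \<bar>y\<bar>)"
  by (rule z_transform_bound[OF site_coeff_bound[of m, OF mass] s4]) (auto intro: site_coeff_eq_0)

text \<open>The Laplace transform of the equation of motion; the source \<open>s\<close> at site 0
  is the unit initial displacement.\<close>

lemma resolvent_equation:
  "(1 + m y) * (s\<^sup>2 * resolvent y - (if y = 0 then s else 0)) = resolvent (y + 1) + resolvent (y - 1) - 2 * resolvent y"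
proof -
  note sm = z_transform_summable[OF site_coeff_bound[of m, OF mass] s4]
  have nz: "1 + complex_of_real (m y) \<noteq> 0"
  proof -
    have "1 + m y \<noteq> 0" using mass[of y] by linarith
    then have "complex_of_real (1 + m y) \<noteq> 0" by (simp only: of_real_eq_0_iff not_False_eq_True)
    then show ?thesis by simp
  qed
  have "s\<^sup>2 * resolvent y - (if y = 0 then s else 0) = (\<Sum>n. of_real (site_coeff m (n + 2) y) / s ^ Suc n)"
    using z_transform_shift[of "\<lambda>n. site_coeff m n y" s, OF site_coeff_bound[of m, OF mass] s4] by simp
  also have "\<dots> = (\<Sum>n. (1 / (1 + m y)) * (of_real (site_coeff m n (y + 1)) / s ^ Suc n
      + of_real (site_coeff m n (y - 1)) / s ^ Suc n - 2 * (of_real (site_coeff m n y) / s ^ Suc n)))"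
    by (intro suminf_cong) (simp add: numeral_2_eq_2 add_divide_distrib diff_divide_distrib mult_ac)
  also have "\<dots> = (1 / (1 + m y)) * (resolvent (y + 1) + resolvent (y - 1) - 2 * resolvent y)"
    unfolding z_transform_def
    by (intro sums_unique[symmetric] sums_mult sums_diff sums_add summable_sums sm)
  finally show ?thesis using nz by simp
qed

lemma decay_root_sq: "s\<^sup>2 + 2 = decay_root s ^ 2 + 1 / decay_root s ^ 2"
proof -
  have "s\<^sup>2 = (decay_root s - 1 / decay_root s)\<^sup>2" by (simp add: decay_root_minus)
  also have "\<dots> = decay_root s ^ 2 + 1 / decay_root s ^ 2 - 2"
    using decay_root_nonzero[of s] by (simp add: field_simps power2_eq_square)
  finally show ?thesis by simp
qed

lemma resolvent_le_1: "norm (resolvent y) \<le> 1"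
  using resolvent_bound[of y] by (rule order_trans) (simp add: power_le_one)

text \<open>The free recursion has the characteristic roots \<open>b\<^sup>2\<close> and
  \<open>1 / b\<^sup>2\<close>. The quantity \<open>e\<close> isolates the growing part: each step
  multiplies it by \<open>b\<^sup>2\<close>, so it must vanish because the resolvent is bounded. The
  sign \<open>d\<close> covers both directions.\<close>

lemma free_decay:
  assumes d: "d = 1 \<or> d = -1" and free: "\<And>k::nat. m (y + d * int (Suc k)) = 0 \<and> y + d * int (Suc k) \<noteq> 0"
  shows "resolvent (y + d) = resolvent y / decay_root s ^ 2"
proof -
  let ?b = "decay_root s"
  define f where "f k = resolvent (y + d * int k)" for k
  have nz: "?b \<noteq> 0" by (rule decay_root_nonzero)
  define e where "e k = f (Suc k) - f k / ?b\<^sup>2" for k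
  have b1: "norm (?b\<^sup>2) > 1"
    using norm_decay_root_gt_1[OF s] one_less_power[of "norm ?b" 2] by (simp add: norm_power)
  have "e 0 = 0"
  proof (rule bounded_geometric_recursion_zero[OF _ b1])
    fix k
    have "s\<^sup>2 * f (Suc k) = f (Suc (Suc k)) + f k - 2 * f (Suc k)"
      using resolvent_equation[of "y + d * int (Suc k)"] free[of k] d
      by (auto simp: f_def algebra_simps)
    then have "f (Suc (Suc k)) = (s\<^sup>2 + 2) * f (Suc k) - f k" by (simp add: algebra_simps)
    then have "f (Suc (Suc k)) = (?b\<^sup>2 + 1 / ?b\<^sup>2) * f (Suc k) - f k" unfolding decay_root_sq .
    then have "e (Suc k) = ?b\<^sup>2 * f (Suc k) - f k" unfolding e_def by (simp add: algebra_simps)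
    also have "\<dots> = ?b\<^sup>2 * e k" using nz by (simp add: e_def right_diff_distrib)
    finally show "e (Suc k) = ?b\<^sup>2 * e k" .
  next
    fix k
    have "norm (f k / ?b\<^sup>2) \<le> 1 / 1"
      unfolding norm_divide using resolvent_le_1 b1 by (intro frac_le) (auto simp: f_def)
    moreover have "norm (f (Suc k)) \<le> 1" using resolvent_le_1 by (simp add: f_def)
    ultimately show "norm (e k) \<le> 2" unfolding e_def
      using norm_triangle_ineq4[of "f (Suc k)" "f k / ?b\<^sup>2"] by simp
  qed
  then show ?thesis by (simp add: e_def f_def)
qed

text \<open>The invariant \<open>inv\<close> carries two facts from the right end of the slab to
  site 0: the ratio of neighbouring values, encoded by \<open>slab_adm\<close>, and a comparison
  with the homogeneous lattice, where \<open>slab_adm\<close> is \<open>1 / b\<close>, the factor is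
  1 and a step multiplies by \<open>b\<^sup>2\<close>. At site 0 the free decay to the left and the
  source fix the normalisation.\<close>

lemma resolvent_transmission:
  fixes l x :: nat
  assumes supp: "\<And>y. y \<notin> {1..int l} \<Longrightarrow> m y = 0" and x: "l \<le> x"
  shows "resolvent (int x) = slab_trans m l s l / (decay_root s ^ (2 * x) * (decay_root s + 1 / decay_root s))"
proof -
  let ?b = "decay_root s"
  have nz: "?b \<noteq> 0" by (rule decay_root_nonzero)
  note den = slab_denominator_nonzero[OF s, of m l, OF mass]
  have adm_nz: "slab_adm m l s i \<noteq> 0" for i
    using Re_slab_adm_pos[OF s, of m l i, OF mass] by (metis less_irrefl zero_complex.sel(1))
  have bs: "s * ?b = ?b\<^sup>2 - 1" "?b + s * ?b\<^sup>2 = ?b ^ 3"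
  proof -
    have "s * ?b = (?b - 1 / ?b) * ?b" by (simp add: decay_root_minus)
    also have "\<dots> = ?b\<^sup>2 - 1" using nz by (simp add: field_simps power2_eq_square)
    finally show *: "s * ?b = ?b\<^sup>2 - 1" .
    have "s * ?b\<^sup>2 = (s * ?b) * ?b" by (simp add: power2_eq_square)
    also have "\<dots> = ?b ^ 3 - ?b" unfolding * by (simp add: algebra_simps power2_eq_square power3_eq_cube)
    finally show "?b + s * ?b\<^sup>2 = ?b ^ 3" by simp
  qed
  have right: "resolvent (int (l + k)) = resolvent (int l) / ?b ^ (2 * k)" for k
  proof (induction k)
    case (Suc k)
    have "resolvent (int (l + k) + 1) = resolvent (int (l + k)) / ?b\<^sup>2"
      by (rule free_decay) (auto simp: supp)
    then show ?case using Suc by (simp add: add.commute power_add power2_eq_square)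
  qed simp
  define q where "q = slab_adm m l s"
  define T where "T = slab_trans m l s"
  have inv: "resolvent (int l - int i + 1) = (1 - s * q i) * resolvent (int l - int i) \<and>
      resolvent (int l) * ?b ^ (2 * i) * (?b + 1 / ?b) = T i * (?b + q i) * resolvent (int l - int i)"
    if "i \<le> l" for i
    using that
  proof (induction i)
    case 0
    have "resolvent (int l + 1) = resolvent (int l) / ?b\<^sup>2"
      by (rule free_decay) (auto simp: supp)
    moreover have "1 - s / ?b = 1 / ?b\<^sup>2"
    proof -
      have "1 - s / ?b = (?b\<^sup>2 - s * ?b) / ?b\<^sup>2" using nz by (simp add: field_simps power2_eq_square)
      then show ?thesis unfolding bs(1) by simp
    qed
    ultimately show ?case by (simp add: q_def T_def)
  next
    case (Suc i)
    let ?y = "int l - int i" and ?m = "complex_of_real (m (int l - int i))"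
    define h where "h = q i + (1 + ?m) * s"
    have IH: "resolvent (?y + 1) = (1 - s * q i) * resolvent ?y"
      "resolvent (int l) * ?b ^ (2 * i) * (?b + 1 / ?b) = T i * (?b + q i) * resolvent ?y"
      using Suc by auto
    have Re_h: "Re h > 0"
    proof -
      have "0 < (1 + m ?y) * Re s" using s mass[of ?y] by (intro mult_pos_pos) auto
      then show ?thesis using Re_slab_adm_pos[OF s, of m l i, OF mass] by (simp add: h_def q_def)
    qed
    then have h: "h \<noteq> 0" by auto
    have "0 \<le> Re (1 / h)" unfolding Re_one_div using Re_h by (intro divide_nonneg_nonneg) auto
    then have "Re (1 / h + s) > 0" using s by simp
    then have hs0: "1 / h + s \<noteq> 0" by (metis less_irrefl zero_complex.sel(1))
    have hs: "1 + s * h \<noteq> 0"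
    proof
      assume "1 + s * h = 0"
      then have "h * (1 / h + s) = 0" using h by (simp add: distrib_left mult.commute)
      then show False using h hs0 by simp
    qed
    have q': "q (Suc i) = h / (1 + s * h)"
    proof -
      have "1 / h + s = (1 + s * h) / h" using h by (simp add: add_divide_distrib)
      then show ?thesis by (simp add: q_def h_def)
    qed
    have "(1 + ?m) * (s\<^sup>2 * resolvent ?y) = resolvent (?y + 1) + resolvent (?y - 1) - 2 * resolvent ?y"
      using resolvent_equation[of ?y] Suc.prems by simp
    then have "resolvent (?y - 1) = resolvent ?y * (1 + s * h)"
      unfolding IH(1) h_def by (simp add: algebra_simps power2_eq_square)
    then have prev: "resolvent ?y = resolvent (?y - 1) / (1 + s * h)" using hs by simp
    have eq1: "resolvent (?y - 1 + 1) = (1 - s * q (Suc i)) * resolvent (?y - 1)"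
    proof -
      have "(1 - s * q (Suc i)) * (1 + s * h) = 1" unfolding q' using hs by (simp add: left_diff_distrib)
      then have "1 - s * q (Suc i) = 1 / (1 + s * h)" using hs by (simp add: eq_divide_eq)
      then show ?thesis using prev by simp
    qed
    have D: "?b + q i + ?m * s \<noteq> 0" using den(2)[of i ?y] by (simp add: q_def)
    have "?b + q (Suc i) = ?b\<^sup>2 * (?b + q i + ?m * s) / (1 + s * h)"
    proof -
      have "(?b + q (Suc i)) * (1 + s * h) = ?b + (s * ?b + 1) * h"
        unfolding q' using hs by (simp add: distrib_right) (simp add: algebra_simps)
      also have "\<dots> = ?b + ?b\<^sup>2 * h" unfolding bs(1) by simp
      also have "\<dots> = (?b + s * ?b\<^sup>2) + ?b\<^sup>2 * (q i + ?m * s)" by (simp add: h_def algebra_simps)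
      also have "\<dots> = ?b\<^sup>2 * (?b + q i + ?m * s)"
        unfolding bs(2) by (simp add: algebra_simps power2_eq_square power3_eq_cube)
      finally show ?thesis using hs by (simp add: eq_divide_eq)
    qed
    then have "T (Suc i) * (?b + q (Suc i)) * resolvent (?y - 1)
        = T i * ((?b + q i) / (?b + q i + ?m * s)) * (?b\<^sup>2 * (?b + q i + ?m * s)) * resolvent ?y"
      unfolding prev by (simp add: T_def q_def)
    also have "\<dots> = ?b\<^sup>2 * (T i * (?b + q i) * resolvent ?y)" using D by simp
    also have "\<dots> = resolvent (int l) * ?b ^ (2 * Suc i) * (?b + 1 / ?b)"
      unfolding IH(2)[symmetric] by (simp add: power2_eq_square)
    finally show ?case using eq1 by (simp add: algebra_simps)
  qed
  have left: "resolvent (- 1) = resolvent 0 / ?b\<^sup>2"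
    using free_decay[of "-1" 0] by (auto simp: supp)
  have r1: "resolvent 1 = (1 - s * q l) * resolvent 0" using inv[of l] by simp
  have "s\<^sup>2 * resolvent 0 - s = resolvent 1 + resolvent (-1) - 2 * resolvent 0"
    using resolvent_equation[of 0] by (simp add: supp)
  then have "((s\<^sup>2 + 2) - 1 / ?b\<^sup>2 - (1 - s * q l)) * resolvent 0 = s"
    unfolding left r1 by (simp add: algebra_simps)
  then have "(?b\<^sup>2 - 1 + s * q l) * resolvent 0 = s" unfolding decay_root_sq by (simp add: algebra_simps)
  \<comment> \<open>Since \<open>b\<^sup>2 - 1 = s * b\<close>, a common factor \<open>s\<close>
    cancels: the source sees the admittance \<open>b\<close> of the left half together with the
    slab's \<open>q l\<close> in parallel.\<close>
  then have "s * ((?b + q l) * resolvent 0) = s * 1" unfolding bs(1)[symmetric] by (simp add: algebra_simps)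
  then have "(?b + q l) * resolvent 0 = 1" using s by auto
  then have rl: "resolvent (int l) * ?b ^ (2 * l) * (?b + 1 / ?b) = T l"
    using inv[of l] by (simp add: mult.assoc)
  have pl: "?b + 1 / ?b \<noteq> 0" using norm_decay_root_plus[OF s] s by auto
  have "resolvent (int l) = T l / (?b ^ (2 * l) * (?b + 1 / ?b))"
    unfolding rl[symmetric] using nz pl by simp
  moreover have "?b ^ (2 * x) = ?b ^ (2 * l) * ?b ^ (2 * (x - l))"
  proof -
    have "2 * x = 2 * l + 2 * (x - l)" using x by simp
    then show ?thesis by (metis power_add)
  qed
  ultimately show ?thesis using right[of "x - l"] x by (simp add: T_def mult_ac)
qed

end

text \<open>The part of the circle to the right of \<open>Re s = a\<close> is deformed into a chord; the rest is
  negligible because there the resolvent is geometrically small in the distance travelled.\<close>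

lemma circle_to_chord:
  assumes a: "0 < a" "a < 4" and hol: "F holomorphic_on {s. Re s > 0}"
    and int: "f contour_integrable_on circlepath 0 4"
    and eq: "\<And>s. norm s = 4 \<Longrightarrow> a \<le> Re s \<Longrightarrow> f s = F s"
    and bound: "\<And>s. norm s = 4 \<Longrightarrow> Re s \<le> a \<Longrightarrow> norm (f s) \<le> K"
  shows "norm (contour_integral (circlepath 0 4) f
      - \<i> * integral {- sqrt (16 - a\<^sup>2)..sqrt (16 - a\<^sup>2)} (\<lambda>r. F (Complex a r))) \<le> 8 * pi * K"
proof -
  define \<Lambda> where "\<Lambda> = sqrt (16 - a\<^sup>2)"
  \<comment> \<open>The parameter at which the circle, started at 4, meets the line
    \<open>Re s = a\<close> in the upper half plane; \<open>1 - u0\<close> is the mirror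
    point.\<close>
  define u0 where "u0 = arccos (a / 4) / (2 * pi)"
  let ?g = "circlepath 0 4"
  have g: "Re (?g u) = 4 * cos (2 * pi * u)" "Im (?g u) = 4 * sin (2 * pi * u)" "norm (?g u) = 4" for u
    by (simp_all add: circlepath Re_exp Im_exp norm_mult)
  have a4: "- 1 \<le> a / 4" "a / 4 \<le> 1" using a by auto
  have arc: "0 < arccos (a / 4)" "arccos (a / 4) < pi / 2"
    using a arccos_less_arccos[of "a/4" 1] arccos_less_arccos[of 0 "a/4"] by auto
  have u0: "0 < u0" "u0 < 1 / 4" using arc pi_gt_zero by (auto simp: u0_def field_simps)
  have pu0: "2 * pi * u0 = arccos (a / 4)" by (simp add: u0_def)
  have cos_u0: "cos (2 * pi * u0) = a / 4" unfolding pu0 using a4 by (rule cos_arccos)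
  have sin_u0: "sin (2 * pi * u0) = \<Lambda> / 4"
  proof -
    have "sin (2 * pi * u0) = sqrt (1 - (a / 4)\<^sup>2)" unfolding pu0 using a4 by (rule sin_arccos)
    also have "1 - (a / 4)\<^sup>2 = (16 - a\<^sup>2) / 16" by (simp add: power2_eq_square field_simps)
    also have "sqrt \<dots> = \<Lambda> / 4" by (simp add: real_sqrt_divide \<Lambda>_def)
    finally show ?thesis .
  qed
  have mirror: "cos (2 * pi * (1 - u)) = cos (2 * pi * u)" "sin (2 * pi * (1 - u)) = - sin (2 * pi * u)" for u
    by (simp_all add: right_diff_distrib cos_diff sin_diff)
  have right: "a \<le> Re (?g u)" if "u \<in> {0..u0} \<union> {1 - u0..1}" for u
  proof -
    have *: "a / 4 \<le> cos (2 * pi * v)" if "v \<in> {0..u0}" for v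
      unfolding cos_u0[symmetric] using that u0 pi_gt_zero
      by (intro cos_monotone_0_pi_le) (auto simp: field_simps)
    show ?thesis
      using *[of u] *[of "1 - u"] that by (auto simp: g mirror)
  qed
  have left: "Re (?g u) \<le> a" if "u \<in> {u0..1 - u0}" for u
  proof -
    have *: "cos (2 * pi * v) \<le> a / 4" if "v \<in> {u0..1 / 2}" for v
      unfolding cos_u0[symmetric] using that u0 pi_gt_zero
      by (intro cos_monotone_0_pi_le) (auto simp: field_simps)
    show ?thesis
      using *[of u] *[of "1 - u"] that by (cases "u \<le> 1 / 2") (auto simp: g mirror)
  qed
  \<comment> \<open>A primitive on the half plane expresses the two arcs and the chord by its values
    at the crossing points; the value at the starting point 4 cancels.\<close>
  obtain Q where Q: "\<And>s. s \<in> {s. Re s > 0} \<Longrightarrow> (Q has_field_derivative F s) (at s within {s. Re s > 0})"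
    by (rule holomorphic_convex_primitive'[OF convex_halfspace_Re_gt open_halfspace_Re_gt hol]) blast
  have arc_int: "contour_integral (subpath u v ?g) f = Q (?g v) - Q (?g u)"
    if uv: "u \<le> v" "{u..v} \<subseteq> {0..u0} \<union> {1 - u0..1}" "u \<in> {0..1}" "v \<in> {0..1}" for u v
  proof -
    have img: "path_image (subpath u v ?g) = ?g ` {u..v}" using uv by (simp add: path_image_subpath)
    have "contour_integral (subpath u v ?g) f = contour_integral (subpath u v ?g) F"
    proof (rule contour_integral_eq)
      fix z assume "z \<in> path_image (subpath u v ?g)"
      then obtain r where "r \<in> {u..v}" "z = ?g r" unfolding img by blast
      then show "f z = F z" using right[of r] g(3)[of r] uv(2) by (intro eq) blast+
    qed
    also have "\<dots> = Q (pathfinish (subpath u v ?g)) - Q (pathstart (subpath u v ?g))"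
    proof (rule contour_integral_unique, rule contour_integral_primitive[OF Q])
      show "valid_path (subpath u v ?g)" using uv by (intro valid_path_subpath) auto
      show "path_image (subpath u v ?g) \<subseteq> {s. Re s > 0}"
      proof
        fix z assume "z \<in> path_image (subpath u v ?g)"
        then obtain r where "r \<in> {u..v}" "z = ?g r" unfolding img by blast
        then have "a \<le> Re z" using right[of r] uv(2) by blast
        then show "z \<in> {s. Re s > 0}" using a by simp
      qed
    qed
    finally show ?thesis by simp
  qed
  have chord: "\<i> * integral {- \<Lambda>..\<Lambda>} (\<lambda>r. F (Complex a r)) = Q (Complex a \<Lambda>) - Q (Complex a (- \<Lambda>))"
  proof -
    have Lpos: "\<Lambda> > 0" unfolding \<Lambda>_def using a power_strict_mono[of a 4 2] by simp
    have "closed_segment (Complex a (- \<Lambda>)) (Complex a \<Lambda>) \<subseteq> {s. Re s > 0}"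
      using a by (intro closed_segment_subset convex_halfspace_Re_gt) auto
    then have "(F has_contour_integral Q (pathfinish (linepath (Complex a (- \<Lambda>)) (Complex a \<Lambda>)))
        - Q (pathstart (linepath (Complex a (- \<Lambda>)) (Complex a \<Lambda>)))) (linepath (Complex a (- \<Lambda>)) (Complex a \<Lambda>))"
      by (intro contour_integral_primitive[OF Q]) auto
    from contour_integral_unique[OF this] show ?thesis
      using Lpos by (subst (asm) contour_integral_linepath_same_Re[where c = a and a = "- \<Lambda>" and b = \<Lambda>]) auto
  qed
  have "contour_integral ?g f = contour_integral (subpath 0 1 ?g) f" by simp
  also have "\<dots> = contour_integral (subpath 0 u0 ?g) f + contour_integral (subpath u0 (1 - u0) ?g) f
      + contour_integral (subpath (1 - u0) 1 ?g) f"
    using u0 contour_integral_subpath_combine[OF int valid_path_circlepath, of 0 u0 "1 - u0"]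
      contour_integral_subpath_combine[OF int valid_path_circlepath, of 0 "1 - u0" 1] by simp
  also have "contour_integral (subpath 0 u0 ?g) f = Q (?g u0) - Q (?g 0)"
    using u0 by (intro arc_int) auto
  also have "contour_integral (subpath (1 - u0) 1 ?g) f = Q (?g 1) - Q (?g (1 - u0))"
    using u0 by (intro arc_int) auto
  also have "?g 1 = ?g 0" by (simp add: circlepath)
  also have "?g u0 = Complex a \<Lambda>" by (simp add: complex_eq_iff g cos_u0 sin_u0)
  also have "?g (1 - u0) = Complex a (- \<Lambda>)" by (simp add: complex_eq_iff g mirror cos_u0 sin_u0)
  finally have "contour_integral ?g f - \<i> * integral {- \<Lambda>..\<Lambda>} (\<lambda>r. F (Complex a r))
      = contour_integral (subpath u0 (1 - u0) ?g) f" unfolding chord by simp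
  also have "norm \<dots> \<le> 8 * pi * K"
  proof -
    \<comment> \<open>The circle has speed \<open>8 * pi\<close>, and the parameter interval has
      length at most 1.\<close>
    let ?h = "\<lambda>x. f (?g x) * vector_derivative ?g (at x)"
    have "norm (f (?g u0)) \<le> K" using u0 by (intro bound g(3) left) auto
    then have K: "0 \<le> K" using norm_ge_zero[of "f (?g u0)"] by linarith
    have "(?h has_integral contour_integral (subpath u0 (1 - u0) ?g) f) {u0..1 - u0}"
      using u0 by (intro has_integral_contour_integral_subpath int) auto
    then have "norm (contour_integral (subpath u0 (1 - u0) ?g) f) \<le> 8 * pi * K * measure lborel (cbox u0 (1 - u0))"
      unfolding interval_cbox
    proof (rule has_integral_bound[rotated])
      fix x assume "x \<in> cbox u0 (1 - u0)"
      then have "norm (f (?g x)) \<le> K" using left g(3) by (intro bound) auto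
      moreover have "norm (vector_derivative ?g (at x)) = 8 * pi"
        by (simp add: vector_derivative_circlepath norm_mult)
      ultimately show "norm (?h x) \<le> 8 * pi * K"
        unfolding norm_mult by (simp add: mult_right_mono)
    qed (use K in auto)
    also have "\<dots> \<le> 8 * pi * K * 1" using u0 K by (intro mult_left_mono) auto
    finally show ?thesis by simp
  qed
  finally show ?thesis by (simp add: \<Lambda>_def)
qed

section \<open>The field as an integral over a chord\<close>

definition free_integrand :: "nat \<Rightarrow> real \<Rightarrow> complex \<Rightarrow> complex" where
  "free_integrand x t s = exp (s * t) / (decay_root s ^ (2 * x) * (decay_root s + 1 / decay_root s))"

definition slab_integrand :: "(int \<Rightarrow> real) \<Rightarrow> nat \<Rightarrow> nat \<Rightarrow> real \<Rightarrow> complex \<Rightarrow> complex" where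
  "slab_integrand m l x t s = free_integrand x t s * slab_trans m l s l"

lemma slab_integrand_holomorphic:
  assumes "\<And>y. m y \<ge> - 1 / 2"
  shows "slab_integrand m l x t holomorphic_on {s. Re s > 0}"
proof -
  have "decay_root s + 1 / decay_root s \<noteq> 0" if "Re s > 0" for s
    using norm_decay_root_plus[OF that] that by auto
  then show ?thesis unfolding slab_integrand_def free_integrand_def
    using decay_root_nonzero
    by (intro holomorphic_intros decay_root_holomorphic slab_holomorphic assms) auto
qed

text \<open>The error of \<open>circle_to_chord\<close> divided by \<open>2 * pi\<close> gives the
  factor 4. On the lines used later \<open>a * t\<close> grows only like \<open>x\<close> to the
  power \<open>2 / 3\<close>, so the geometric factor wins.\<close>

lemma lattice_field_chord:
  fixes l x :: nat
  assumes mass: "\<And>y. m y \<ge> - 1 / 2" and supp: "\<And>y. y \<notin> {1..int l} \<Longrightarrow> m y = 0" and x: "l \<le> x"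
    and a: "0 < a" "a < 4" and t: "0 \<le> t"
  shows "norm (of_real (lattice_field m (int x) t) - 1 / (2 * pi) *
      integral {- sqrt (16 - a\<^sup>2)..sqrt (16 - a\<^sup>2)} (\<lambda>r. slab_integrand m l x t (Complex a r)))
    \<le> 4 * exp (a * t) * (3 / 4) ^ (2 * x)"
proof -
  let ?c = "\<lambda>n. site_coeff m n (int x)"
  note c = site_coeff_bound[of m, OF mass]
  let ?I = "integral {- sqrt (16 - a\<^sup>2)..sqrt (16 - a\<^sup>2)} (\<lambda>r. slab_integrand m l x t (Complex a r))"
  have "norm (contour_integral (circlepath 0 4) (\<lambda>s. exp (s * t) * z_transform ?c s) - \<i> * ?I)
      \<le> 8 * pi * (exp (a * t) * (3 / 4) ^ (2 * x))"
  proof (rule circle_to_chord[OF a slab_integrand_holomorphic[of m, OF mass]])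
    show "(\<lambda>s. exp (s * t) * z_transform ?c s) contour_integrable_on circlepath 0 4"
      by (rule exp_series_contour_integral[OF c])
    fix s :: complex assume s: "norm s = 4"
    show "exp (s * t) * z_transform ?c s = slab_integrand m l x t s" if "a \<le> Re s"
      using resolvent_transmission[of m s l x, OF mass _ _ supp x] s that a
      by (simp add: slab_integrand_def free_integrand_def)
    show "norm (exp (s * t) * z_transform ?c s) \<le> exp (a * t) * (3 / 4) ^ (2 * x)" if "Re s \<le> a"
      unfolding norm_mult
    proof (intro mult_mono)
      show "norm (exp (s * t)) \<le> exp (a * t)" using that t by (simp add: mult_right_mono)
      show "norm (z_transform ?c s) \<le> (3 / 4) ^ (2 * x)"
        by (rule z_transform_bound[OF c]) (use s in \<open>auto intro!: site_coeff_eq_0\<close>)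
    qed auto
  qed
  also have "contour_integral (circlepath 0 4) (\<lambda>s. exp (s * t) * z_transform ?c s)
      = 2 * pi * \<i> * of_real (lattice_field m (int x) t)"
    unfolding lattice_field_def by (rule exp_series_contour_integral[OF c])
  also have "2 * pi * \<i> * of_real (lattice_field m (int x) t) - \<i> * ?I
      = 2 * pi * \<i> * (of_real (lattice_field m (int x) t) - 1 / (2 * pi) * ?I)"
    by (simp add: algebra_simps)
  finally show ?thesis by (simp add: norm_mult)
qed

section \<open>Second moment of the transmission factor\<close>

text \<open>After \<open>i\<close> steps only the \<open>i\<close> rightmost sites have entered.
  Hence the mass at \<open>l - i\<close>, the next to come, is independent of everything at stage
  \<open>i\<close>.\<close>

lemma slab_cong:
  assumes "\<And>j. j < i \<Longrightarrow> m (l - int j) = m' (l - int j)"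
  shows "slab_adm m l s i = slab_adm m' l s i" "slab_trans m l s i = slab_trans m' l s i"
  using assms
proof (induction i)
  case (Suc i)
  { case 1 then show ?case using Suc by simp }
  { case 2 then show ?case using Suc by simp }
qed auto

lemma borel_measurable_slab:
  assumes [measurable]: "\<And>y. (\<lambda>\<omega>. m \<omega> y) \<in> borel_measurable M"
    "s \<in> borel_measurable M" "(\<lambda>\<omega>. decay_root (s \<omega>)) \<in> borel_measurable M"
  shows "(\<lambda>\<omega>. slab_adm (m \<omega>) l (s \<omega>) i) \<in> borel_measurable M"
    "(\<lambda>\<omega>. slab_trans (m \<omega>) l (s \<omega>) i) \<in> borel_measurable M"
proof -
  have [measurable]: "(\<lambda>\<omega>. slab_adm (m \<omega>) l (s \<omega>) i) \<in> borel_measurable M" for i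
    by (induction i) simp_all
  then show "(\<lambda>\<omega>. slab_adm (m \<omega>) l (s \<omega>) i) \<in> borel_measurable M" .
  show "(\<lambda>\<omega>. slab_trans (m \<omega>) l (s \<omega>) i) \<in> borel_measurable M"
    by (induction i) simp_all
qed

text \<open>The term linear in \<open>\<mu>\<close> is singled out because it vanishes on average: \<open>\<mu>\<close> has mean zero and is
  independent of \<open>T\<close> and \<open>d\<close>.\<close>

lemma one_site_bound:
  fixes T d s :: complex and \<mu> \<kappa> :: real
  assumes d: "h > 0" "h \<le> Re d" "h \<le> Re (d + \<mu> * s)" and \<kappa>: "\<kappa> = (norm s / h)\<^sup>2"
  shows "(norm (T * (d / (d + \<mu> * s)) - 1))\<^sup>2 \<le> (norm (T - 1))\<^sup>2
     - 2 * \<mu> * Re (cnj (T - 1) * T * (s / d)) + \<mu>\<^sup>2 * (\<kappa> * (3 + 5 * (norm (T - 1))\<^sup>2))"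
proof -
  define f where "f = d / (d + \<mu> * s) - 1"
  define p where "p = norm (T - 1)"
  have nz: "d \<noteq> 0" "d + \<mu> * s \<noteq> 0" using d by (metis not_le zero_complex.sel(1))+
  have nd: "h \<le> norm d" "h \<le> norm (d + \<mu> * s)"
    using d complex_Re_le_cmod order_trans by blast+
  have f: "f = - (\<mu> * s) / (d + \<mu> * s)" using nz by (simp add: f_def field_simps)
  have "norm f = \<bar>\<mu>\<bar> * norm s / norm (d + \<mu> * s)" by (simp add: f norm_divide norm_mult)
  also have "\<dots> \<le> \<bar>\<mu>\<bar> * norm s / h" using nd d by (intro divide_left_mono) (auto intro!: mult_pos_pos)
  finally have "norm f \<le> \<bar>\<mu>\<bar> * (norm s / h)" by simp
  then have "(norm f)\<^sup>2 \<le> (\<bar>\<mu>\<bar> * (norm s / h))\<^sup>2" by (intro power_mono) auto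
  then have nf: "(norm f)\<^sup>2 \<le> \<mu>\<^sup>2 * \<kappa>" by (simp add: \<kappa> power_mult_distrib power_divide)
  \<comment> \<open>\<open>f\<close> is the relative change caused by the site and
    \<open>- \<mu> * (s / d)\<close> its linear part; the remainder \<open>r\<close> is quadratic in
    \<open>\<mu>\<close>.\<close>
  define r where "r = f + \<mu> * (s / d)"
  have r: "r = (\<mu> * s)\<^sup>2 / (d * (d + \<mu> * s))"
    unfolding r_def f using nz by (simp add: divide_simps) (simp add: algebra_simps power2_eq_square)
  have "norm r = (\<mu> * norm s)\<^sup>2 / (norm d * norm (d + \<mu> * s))"
    unfolding r by (simp add: norm_divide norm_mult norm_power power_mult_distrib)
  also have "\<dots> \<le> (\<mu> * norm s)\<^sup>2 / (h * h)"
    using nd d by (intro divide_left_mono mult_mono) (auto intro!: mult_pos_pos)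
  finally have nr: "norm r \<le> \<mu>\<^sup>2 * \<kappa>" by (simp add: \<kappa> power2_eq_square mult_ac)
  have nT: "norm T \<le> 1 + p" unfolding p_def using norm_triangle_ineq2[of T 1] by simp
  have "T * (d / (d + \<mu> * s)) - 1 = (T - 1) + T * f" by (simp add: f_def algebra_simps)
  then have "(norm (T * (d / (d + \<mu> * s)) - 1))\<^sup>2 = p\<^sup>2 + 2 * Re (cnj (T - 1) * (T * f)) + (norm T)\<^sup>2 * (norm f)\<^sup>2"
    unfolding p_def cmod_power2 by (simp add: power2_eq_square algebra_simps)
  also have "cnj (T - 1) * (T * f) = cnj (T - 1) * T * r - \<mu> * (cnj (T - 1) * T * (s / d))"
    by (simp add: r_def distrib_left mult_ac del: complex_cnj_diff)
  also have "p\<^sup>2 + 2 * Re \<dots> + (norm T)\<^sup>2 * (norm f)\<^sup>2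
     = p\<^sup>2 - 2 * \<mu> * Re (cnj (T - 1) * T * (s / d)) + 2 * Re (cnj (T - 1) * T * r) + (norm T)\<^sup>2 * (norm f)\<^sup>2"
  proof -
    have "Re (complex_of_real \<mu> * w) = \<mu> * Re w" for w by simp
    moreover have "b + 2 * (x - y) + c = b - 2 * y + 2 * x + c" for b c x y :: real by simp
    ultimately show ?thesis unfolding minus_complex.sel by (simp only: mult.assoc)
  qed
  also have "\<dots> \<le> p\<^sup>2 - 2 * \<mu> * Re (cnj (T - 1) * T * (s / d)) + 2 * (p * (1 + p) * (\<mu>\<^sup>2 * \<kappa>)) + (1 + p)\<^sup>2 * (\<mu>\<^sup>2 * \<kappa>)"
  proof -
    have "Re (cnj (T - 1) * T * r) \<le> norm (cnj (T - 1) * T * r)" by (rule complex_Re_le_cmod)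
    also have "\<dots> = p * norm T * norm r" by (simp add: norm_mult p_def flip: complex_cnj_diff)
    also have "\<dots> \<le> p * (1 + p) * (\<mu>\<^sup>2 * \<kappa>)" using nT nr by (intro mult_mono) (auto simp: p_def)
    finally have "2 * Re (cnj (T - 1) * T * r) \<le> 2 * (p * (1 + p) * (\<mu>\<^sup>2 * \<kappa>))" by (rule mult_left_mono) simp
    moreover have "(norm T)\<^sup>2 * (norm f)\<^sup>2 \<le> (1 + p)\<^sup>2 * (\<mu>\<^sup>2 * \<kappa>)"
      using nT nf by (intro mult_mono power_mono) auto
    ultimately show ?thesis by (intro add_mono order_refl)
  qed
  also have "\<dots> = p\<^sup>2 - 2 * \<mu> * Re (cnj (T - 1) * T * (s / d)) + (\<mu>\<^sup>2 * \<kappa>) * (1 + 4 * p + 3 * p\<^sup>2)"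
    by (simp add: algebra_simps power2_eq_square)
  also have "\<dots> \<le> p\<^sup>2 - 2 * \<mu> * Re (cnj (T - 1) * T * (s / d)) + (\<mu>\<^sup>2 * \<kappa>) * (3 + 5 * p\<^sup>2)"
  proof (intro add_left_mono mult_left_mono)
    \<comment> \<open>Trading \<open>4 * p\<close> for \<open>2 + 2 * p\<^sup>2\<close> makes the
      bound affine in \<open>p\<^sup>2\<close>, so that it can be iterated under the
      expectation.\<close>
    have "0 \<le> 2 * (p - 1)\<^sup>2" by simp
    also have "\<dots> = 2 * p\<^sup>2 - 4 * p + 2" by (simp add: power2_eq_square algebra_simps)
    finally show "1 + 4 * p + 3 * p\<^sup>2 \<le> 3 + 5 * p\<^sup>2" by simp
  qed (simp add: \<kappa>)
  finally show ?thesis by (simp add: p_def mult_ac)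
qed

text \<open>\<open>g\<close> turns a sample of the fixed law \<open>N\<close> into a mass defect of
  variance \<open>v\<close>. Separating \<open>g\<close> from \<open>N\<close> lets one law serve
  every \<open>\<sigma>\<close>, and lets \<open>g\<close> be modified on a null set so that the
  lower bound holds at every point.\<close>

locale random_mass = prob_space N for N :: "real measure" +
  fixes g :: "real \<Rightarrow> real" and v :: real
  assumes sets_N [measurable_cong]: "sets N = sets borel"
    and g_measurable [measurable]: "g \<in> borel_measurable borel"
    and g_ge: "\<And>y. g y \<ge> - 1 / 2"
    and g_int: "integrable N g" "integrable N (\<lambda>y. (g y)\<^sup>2)"
    and g_moments: "(LINT y|N. g y) = 0" "(LINT y|N. (g y)\<^sup>2) = v"
begin

definition masses :: "nat \<Rightarrow> (int \<Rightarrow> real) \<Rightarrow> int \<Rightarrow> real" where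
  "masses l \<nu> y = (if y \<in> {1..int l} then g (\<nu> y) else 0)"

lemma masses_ge: "masses l \<nu> y \<ge> - 1 / 2" using g_ge by (simp add: masses_def)

lemma v_nonneg: "v \<ge> 0" unfolding g_moments(2)[symmetric] by (rule Bochner_Integration.integral_nonneg) simp

text \<open>Integrating \<open>one_site_bound\<close> over the newly added mass bounds the next
  second moment by \<open>1 + 5 * \<kappa> * v\<close> times the current one plus
  \<open>3 * \<kappa> * v\<close>. The right side solves this recursion with equality, starting from
  0.\<close>

lemma transmission_second_moment:
  fixes l :: nat and s :: complex
  assumes s: "Re s > 0" and \<kappa>: "\<kappa> = (norm s / (Re (decay_root s) / 2))\<^sup>2" and i: "i \<le> l"
  shows "(\<integral>\<^sup>+\<nu>. ennreal ((norm (slab_trans (masses l \<nu>) l s i - 1))\<^sup>2) \<partial>PiM {int l - int i<..int l} (\<lambda>_. N))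
    \<le> ennreal (3 / 5 * ((1 + 5 * \<kappa> * v) ^ i - 1))"
  using i
proof (induction i)
  case (Suc i)
  let ?T = "\<lambda>\<nu>. slab_trans (masses l \<nu>) l s i" and ?q = "\<lambda>\<nu>. slab_adm (masses l \<nu>) l s i"
  let ?y = "int l - int i"
  let ?A = "\<lambda>\<nu>. (norm (?T \<nu> - 1))\<^sup>2"
  let ?I = "{?y<..int l}"
  interpret P: product_sigma_finite "\<lambda>_::int. N" by (intro product_sigma_finite.intro sigma_finite_measure_axioms)
  have y: "?y \<in> {1..int l}" using Suc.prems by auto
  have ins: "{int l - int (Suc i)<..int l} = insert ?y ?I" by auto
  have \<kappa>0: "\<kappa> \<ge> 0" by (simp add: \<kappa>)
  have ennreal_affine: "ennreal (p * q + r) = ennreal p * ennreal q + ennreal r" if "0 \<le> p" "0 \<le> q" "0 \<le> r" for p q r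
    using that by (simp add: ennreal_mult)
  have meas: "(\<lambda>\<nu>. slab_trans (masses l \<nu>) l s j) \<in> borel_measurable (PiM {int l - int j<..int l} (\<lambda>_. N))" for j
  proof -
    let ?M = "PiM {int l - int j<..int l} (\<lambda>_. N)"
    \<comment> \<open>Zeroing the masses outside the index set makes all sites measurable at once;
      by \<open>slab_cong\<close> the factor does not see the change.\<close>
    let ?m = "\<lambda>\<nu> y. if y \<in> {int l - int j<..int l} then masses l \<nu> y else 0"
    have [measurable]: "(\<lambda>\<nu>. \<nu> y) \<in> borel_measurable ?M" if "y \<in> {int l - int j<..int l}" for y
      using measurable_component_singleton[OF that, of "\<lambda>_. N"] measurable_cong_sets[OF refl sets_N] by auto
    have "(\<lambda>\<nu>. ?m \<nu> y) \<in> borel_measurable ?M" for y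
    proof (cases "y \<in> {int l - int j<..int l}")
      case True
      then show ?thesis by (simp add: masses_def)
    next
      case False
      then have "(\<lambda>\<nu>. ?m \<nu> y) = (\<lambda>_. 0)" by auto
      then show ?thesis by simp
    qed
    then have "(\<lambda>\<nu>. slab_trans (?m \<nu>) l s j) \<in> borel_measurable ?M"
      by (intro borel_measurable_slab) auto
    also have "(\<lambda>\<nu>. slab_trans (?m \<nu>) l s j) = (\<lambda>\<nu>. slab_trans (masses l \<nu>) l s j)"
      by (intro ext slab_cong) auto
    finally show ?thesis .
  qed
  have step: "slab_trans (masses l (\<nu>(?y := z))) l s (Suc i)
      = ?T \<nu> * ((decay_root s + ?q \<nu>) / (decay_root s + ?q \<nu> + g z * s))" for \<nu> z
  proof -
    have "slab_trans (masses l (\<nu>(?y := z))) l s i = ?T \<nu>" "slab_adm (masses l (\<nu>(?y := z))) l s i = ?q \<nu>"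
      by (auto intro!: slab_cong simp: masses_def)
    moreover have "masses l (\<nu>(?y := z)) ?y = g z" using y by (simp add: masses_def)
    ultimately show ?thesis by simp
  qed
  have inner: "(\<integral>\<^sup>+z. ennreal ((norm (slab_trans (masses l (\<nu>(?y := z))) l s (Suc i) - 1))\<^sup>2) \<partial>N)
      \<le> ennreal (1 + 5 * \<kappa> * v) * ennreal (?A \<nu>) + ennreal (3 * \<kappa> * v)" for \<nu>
  proof -
    define d where "d = decay_root s + ?q \<nu>"
    define c1 where "c1 = 2 * Re (cnj (?T \<nu> - 1) * ?T \<nu> * (s / d))"
    define c2 where "c2 = \<kappa> * (3 + 5 * ?A \<nu>)"
    let ?B = "\<lambda>z. ?A \<nu> - g z * c1 + (g z)\<^sup>2 * c2"
    have le: "(norm (slab_trans (masses l (\<nu>(?y := z))) l s (Suc i) - 1))\<^sup>2 \<le> ?B z" for z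
    proof -
      have "Re (decay_root s) / 2 \<le> Re (d + g z * s)"
      proof -
        have "- 1 / 2 * Re s \<le> g z * Re s" using g_ge[of z] s by (intro mult_right_mono) auto
        then show ?thesis
          using Re_slab_adm_pos[OF s, of "masses l \<nu>" l i, OF masses_ge] Re_le_Re_decay_root[OF s] by (simp add: d_def)
      qed
      from one_site_bound[OF _ _ this \<kappa>, of "?T \<nu>"]
      show ?thesis
        using slab_denominator_lower_bounds(1)[OF s, of "masses l \<nu>" l i, OF masses_ge] Re_decay_root_pos[OF s]
        unfolding step c1_def c2_def d_def[symmetric] by (simp add: mult_ac)
    qed
    have "(\<integral>\<^sup>+z. ennreal ((norm (slab_trans (masses l (\<nu>(?y := z))) l s (Suc i) - 1))\<^sup>2) \<partial>N)
        \<le> (\<integral>\<^sup>+z. ennreal (?B z) \<partial>N)"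
      using le by (intro nn_integral_mono ennreal_leI)
    also have "\<dots> = ennreal (LINT z|N. ?B z)"
    proof (rule nn_integral_eq_integral)
      show "integrable N ?B"
        by (intro Bochner_Integration.integrable_add Bochner_Integration.integrable_diff
            integrable_mult_left integrable_const g_int)
      show "AE z in N. 0 \<le> ?B z" using le order_trans[OF zero_le_power2] by blast
    qed
    \<comment> \<open>Mean zero removes the term of first order, which is the only one without the
      small factor \<open>v\<close>.\<close>
    also have "(LINT z|N. ?B z) = ?A \<nu> + v * c2"
      using g_int by (simp add: g_moments prob_space)
    also have "\<dots> = (1 + 5 * \<kappa> * v) * ?A \<nu> + 3 * \<kappa> * v" by (simp add: c2_def algebra_simps)
    also have "ennreal \<dots> = ennreal (1 + 5 * \<kappa> * v) * ennreal (?A \<nu>) + ennreal (3 * \<kappa> * v)"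
      using v_nonneg \<kappa>0 by (intro ennreal_affine) auto
    finally show ?thesis .
  qed
  have "(\<integral>\<^sup>+\<nu>. ennreal ((norm (slab_trans (masses l \<nu>) l s (Suc i) - 1))\<^sup>2) \<partial>PiM (insert ?y ?I) (\<lambda>_. N))
      = (\<integral>\<^sup>+\<nu>. (\<integral>\<^sup>+z. ennreal ((norm (slab_trans (masses l (\<nu>(?y := z))) l s (Suc i) - 1))\<^sup>2) \<partial>N) \<partial>PiM ?I (\<lambda>_. N))"
  proof (rule P.product_nn_integral_insert)
    show "(\<lambda>\<nu>. ennreal ((norm (slab_trans (masses l \<nu>) l s (Suc i) - 1))\<^sup>2)) \<in> borel_measurable (PiM (insert ?y ?I) (\<lambda>_. N))"
      using meas[of "Suc i"] unfolding ins by measurable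
  qed auto
  also have "\<dots> \<le> (\<integral>\<^sup>+\<nu>. ennreal (1 + 5 * \<kappa> * v) * ennreal (?A \<nu>) + ennreal (3 * \<kappa> * v) \<partial>PiM ?I (\<lambda>_. N))"
    by (intro nn_integral_mono inner)
  also have "\<dots> = ennreal (1 + 5 * \<kappa> * v) * (\<integral>\<^sup>+\<nu>. ennreal (?A \<nu>) \<partial>PiM ?I (\<lambda>_. N)) + ennreal (3 * \<kappa> * v)"
  proof -
    interpret PP: prob_space "PiM ?I (\<lambda>_. N)" by (intro prob_space_PiM prob_space_axioms)
    have [measurable]: "?T \<in> borel_measurable (PiM ?I (\<lambda>_. N))" by (rule meas)
    show ?thesis by (simp add: nn_integral_add nn_integral_cmult PP.emeasure_space_1)
  qed
  also have "\<dots> \<le> ennreal (1 + 5 * \<kappa> * v) * ennreal (3 / 5 * ((1 + 5 * \<kappa> * v) ^ i - 1)) + ennreal (3 * \<kappa> * v)"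
    using Suc by (intro add_right_mono mult_left_mono) auto
  also have "\<dots> = ennreal ((1 + 5 * \<kappa> * v) * (3 / 5 * ((1 + 5 * \<kappa> * v) ^ i - 1)) + 3 * \<kappa> * v)"
    using v_nonneg \<kappa>0 by (intro ennreal_affine[symmetric]) (auto intro!: one_le_power)
  also have "(1 + 5 * \<kappa> * v) * (3 / 5 * ((1 + 5 * \<kappa> * v) ^ i - 1)) + 3 * \<kappa> * v = 3 / 5 * ((1 + 5 * \<kappa> * v) ^ Suc i - 1)"
    by (simp add: field_simps)
  finally show ?case unfolding ins .
qed simp

text \<open>The joint law of the samples in the slab is the product measure, and the transmission
  factor depends on no other coordinates.\<close>

lemma independent_transmission_second_moment:
  fixes l :: nat and s :: complex and P :: "'w measure" and \<nu> :: "int \<Rightarrow> 'w \<Rightarrow> real"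
  assumes P: "prob_space P" and indep: "prob_space.indep_vars P (\<lambda>_. borel) \<nu> {1..int l}"
    and law: "\<And>k. k \<in> {1..int l} \<Longrightarrow> distr P borel (\<nu> k) = N" and l: "l \<ge> 1"
    and s: "Re s > 0" and \<kappa>: "\<kappa> = (norm s / (Re (decay_root s) / 2))\<^sup>2"
  shows "(\<integral>\<^sup>+\<omega>. ennreal ((norm (slab_trans (masses l (\<lambda>y. \<nu> y \<omega>)) l s l - 1))\<^sup>2) \<partial>P)
    \<le> ennreal (3 / 5 * ((1 + 5 * \<kappa> * v) ^ l - 1))"
proof -
  interpret P: prob_space P by (rule P)
  let ?J = "{1..int l}"
  have rv [measurable]: "\<nu> k \<in> borel_measurable P" if "k \<in> ?J" for k
    using indep that unfolding P.indep_vars_def by auto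
  have mr: "(\<lambda>\<omega>. \<lambda>k\<in>?J. \<nu> k \<omega>) \<in> measurable P (PiM ?J (\<lambda>_. borel))"
    by (intro measurable_restrict rv)
  have J: "{int l - int l<..int l} = ?J" by auto
  have "distr P (PiM ?J (\<lambda>_. borel)) (\<lambda>\<omega>. \<lambda>k\<in>?J. \<nu> k \<omega>) = PiM ?J (\<lambda>k. distr P borel (\<nu> k))"
    using indep l by (subst (asm) P.indep_vars_iff_distr_eq_PiM') auto
  also have "\<dots> = PiM ?J (\<lambda>_. N)" using law by (intro PiM_cong) auto
  finally have distr: "distr P (PiM ?J (\<lambda>_. borel)) (\<lambda>\<omega>. \<lambda>k\<in>?J. \<nu> k \<omega>) = PiM ?J (\<lambda>_. N)" .
  let ?f = "\<lambda>\<nu>. ennreal ((norm (slab_trans (masses l \<nu>) l s l - 1))\<^sup>2)"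
  have meas: "(\<lambda>\<nu>. slab_trans (masses l \<nu>) l s l) \<in> borel_measurable (PiM ?J (\<lambda>_. borel))"
  proof (intro borel_measurable_slab)
    show "(\<lambda>\<nu>. masses l \<nu> y) \<in> borel_measurable (PiM ?J (\<lambda>_. borel))" for y
    proof (cases "y \<in> ?J")
      case True
      then show ?thesis by (simp add: masses_def)
    next
      case False
      then have "(\<lambda>\<nu>. masses l \<nu> y) = (\<lambda>_. 0)" by (auto simp: masses_def)
      then show ?thesis by simp
    qed
  qed auto
  have mf: "?f \<in> borel_measurable (PiM ?J (\<lambda>_. borel))" using meas by simp
  have eq: "masses l (\<lambda>y. \<nu> y \<omega>) = masses l (\<lambda>k\<in>?J. \<nu> k \<omega>)" for \<omega>
    by (auto simp: masses_def fun_eq_iff)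
  have "(\<integral>\<^sup>+\<omega>. ?f (\<lambda>y. \<nu> y \<omega>) \<partial>P) = (\<integral>\<^sup>+\<omega>. ?f (\<lambda>k\<in>?J. \<nu> k \<omega>) \<partial>P)" by (simp add: eq)
  also have "\<dots> = (\<integral>\<^sup>+\<nu>. ?f \<nu> \<partial>distr P (PiM ?J (\<lambda>_. borel)) (\<lambda>\<omega>. \<lambda>k\<in>?J. \<nu> k \<omega>))"
    using mf by (intro nn_integral_distr[OF mr, symmetric]) simp
  also have "\<dots> \<le> ennreal (3 / 5 * ((1 + 5 * \<kappa> * v) ^ l - 1))"
    unfolding distr using transmission_second_moment[OF s \<kappa> order_refl, of l] unfolding J .
  finally show ?thesis .
qed

end

section \<open>Airy function and the homogeneous lattice\<close>

definition airy_integrand :: "real \<Rightarrow> complex \<Rightarrow> complex" where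
  "airy_integrand y z = exp (z ^ 3 / 3 - y * z)"

lemma norm_airy_integrand:
  "norm (airy_integrand y (Complex p r)) = exp (p ^ 3 / 3 - y * p) * exp (- p * r\<^sup>2)"
proof -
  have "Re (Complex p r ^ 3) = p ^ 3 - 3 * p * r\<^sup>2"
    by (simp add: power3_eq_cube power2_eq_square complex_mult) (simp add: algebra_simps)
  then have "Re (Complex p r ^ 3 / 3 - y * Complex p r) = (p ^ 3 / 3 - y * p) + (- p * r\<^sup>2)"
    by (simp add: diff_divide_distrib)
  then show ?thesis unfolding airy_integrand_def norm_exp_eq_Re by (simp only: exp_add)
qed

lemma gaussian_moment_integrable:
  fixes c :: real
  assumes "c > 0"
  shows "integrable lborel (\<lambda>r. \<bar>r\<bar> ^ n * exp (- c * r\<^sup>2))"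
proof -
  define k where "k = sqrt (2 * c)"
  have k: "k > 0" "k\<^sup>2 = 2 * c" using assms by (auto simp: k_def)
  have "integrable lborel (\<lambda>r. std_normal_density (0 + k * r) * \<bar>0 + k * r\<bar> ^ n)"
    using k by (intro lborel_integrable_real_affine[OF integrable_std_normal_moment_abs]) auto
  then have "integrable lborel (\<lambda>r. sqrt (2 * pi) / k ^ n * (std_normal_density (0 + k * r) * \<bar>0 + k * r\<bar> ^ n))"
    by (rule integrable_mult_right)
  also have "(\<lambda>r. sqrt (2 * pi) / k ^ n * (std_normal_density (0 + k * r) * \<bar>0 + k * r\<bar> ^ n))
      = (\<lambda>r. \<bar>r\<bar> ^ n * exp (- c * r\<^sup>2))"
    using k by (auto simp: std_normal_density_def power_mult_distrib abs_mult)
  finally show ?thesis .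
qed

lemma airy_integrand_integrable:
  assumes "p > 0"
  shows "integrable lborel (\<lambda>r. airy_integrand y (Complex p r))"
proof (rule Bochner_Integration.integrable_bound)
  show "integrable lborel (\<lambda>r. exp (p ^ 3 / 3 - y * p) * exp (- p * r\<^sup>2))"
    using gaussian_moment_integrable[OF assms, of 0] by simp
  have "continuous_on UNIV (\<lambda>r. airy_integrand y (Complex p r))"
    unfolding airy_integrand_def by (intro continuous_intros) auto
  then show "(\<lambda>r. airy_integrand y (Complex p r)) \<in> borel_measurable lborel"
    using borel_measurable_continuous_onI by auto
qed (simp add: norm_airy_integrand)

text \<open>Cauchy's theorem on a rectangle: on the horizontal side at height \<open>r\<close> the
  integrand is at most \<open>K * exp (- p * r\<^sup>2)\<close>, whose integral over
  \<open>p\<close> is at most \<open>K / r\<^sup>2\<close>. On the imaginary axis the two halves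
  combine to the cosine in the definition of \<open>Ai\<close>. The shifted line has absolute
  convergence.\<close>

lemma Ai_contour_shift:
  assumes b: "b > 0"
  shows "of_real (Ai y) = 1 / (2 * pi) * (LINT r|lborel. airy_integrand y (Complex b r))"
proof -
  let ?F = "airy_integrand y"
  define I where "I = (LINT r|lborel. ?F (Complex b r))"
  have hol: "?F holomorphic_on UNIV" unfolding airy_integrand_def by (intro holomorphic_intros) auto
  obtain Q where Q: "\<And>z. (Q has_field_derivative ?F z) (at z)"
    using holomorphic_convex_primitive'[OF convex_UNIV open_UNIV hol] by (auto simp: )
  have vertical: "\<i> * integral {-R..R} (\<lambda>r. ?F (Complex p r)) = Q (Complex p R) - Q (Complex p (-R))" if "R > 0" for p R
  proof -
    have "(?F has_contour_integral Q (pathfinish (linepath (Complex p (- R)) (Complex p R)))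
        - Q (pathstart (linepath (Complex p (- R)) (Complex p R)))) (linepath (Complex p (- R)) (Complex p R))"
      by (rule contour_integral_primitive[of UNIV]) (auto intro: Q)
    from contour_integral_unique[OF this] show ?thesis
      using that by (subst (asm) contour_integral_linepath_same_Re[where c = p and a = "- R" and b = R]) auto
  qed
  define K where "K = exp (b ^ 3 / 3 + \<bar>y\<bar> * b)"
  have horizontal: "norm (Q (Complex b r) - Q (Complex 0 r)) \<le> K / r\<^sup>2" if r: "r \<noteq> 0" for r
  proof -
    have der: "((\<lambda>p. Q (Complex p r)) has_vector_derivative ?F (Complex p r)) (at p within {0..b})" for p
    proof -
      have "Complex p r = of_real p + \<i> * of_real r" by (simp add: complex_eq_iff)
      then have "((\<lambda>z. Q (z + \<i> * of_real r)) has_field_derivative ?F (Complex p r)) (at (of_real p))"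
        using Q[of "Complex p r"] by (simp only: DERIV_shift)
      from has_vector_derivative_real_field[OF this] show ?thesis
        by (simp only: Complex_eq)
    qed
    then have "((\<lambda>p. ?F (Complex p r)) has_integral (Q (Complex b r) - Q (Complex 0 r))) {0..b}"
      using b by (intro fundamental_theorem_of_calculus) auto
    moreover have "((\<lambda>p. K * exp (- p * r\<^sup>2)) has_integral (- K * exp (- b * r\<^sup>2) / r\<^sup>2 - (- K * exp (- 0 * r\<^sup>2) / r\<^sup>2))) {0..b}"
      using b r by (intro fundamental_theorem_of_calculus)
        (auto intro!: derivative_eq_intros simp: power2_eq_square power4_eq_xxxx simp flip: has_real_derivative_iff_has_vector_derivative)
    moreover have "norm (?F (Complex p r)) \<le> K * exp (- p * r\<^sup>2)" if p: "p \<in> {0..b}" for p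
    proof -
      have "p ^ 3 \<le> b ^ 3" using p by (intro power_mono) auto
      moreover have "- y * p \<le> \<bar>y\<bar> * p" using p by (intro mult_right_mono) auto
      moreover have "\<bar>y\<bar> * p \<le> \<bar>y\<bar> * b" using p by (intro mult_left_mono) auto
      ultimately show ?thesis unfolding norm_airy_integrand K_def
        by (intro mult_right_mono) auto
    qed
    ultimately have "norm (Q (Complex b r) - Q (Complex 0 r)) \<le> - K * exp (- b * r\<^sup>2) / r\<^sup>2 - (- K * exp (- 0 * r\<^sup>2) / r\<^sup>2)"
      by (metis (no_types, lifting) has_integral_iff integral_norm_bound_integral)
    also have "\<dots> \<le> K / r\<^sup>2" by (simp add: K_def)
    finally show ?thesis .
  qed
  have lim_b: "((\<lambda>R. integral {-R..R} (\<lambda>r. ?F (Complex b r))) \<longlongrightarrow> I) at_top"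
  proof -
    have "((\<lambda>R. LINT r|lborel. indicator {-R..R} r *\<^sub>R ?F (Complex b r)) \<longlongrightarrow> I) at_top"
      unfolding I_def
    proof (rule integral_dominated_convergence_at_top[where w = "\<lambda>r. norm (?F (Complex b r))"])
      show "AE r in lborel. ((\<lambda>R. indicator {-R..R} r *\<^sub>R ?F (Complex b r)) \<longlongrightarrow> ?F (Complex b r)) at_top"
      proof (rule AE_I2, rule tendsto_eventually)
        fix r :: real
        show "\<forall>\<^sub>F R in at_top. indicator {-R..R} r *\<^sub>R ?F (Complex b r) = ?F (Complex b r)"
          using eventually_ge_at_top[of "\<bar>r\<bar>"] by eventually_elim (simp add: indicator_def abs_le_iff)
      qed
    qed (use airy_integrand_integrable[OF b, of y] in \<open>auto simp: indicator_def\<close>)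
    moreover have "(LINT r|lborel. indicator {-R..R} r *\<^sub>R ?F (Complex b r)) = integral {-R..R} (\<lambda>r. ?F (Complex b r))" for R
    proof -
      have "set_integrable lborel {-R..R} (\<lambda>r. ?F (Complex b r))"
        unfolding set_integrable_def using airy_integrand_integrable[OF b, of y]
        by (intro integrable_mult_indicator) auto
      from set_borel_integral_eq_integral(2)[OF this] show ?thesis by (simp add: set_lebesgue_integral_def)
    qed
    ultimately show ?thesis by simp
  qed
  have cos_eq: "integral {-R..R} (\<lambda>r. ?F (Complex 0 r)) = of_real (2 * integral {0..R} (\<lambda>s. cos (s ^ 3 / 3 + y * s)))"
    if R: "R > 0" for R
  proof -
    define h where "h r = r ^ 3 / 3 + y * r" for r :: real
    have F0: "?F (Complex 0 r) = cis (- h r)" for r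
    proof -
      have "Complex 0 r ^ 3 / 3 - y * Complex 0 r = \<i> * of_real (- h r)"
        unfolding h_def by (simp add: complex_eq_iff power3_eq_cube)
      then show ?thesis unfolding airy_integrand_def cis_conv_exp by simp
    qed
    have int: "(\<lambda>r. ?F (Complex 0 r)) integrable_on {u..v}" for u v
      unfolding airy_integrand_def complex_eq by (intro integrable_continuous_real continuous_intros) auto
    have cos_int: "(\<lambda>r. cos (h r)) integrable_on {u..v}" for u v
      unfolding h_def by (intro integrable_continuous_real continuous_intros) auto
    have "integral {-R..R} (\<lambda>r. ?F (Complex 0 r)) = integral {-R..0} (\<lambda>r. ?F (Complex 0 r)) + integral {0..R} (\<lambda>r. ?F (Complex 0 r))"
      using R int by (intro Henstock_Kurzweil_Integration.integral_combine[symmetric]) auto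
    also have "integral {-R..0} (\<lambda>r. ?F (Complex 0 r)) = integral {0..R} (\<lambda>r. ?F (Complex 0 (- r)))"
      using Henstock_Kurzweil_Integration.integral_reflect_real[of R 0 "\<lambda>r. ?F (Complex 0 (- r))"] by simp
    also have "\<dots> + integral {0..R} (\<lambda>r. ?F (Complex 0 r)) = integral {0..R} (\<lambda>r. ?F (Complex 0 (- r)) + ?F (Complex 0 r))"
    proof (rule Henstock_Kurzweil_Integration.integral_add[symmetric, OF _ int])
      show "(\<lambda>r. ?F (Complex 0 (- r))) integrable_on {0..R}"
        unfolding airy_integrand_def complex_eq by (intro integrable_continuous_real continuous_intros) auto
    qed
    also have "\<dots> = integral {0..R} (\<lambda>r. complex_of_real (2 * cos (h r)))"
    proof (rule integral_cong)
      fix r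
      have "h (- r) = - h r" by (simp add: h_def power3_eq_cube)
      then show "?F (Complex 0 (- r)) + ?F (Complex 0 r) = complex_of_real (2 * cos (h r))"
        unfolding F0 by (simp add: complex_eq_iff)
    qed
    also have "\<dots> = complex_of_real (integral {0..R} (\<lambda>r. 2 * cos (h r)))"
      using cos_int by (intro integral_unique has_integral_of_real integrable_integral integrable_on_cmult_left) auto
    finally show ?thesis by (simp add: h_def)
  qed
  have "((\<lambda>R. integral {-R..R} (\<lambda>r. ?F (Complex b r)) - integral {-R..R} (\<lambda>r. ?F (Complex 0 r))) \<longlongrightarrow> 0) at_top"
  proof (rule Lim_null_comparison)
    show "\<forall>\<^sub>F R in at_top. norm (integral {-R..R} (\<lambda>r. ?F (Complex b r)) - integral {-R..R} (\<lambda>r. ?F (Complex 0 r))) \<le> 2 * K / R\<^sup>2"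
      using eventually_gt_at_top[of 0]
    proof eventually_elim
      case (elim R)
      have "norm (\<i> * (integral {-R..R} (\<lambda>r. ?F (Complex b r)) - integral {-R..R} (\<lambda>r. ?F (Complex 0 r))))
         = norm ((Q (Complex b R) - Q (Complex 0 R)) - (Q (Complex b (-R)) - Q (Complex 0 (-R))))"
        unfolding right_diff_distrib vertical[OF elim] by (simp add: algebra_simps)
      also have "\<dots> \<le> K / R\<^sup>2 + K / (-R)\<^sup>2"
        using elim by (intro order_trans[OF norm_triangle_ineq4] add_mono horizontal) auto
      finally show ?case by (simp add: norm_mult)
    qed
    show "((\<lambda>R. 2 * K / R\<^sup>2) \<longlongrightarrow> 0) at_top" by real_asymp
  qed
  from tendsto_diff[OF lim_b this]
  have "((\<lambda>R. integral {-R..R} (\<lambda>r. ?F (Complex 0 r))) \<longlongrightarrow> I) at_top" by simp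
  then have "((\<lambda>R. complex_of_real (2 * integral {0..R} (\<lambda>s. cos (s ^ 3 / 3 + y * s)))) \<longlongrightarrow> I) at_top"
    by (rule Lim_transform_eventually) (use cos_eq in \<open>auto intro: eventually_mono[OF eventually_gt_at_top[of 0]]\<close>)
  note lim = this
  from tendsto_Re[OF lim] have "((\<lambda>R. (2 * integral {0..R} (\<lambda>s. cos (s ^ 3 / 3 + y * s))) / 2) \<longlongrightarrow> Re I / 2) at_top"
    by (intro tendsto_intros) auto
  \<comment> \<open>\<open>Lim\<close> has a useful value only for a convergent argument;
    convergence of the oscillating integral has just been inherited from the shifted line.\<close>
  then have "Lim at_top (\<lambda>R. integral {0..R} (\<lambda>s. cos (s ^ 3 / 3 + y * s))) = Re I / 2"
    by (intro tendsto_Lim) auto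
  moreover have "Im I = 0" using tendsto_unique[OF trivial_limit_at_top_linorder tendsto_Im[OF lim]] by simp
  ultimately show ?thesis unfolding Ai_def I_def[symmetric] by (simp add: complex_eq_iff field_simps)
qed

section \<open>Low-frequency expansion of the logarithm of the decay root\<close>

lemma csqrt_expansion:
  assumes "norm w \<le> 1 / 4"
  shows "norm (1 / (2 * csqrt (1 + w)) - 1 / 2 + w / 4) \<le> 2 * (norm w)\<^sup>2"
proof -
  define r where "r = csqrt (1 + w)"
  have r2: "r\<^sup>2 = 1 + w" by (simp add: r_def)
  have Re_r: "Re r \<ge> 0" unfolding r_def using csqrt_principal[of "1 + w"] by auto
  have "1 \<le> Re (r + 1)" using Re_r by simp
  also have "\<dots> \<le> norm (r + 1)" by (rule complex_Re_le_cmod)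
  finally have r1: "1 \<le> norm (r + 1)" .
  have "w = (r - 1) * (r + 1)" using r2 by (simp add: algebra_simps power2_eq_square)
  then have "norm w = norm (r - 1) * norm (r + 1)" by (simp add: norm_mult)
  moreover have "norm (r - 1) * 1 \<le> norm (r - 1) * norm (r + 1)" using r1 by (intro mult_left_mono) auto
  ultimately have rw: "norm (r - 1) \<le> norm w" by simp
  have nr: "3 / 4 \<le> norm r" "norm (r + 2) \<le> 13 / 4"
    using rw assms norm_triangle_ineq2[of 1 "1 - r"] norm_triangle_ineq[of "r - 1" 3]
    by (auto simp: norm_minus_commute algebra_simps)
  then have rnz: "r \<noteq> 0" by auto
  have w: "w = r\<^sup>2 - 1" using r2 by simp
  \<comment> \<open>In terms of the root \<open>r\<close> the Taylor remainder is rational with a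
    visible double zero at \<open>r = 1\<close>, and \<open>r - 1\<close> is at most
    \<open>w\<close> in norm.\<close>
  have "1 / (2 * r) - 1 / 2 + w / 4 = (r - 1)\<^sup>2 * (r + 2) / (4 * r)"
    unfolding w using rnz by (simp add: field_simps) (simp add: algebra_simps power2_eq_square power3_eq_cube)
  then have "norm (1 / (2 * r) - 1 / 2 + w / 4) = (norm (r - 1))\<^sup>2 * norm (r + 2) / (4 * norm r)"
    by (simp add: norm_divide norm_mult norm_power)
  also have "\<dots> \<le> (norm w)\<^sup>2 * (13 / 4) / (4 * (3 / 4))"
    using rw nr by (intro frac_le mult_mono power_mono) auto
  also have "\<dots> \<le> 2 * (norm w)\<^sup>2" by simp
  finally show ?thesis by (simp add: r_def)
qed

text \<open>\<open>Ln (decay_root s)\<close> is \<open>arsinh (s / 2)\<close> near 0: the derivative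
  of \<open>decay_root\<close> is \<open>decay_root\<close> times the stated factor. The work
  consists in staying off the cuts of the root and the logarithm.\<close>

lemma Ln_decay_root_deriv:
  assumes "norm s < 1"
  shows "((\<lambda>s. Ln (decay_root s)) has_field_derivative 1 / (2 * csqrt (1 + s\<^sup>2 / 4))) (at s)"
proof -
  define r where "r = csqrt (1 + s\<^sup>2 / 4)"
  have "(norm s)\<^sup>2 < 1" using assms by (simp add: abs_square_less_1)
  then have "norm (s\<^sup>2 / 4) < 1" by (simp add: norm_power norm_divide)
  then have "\<bar>Re (s\<^sup>2 / 4)\<bar> < 1" using abs_Re_le_cmod[of "s\<^sup>2 / 4"] by linarith
  then have "Re (1 + s\<^sup>2 / 4) > 0" unfolding plus_complex.sel one_complex.sel by linarith
  then have nonpos: "1 + s\<^sup>2 / 4 \<notin> \<real>\<^sub>\<le>\<^sub>0" by (auto simp: complex_nonpos_Reals_iff)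
  then have rnz: "r \<noteq> 0" unfolding r_def by auto
  have r_half: "Re r > 1 / 2"
  proof -
    have "norm (s\<^sup>2 / 4) \<le> 1 / 4" using \<open>(norm s)\<^sup>2 < 1\<close> by (simp add: norm_power norm_divide)
    then have "\<bar>Re (s\<^sup>2 / 4)\<bar> \<le> 1 / 4" using abs_Re_le_cmod[of "s\<^sup>2 / 4"] by linarith
    then have Re34: "Re (1 + s\<^sup>2 / 4) \<ge> 3 / 4" unfolding plus_complex.sel one_complex.sel by linarith
    have "(Re r)\<^sup>2 - (Im r)\<^sup>2 = Re (r\<^sup>2)" by (simp add: power2_eq_square)
    also have "r\<^sup>2 = 1 + s\<^sup>2 / 4" by (simp add: r_def)
    finally have "(Re r)\<^sup>2 \<ge> 3 / 4" using Re34 zero_le_power2[of "Im r"] by linarith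
    then have "(1 / 2)\<^sup>2 < (Re r)\<^sup>2" by (simp add: power2_eq_square)
    then show ?thesis
      by (rule power2_less_imp_less) (use csqrt_principal[of "1 + s\<^sup>2 / 4"] in \<open>auto simp: r_def simp del: csqrt.sel\<close>)
  qed
  have "\<bar>Re s\<bar> < 1" using abs_Re_le_cmod[of s] assms by linarith
  then have "Re (decay_root s) > 0" using r_half by (simp add: decay_root_def r_def)
  then have b: "decay_root s \<notin> \<real>\<^sub>\<le>\<^sub>0" by (auto simp: complex_nonpos_Reals_iff)
  have "(decay_root has_field_derivative 1 / 2 + (2 * s / 4) / (2 * r)) (at s)"
    unfolding decay_root_def[abs_def] r_def using nonpos
    by (auto intro!: derivative_eq_intros simp: field_simps)
  also have "1 / 2 + (2 * s / 4) / (2 * r) = decay_root s / (2 * r)"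
  proof -
    have "decay_root s = s / 2 + r" by (simp add: decay_root_def r_def)
    then show ?thesis using rnz by (simp add: add_divide_distrib)
  qed
  finally have "(decay_root has_field_derivative decay_root s / (2 * r)) (at s)" .
  from DERIV_chain2[OF has_field_derivative_Ln[OF b] this]
  show ?thesis using decay_root_nonzero[of s] by (simp add: r_def field_simps)
qed

text \<open>The derivative of the left side is the remainder of \<open>csqrt_expansion\<close> at
  \<open>w = s\<^sup>2 / 4\<close>, so the mean value inequality gives fifth order. Multiplied by
  \<open>2 * x\<close>, the cubic term becomes the \<open>S ^ 3 / 24\<close> of the limit.\<close>

lemma Ln_decay_root_expansion:
  assumes "norm s < 1"
  shows "norm (Ln (decay_root s) - s / 2 + s ^ 3 / 48) \<le> norm s ^ 5"
proof -
  let ?f = "\<lambda>s. Ln (decay_root s) - s / 2 + s ^ 3 / 48"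
  let ?f' = "\<lambda>s. 1 / (2 * csqrt (1 + s\<^sup>2 / 4)) - 1 / 2 + s\<^sup>2 / 4 / 4"
  have "norm (?f s - ?f 0) \<le> norm s ^ 4 * norm (s - 0)"
  proof (rule field_differentiable_bound[where S = "cball (0::complex) (norm s)" and f' = ?f'])
    fix z :: complex assume "z \<in> cball 0 (norm s)"
    then have z: "norm z \<le> norm s" "norm z < 1" using assms by auto
    have "(?f has_field_derivative ?f' z) (at z)"
      by (rule derivative_eq_intros Ln_decay_root_deriv z refl | simp add: power2_eq_square)+
    then show "(?f has_field_derivative ?f' z) (at z within cball 0 (norm s))"
      by (rule has_field_derivative_at_within)
    have "(norm z)\<^sup>2 \<le> 1" using z by (simp add: abs_square_le_1)
    then have "norm (?f' z) \<le> 2 * (norm (z\<^sup>2 / 4))\<^sup>2"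
      by (intro csqrt_expansion) (simp add: norm_divide norm_power)
    also have "\<dots> = norm z ^ 4 / 8" by (simp add: norm_divide norm_power power_divide)
    also have "\<dots> \<le> norm z ^ 4" by simp
    also have "\<dots> \<le> norm s ^ 4" using z(1) by (intro power_mono) auto
    finally show "norm (?f' z) \<le> norm s ^ 4" .
  qed auto
  moreover have "?f 0 = 0" by (simp add: decay_root_def)
  ultimately show ?thesis by (simp add: power_Suc2 numeral_eq_Suc del: power_Suc)
qed

section \<open>The homogeneous integrand on the line \<open>Re s = B / X\<close>\<close>

context
  fixes X B \<beta> :: real and x :: nat
  assumes X: "X > 0" "X ^ 3 = real x" and B: "B \<ge> 1" "2 * B \<le> X"
begin

text \<open>The growth \<open>B * X\<^sup>2\<close> of \<open>exp (s * t)\<close> cancels against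
  the spatial decay and leaves the Gaussian. The prefactor is at most 1 for
  \<open>\<bar>\<rho>\<bar> \<le> X\<close>; beyond that it may reach \<open>X / B\<close> at the
  band edge, and there \<open>\<bar>\<rho>\<bar>\<close> itself exceeds it.\<close>

lemma scaled_free_integrand_bound:
  assumes \<rho>: "\<bar>\<rho>\<bar> \<le> 4 * X"
  shows "norm (free_integrand x (real x + X * \<beta>) (Complex (B / X) (\<rho> / X)))
    \<le> exp (B * \<beta> + B ^ 3) * ((1 + \<bar>\<rho>\<bar>) * exp (- (B / 20) * \<rho>\<^sup>2))"
proof -
  define s where "s = Complex (B / X) (\<rho> / X)"
  let ?b = "decay_root s" and ?t = "real x + X * \<beta>"
  have s: "Re s > 0" "Re s \<le> 1 / 2" "\<bar>Im s\<bar> \<le> 4"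
    using X B \<rho> by (auto simp: s_def abs_divide field_simps)
  have b: "norm ?b > 1" by (rule norm_decay_root_gt_1[OF s(1)])
  have "norm (exp (s * ?t)) = exp (B / X * ?t)" by (simp add: s_def)
  moreover have "norm (?b ^ (2 * x)) = exp (real x * ln ((norm ?b)\<^sup>2))"
  proof -
    have "0 < (norm ?b)\<^sup>2" using b by (intro zero_less_power) linarith
    then have "exp (real x * ln ((norm ?b)\<^sup>2)) = ((norm ?b)\<^sup>2) ^ x" by (simp only: exp_of_nat_mult exp_ln)
    then show ?thesis by (simp add: norm_power power_mult)
  qed
  moreover have "B / X * ?t - real x * ln ((norm ?b)\<^sup>2) \<le> B * \<beta> + B ^ 3 - (B / 20) * \<rho>\<^sup>2"
  proof -
    have "real x * (Re s * (1 + (Im s)\<^sup>2 / 20) - (Re s) ^ 3) \<le> real x * ln ((norm ?b)\<^sup>2)"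
      using ln_norm_decay_root_lower_bound[OF s] by (intro mult_left_mono) auto
    moreover have "real x * (Re s * (1 + (Im s)\<^sup>2 / 20) - (Re s) ^ 3) = B / X * real x + (B / 20) * \<rho>\<^sup>2 - B ^ 3"
      unfolding X(2)[symmetric] s_def using X(1)
      by (simp add: field_simps power2_eq_square power3_eq_cube)
    moreover have "B / X * ?t = B / X * real x + B * \<beta>" using X(1) by (simp add: distrib_left)
    ultimately show ?thesis by linarith
  qed
  ultimately have "norm (exp (s * ?t)) / norm (?b ^ (2 * x)) \<le> exp (B * \<beta> + B ^ 3 - (B / 20) * \<rho>\<^sup>2)"
    by (simp flip: exp_diff)
  moreover have "1 / norm (?b + 1 / ?b) \<le> 1 + \<bar>\<rho>\<bar>"
  proof (cases "\<bar>\<rho>\<bar> \<le> X")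
    case True
    have "norm (?b + 1 / ?b) \<ge> 1"
      using X(1) True by (intro low_frequency_bounds[OF s(1)]) (simp add: s_def abs_divide field_simps)
    moreover have "1 / n \<le> 1" if "1 \<le> n" for n :: real using that by simp
    ultimately have "1 / norm (?b + 1 / ?b) \<le> 1" by blast
    then show ?thesis by simp
  next
    case False
    have "B / X \<le> norm (?b + 1 / ?b)" using norm_decay_root_plus[OF s(1)] by (simp add: s_def)
    moreover have "0 < B / X" using B X by (intro divide_pos_pos) auto
    moreover have "1 / n \<le> 1 / k" if "k \<le> n" "0 < k" for n k :: real using that by (intro frac_le) auto
    ultimately have "1 / norm (?b + 1 / ?b) \<le> 1 / (B / X)" by blast
    also have "1 / (B / X) \<le> X" using B X by (simp add: divide_le_eq)
    finally show ?thesis using False by linarith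
  qed
  ultimately have "norm (exp (s * ?t)) / norm (?b ^ (2 * x)) * (1 / norm (?b + 1 / ?b))
      \<le> exp (B * \<beta> + B ^ 3 - (B / 20) * \<rho>\<^sup>2) * (1 + \<bar>\<rho>\<bar>)"
    by (intro mult_mono) auto
  also have "\<dots> = exp (B * \<beta> + B ^ 3) * ((1 + \<bar>\<rho>\<bar>) * exp (- (B / 20) * \<rho>\<^sup>2))"
  proof -
    have "exp (p - B / 20 * q) = exp p * exp (- (B / 20) * q)" for p q :: real by (simp flip: exp_add)
    then show ?thesis by (simp only: mult_ac)
  qed
  finally show ?thesis by (simp add: free_integrand_def s_def[symmetric] norm_divide norm_mult)
qed

text \<open>\<open>e\<close> is \<open>2 * x\<close> times the fifth-order remainder of the
  logarithm, hence of order \<open>X ^ 3 * (norm S / X) ^ 5\<close>. Kept inside the exponential, it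
  makes the formula an exact identity.\<close>

lemma scaled_free_integrand_expansion:
  fixes S :: complex
  assumes S_def: "S = Complex B \<rho>" and \<rho>: "norm S < X"
  shows "\<exists>e. norm e \<le> 2 * norm S ^ 5 / X\<^sup>2 \<and>
    free_integrand x (real x + X * \<beta>) (Complex (B / X) (\<rho> / X))
      = exp (\<beta> * S + S ^ 3 / 24 - e) / (2 * csqrt (1 + (S / X)\<^sup>2 / 4))"
proof -
  define s where "s = S / X"
  have s: "Complex (B / X) (\<rho> / X) = s" by (simp add: s_def S_def complex_eq_iff)
  let ?b = "decay_root s" and ?t = "real x + X * \<beta>"
  have ns: "norm s < 1" using \<rho> X by (simp add: s_def S_def norm_divide)
  define e where "e = 2 * real x * (Ln ?b - s / 2 + s ^ 3 / 48)"
  have cX: "complex_of_real X \<noteq> 0" using X by simp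
  have x3: "of_nat x = complex_of_real X ^ 3" using X(2) by (metis of_real_of_nat_eq of_real_power)
  have "norm e = 2 * X ^ 3 * norm (Ln ?b - s / 2 + s ^ 3 / 48)"
    using X by (simp add: e_def norm_mult)
  also have "\<dots> \<le> 2 * X ^ 3 * norm s ^ 5"
    using Ln_decay_root_expansion[OF ns] X by (intro mult_left_mono) auto
  also have "\<dots> = 2 * norm S ^ 5 / X\<^sup>2"
    using X(1) by (simp add: s_def norm_divide power_divide field_simps flip: power_add)
  finally have "norm e \<le> 2 * norm S ^ 5 / X\<^sup>2" .
  moreover have expo: "s * ?t - of_nat (2 * x) * Ln ?b = \<beta> * S + S ^ 3 / 24 - e"
  proof -
    have "s * ?t = S * X\<^sup>2 + \<beta> * S"
      using cX by (simp add: s_def x3 field_simps power2_eq_square power3_eq_cube)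
    moreover have "of_nat (2 * x) * Ln ?b = e + S * X\<^sup>2 - S ^ 3 / 24"
    proof -
      have "2 * complex_of_real X ^ 3 * (s / 2) = S * X\<^sup>2"
        using cX by (simp add: s_def field_simps power2_eq_square power3_eq_cube)
      moreover have "2 * complex_of_real X ^ 3 * (s ^ 3 / 48) = S ^ 3 / 24"
        using cX by (simp add: s_def power_divide)
      moreover have "e = 2 * complex_of_real X ^ 3 * Ln ?b - 2 * complex_of_real X ^ 3 * (s / 2) + 2 * complex_of_real X ^ 3 * (s ^ 3 / 48)"
        by (simp add: e_def x3 algebra_simps)
      ultimately show ?thesis by (simp add: x3)
    qed
    ultimately show ?thesis by simp
  qed
  moreover have "free_integrand x ?t s = exp (\<beta> * S + S ^ 3 / 24 - e) / (2 * csqrt (1 + s\<^sup>2 / 4))"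
  proof -
    have pow: "?b ^ (2 * x) = exp (of_nat (2 * x) * Ln ?b)"
      unfolding exp_of_nat_mult exp_Ln[OF decay_root_nonzero] ..
    have "free_integrand x ?t s = exp (s * ?t) / ?b ^ (2 * x) / (?b + 1 / ?b)"
      by (simp only: free_integrand_def divide_divide_eq_left of_real_add of_real_mult)
    then show ?thesis unfolding pow decay_root_plus exp_diff[symmetric] expo .
  qed
  ultimately show ?thesis unfolding s by (intro exI[of _ e] conjI) (simp_all only: s_def)
qed

end

lemma filterlim_root3: "filterlim (\<lambda>x::nat. root 3 (real x)) at_top sequentially"
proof -
  have "filterlim (root 3) at_top at_top" by real_asymp
  then show ?thesis using filterlim_compose filterlim_real_sequentially by blast
qed

lemma scaled_free_integrand_limit:
  fixes B \<beta> \<rho> :: real and S :: complex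
  assumes B: "B \<ge> 1" and S_def: "S = Complex B \<rho>"
  defines "X \<equiv> \<lambda>x::nat. root 3 (real x)"
  shows "(\<lambda>x. free_integrand x (real x + X x * \<beta>) (Complex (B / X x) (\<rho> / X x)))
    \<longlonglongrightarrow> exp (\<beta> * S + S ^ 3 / 24) / 2"
proof -
  have Xinf: "filterlim X at_top sequentially" unfolding X_def by (rule filterlim_root3)
  have X3: "X x ^ 3 = real x" for x by (simp add: X_def odd_real_root_pow)
  let ?good = "\<lambda>x. 0 < X x \<and> 2 * B \<le> X x \<and> norm S < X x"
  have "\<exists>e. ?good x \<longrightarrow> norm e \<le> 2 * norm S ^ 5 / (X x)\<^sup>2 \<and>
      free_integrand x (real x + X x * \<beta>) (Complex (B / X x) (\<rho> / X x))
        = exp (\<beta> * S + S ^ 3 / 24 - e) / (2 * csqrt (1 + (S / X x)\<^sup>2 / 4))" for x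
    using scaled_free_integrand_expansion[OF _ X3 B _ S_def] by blast
  then obtain e where e: "\<And>x. ?good x \<Longrightarrow> norm (e x) \<le> 2 * norm S ^ 5 / (X x)\<^sup>2"
    "\<And>x. ?good x \<Longrightarrow> free_integrand x (real x + X x * \<beta>) (Complex (B / X x) (\<rho> / X x))
        = exp (\<beta> * S + S ^ 3 / 24 - e x) / (2 * csqrt (1 + (S / X x)\<^sup>2 / 4))" by metis
  have good: "\<forall>\<^sub>F x in sequentially. ?good x"
  proof -
    have gt: "\<forall>\<^sub>F x in sequentially. Z < X x" for Z
      using Xinf unfolding filterlim_at_top_dense by blast
    show ?thesis using gt[of 0] gt[of "2 * B"] gt[of "norm S"] by eventually_elim simp
  qed
  have inv0: "(\<lambda>x. c / X x) \<longlonglongrightarrow> 0" for c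
    by (rule tendsto_divide_0[OF tendsto_const filterlim_at_top_imp_at_infinity[OF Xinf]])
  have "e \<longlonglongrightarrow> 0"
  proof (rule Lim_null_comparison)
    show "\<forall>\<^sub>F x in sequentially. norm (e x) \<le> 2 * norm S ^ 5 / (X x)\<^sup>2"
      using good by eventually_elim (rule e(1))
    have "(\<lambda>x. 2 * norm S ^ 5 / X x * (1 / X x)) \<longlonglongrightarrow> 0 * 0" by (intro tendsto_mult inv0)
    then show "(\<lambda>x. 2 * norm S ^ 5 / (X x)\<^sup>2) \<longlonglongrightarrow> 0" by (simp add: power2_eq_square)
  qed
  moreover have "(\<lambda>x. S / X x) \<longlonglongrightarrow> 0"
  proof (rule tendsto_norm_zero_cancel)
    have "(\<lambda>x. \<bar>norm S / X x\<bar>) \<longlonglongrightarrow> 0" using inv0 by (rule tendsto_rabs_zero)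
    then show "(\<lambda>x. norm (S / X x)) \<longlonglongrightarrow> 0" by (simp add: norm_divide)
  qed
  then have "(\<lambda>x. 1 + (S / X x)\<^sup>2 / 4) \<longlonglongrightarrow> 1 + 0\<^sup>2 / 4" by (intro tendsto_intros) auto
  then have "(\<lambda>x. csqrt (1 + (S / X x)\<^sup>2 / 4)) \<longlonglongrightarrow> csqrt (1 + 0\<^sup>2 / 4)"
    by (intro isCont_tendsto_compose[OF continuous_at_csqrt]) auto
  ultimately have "(\<lambda>x. exp (\<beta> * S + S ^ 3 / 24 - e x) / (2 * csqrt (1 + (S / X x)\<^sup>2 / 4)))
      \<longlonglongrightarrow> exp (\<beta> * S + S ^ 3 / 24 - 0) / (2 * csqrt (1 + 0\<^sup>2 / 4))"
    by (intro tendsto_intros) auto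
  then have "(\<lambda>x. exp (\<beta> * S + S ^ 3 / 24 - e x) / (2 * csqrt (1 + (S / X x)\<^sup>2 / 4)))
      \<longlonglongrightarrow> exp (\<beta> * S + S ^ 3 / 24) / 2" by simp
  moreover have "\<forall>\<^sub>F x in sequentially. exp (\<beta> * S + S ^ 3 / 24 - e x) / (2 * csqrt (1 + (S / X x)\<^sup>2 / 4))
      = free_integrand x (real x + X x * \<beta>) (Complex (B / X x) (\<rho> / X x))"
    using good by eventually_elim (rule e(2)[symmetric])
  ultimately show ?thesis by (rule Lim_transform_eventually)
qed

lemma scaled_chord_integral:
  fixes f :: "real \<Rightarrow> complex"
  assumes X: "X > 0" and f: "continuous_on {- \<Lambda>..\<Lambda>} f"
  shows "of_real X * integral {- \<Lambda>..\<Lambda>} f = (LINT \<rho>|lborel. indicator {- (X * \<Lambda>)..X * \<Lambda>} \<rho> *\<^sub>R f (\<rho> / X))"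
proof -
  have "set_integrable lborel {- \<Lambda>..\<Lambda>} f" by (rule borel_integrable_atLeastAtMost'[OF f])
  from set_borel_integral_eq_integral(2)[OF this]
  have "integral {- \<Lambda>..\<Lambda>} f = (LINT r|lborel. indicator {- \<Lambda>..\<Lambda>} r *\<^sub>R f r)"
    by (simp add: set_lebesgue_integral_def)
  also have "\<dots> = \<bar>1 / X\<bar> *\<^sub>R (LINT \<rho>|lborel. indicator {- \<Lambda>..\<Lambda>} (0 + 1 / X * \<rho>) *\<^sub>R f (0 + 1 / X * \<rho>))"
    by (rule lborel_integral_real_affine) (use X in auto)
  also have "(\<lambda>\<rho>. indicator {- \<Lambda>..\<Lambda>} (0 + 1 / X * \<rho>) *\<^sub>R f (0 + 1 / X * \<rho>))
      = (\<lambda>\<rho>. indicator {- (X * \<Lambda>)..X * \<Lambda>} \<rho> *\<^sub>R f (\<rho> / X))"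
    using X by (auto simp: fun_eq_iff indicator_def field_simps)
  finally show ?thesis using X by (simp add: scaleR_conv_of_real)
qed

lemma continuous_on_chord:
  assumes "f holomorphic_on {s. Re s > 0}" "a > 0"
  shows "continuous_on A (\<lambda>r. f (Complex a r))"
proof -
  have "continuous_on A (\<lambda>r. Complex a r)" unfolding complex_eq by (intro continuous_intros) 
  then show ?thesis
    by (rule continuous_on_compose2[OF holomorphic_on_imp_continuous_on[OF assms(1)]]) (use assms(2) in auto)
qed

text \<open>The substitution \<open>S = 2 * z\<close>; the factor \<open>1 / 2\<close> left over
  from the square-root prefactor is its Jacobian.\<close>

lemma Ai_as_limit_integral:
  assumes B: "B > 0"
  shows "1 / (2 * pi) * (LINT \<rho>|lborel. exp (\<beta> * Complex B \<rho> + Complex B \<rho> ^ 3 / 24) / 2) = of_real (Ai (- 2 * \<beta>))"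
proof -
  have "(LINT r|lborel. airy_integrand (- 2 * \<beta>) (Complex (B / 2) r))
      = \<bar>1 / 2\<bar> *\<^sub>R (LINT \<rho>|lborel. airy_integrand (- 2 * \<beta>) (Complex (B / 2) (0 + 1 / 2 * \<rho>)))"
    by (rule lborel_integral_real_affine) simp
  also have "(\<lambda>\<rho>. airy_integrand (- 2 * \<beta>) (Complex (B / 2) (0 + 1 / 2 * \<rho>)))
      = (\<lambda>\<rho>. exp (\<beta> * Complex B \<rho> + Complex B \<rho> ^ 3 / 24))"
  proof
    fix \<rho>
    have eq: "Complex (B / 2) (0 + 1 / 2 * \<rho>) = Complex B \<rho> / 2" by (simp add: complex_eq_iff)
    show "airy_integrand (- 2 * \<beta>) (Complex (B / 2) (0 + 1 / 2 * \<rho>)) = exp (\<beta> * Complex B \<rho> + Complex B \<rho> ^ 3 / 24)"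
      unfolding eq airy_integrand_def by (simp add: power_divide add.commute)
  qed
  finally have "(LINT \<rho>|lborel. exp (\<beta> * Complex B \<rho> + Complex B \<rho> ^ 3 / 24) / 2)
      = (LINT r|lborel. airy_integrand (- 2 * \<beta>) (Complex (B / 2) r))"
    by (simp add: scaleR_conv_of_real)
  moreover have "B / 2 > 0" using B by simp
  ultimately show ?thesis by (simp only: Ai_contour_shift)
qed

text \<open>In terms of \<open>X\<close> the exponential grows like
  \<open>exp (B * X\<^sup>2)\<close>, while the power decays exponentially in
  \<open>X ^ 3\<close>.\<close>

lemma chord_remainder:
  fixes B \<beta> :: real
  assumes "B > 0"
  shows "(\<lambda>x::nat. root 3 (real x) * (4 * exp (B / root 3 (real x) * (real x + root 3 (real x) * \<beta>)) * (3 / 4) ^ (2 * x))) \<longlonglongrightarrow> 0"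
proof -
  let ?f = "\<lambda>X::real. X * (4 * exp (B * X\<^sup>2 + B * \<beta>) * exp (ln (3 / 4) * (2 * X ^ 3)))"
  have "((\<lambda>X::real. X * (4 * exp (B * X\<^sup>2 + B * \<beta>) * exp (- c * (2 * X ^ 3)))) \<longlongrightarrow> 0) at_top"
    if "c > 0" for c :: real using that assms by real_asymp
  from this[of "- ln (3 / 4)"] have "(?f \<longlongrightarrow> 0) at_top" by simp
  then have "(\<lambda>x::nat. ?f (root 3 (real x))) \<longlonglongrightarrow> 0"
    by (rule filterlim_compose[OF _ filterlim_root3])
  moreover have "\<forall>\<^sub>F x::nat in sequentially. ?f (root 3 (real x)) =
      root 3 (real x) * (4 * exp (B / root 3 (real x) * (real x + root 3 (real x) * \<beta>)) * (3 / 4) ^ (2 * x))"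
    using eventually_gt_at_top[of 0]
  proof eventually_elim
    case (elim x)
    define X where "X = root 3 (real x)"
    have X: "X > 0" "X ^ 3 = real x" using elim by (simp_all add: X_def odd_real_root_pow)
    have "B * X\<^sup>2 + B * \<beta> = B / X * (real x + X * \<beta>)"
      unfolding X(2)[symmetric] using X(1) by (simp add: field_simps power2_eq_square power3_eq_cube)
    moreover have "exp (ln (3 / 4) * (2 * X ^ 3)) = (3 / 4 :: real) ^ (2 * x)"
    proof -
      have "exp (ln (3 / 4) * (2 * X ^ 3)) = exp (real (2 * x) * ln (3 / 4))" by (simp add: X(2) mult_ac)
      also have "\<dots> = (3 / 4) ^ (2 * x)" unfolding exp_of_nat_mult by simp
      finally show ?thesis .
    qed
    ultimately show ?case unfolding X_def[symmetric] by simp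
  qed
  ultimately show ?thesis by (rule Lim_transform_eventually)
qed

lemma scaled_gaussian_integrable:
  fixes c :: real
  assumes "c > 0"
  shows "integrable lborel (\<lambda>\<rho>. K * ((1 + \<bar>\<rho>\<bar>) * exp (- c * \<rho>\<^sup>2)))"
proof -
  have "integrable lborel (\<lambda>\<rho>. \<bar>\<rho>\<bar> ^ 0 * exp (- c * \<rho>\<^sup>2) + \<bar>\<rho>\<bar> ^ 1 * exp (- c * \<rho>\<^sup>2))"
    by (intro Bochner_Integration.integrable_add gaussian_moment_integrable assms)
  then show ?thesis by (intro integrable_mult_right) (simp add: distrib_right)
qed

text \<open>Dominated convergence on the line with \<open>B = 1\<close>: without disorder to absorb,
  no larger \<open>B\<close> is called for, and by \<open>Ai_contour_shift\<close> the limit is the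
  same on every line. Zero masses are treated as a slab of length 0.\<close>

lemma free_field_asymptotics:
  "(\<lambda>x::nat. root 3 (real x) * lattice_field (\<lambda>_. 0) (int x) (real x + root 3 (real x) * \<beta>)) \<longlonglongrightarrow> Ai (- 2 * \<beta>)"
proof -
  define X where "X x = root 3 (real x)" for x :: nat
  have X3: "X x ^ 3 = real x" for x by (simp add: X_def odd_real_root_pow)
  have Xinf: "filterlim X at_top sequentially" unfolding X_def by (rule filterlim_root3)
  define \<Lambda> where "\<Lambda> x = sqrt (16 - (1 / X x)\<^sup>2)" for x
  define G where "G x \<rho> = free_integrand x (real x + X x * \<beta>) (Complex (1 / X x) (\<rho> / X x))" for x \<rho>
  define h where "h \<rho> = exp (\<beta> * Complex 1 \<rho> + Complex 1 \<rho> ^ 3 / 24) / 2" for \<rho>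
  define f where "f x \<rho> = (if 2 \<le> X x then indicator {- (X x * \<Lambda> x)..X x * \<Lambda> x} \<rho> *\<^sub>R G x \<rho> else 0)" for x \<rho>
  have Lam: "\<Lambda> x \<le> 4" for x
  proof -
    have "\<Lambda> x \<le> sqrt (4\<^sup>2)" unfolding \<Lambda>_def by (intro real_sqrt_le_mono) simp
    then show ?thesis by simp
  qed
  have Lam3: "3 \<le> \<Lambda> x" if "2 \<le> X x" for x
  proof -
    have "(1 / X x)\<^sup>2 \<le> 1\<^sup>2" using that by (intro power_mono) auto
    then have "sqrt (3\<^sup>2) \<le> \<Lambda> x" unfolding \<Lambda>_def by (intro real_sqrt_le_mono) simp
    then show ?thesis by simp
  qed
  have good: "\<forall>\<^sub>F x in sequentially. 2 \<le> X x" using Xinf by (auto simp: filterlim_at_top)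
  have free_hol: "free_integrand x t holomorphic_on {s. Re s > 0}" for x t
    using slab_integrand_holomorphic[of "\<lambda>_. 0" 0 x t] by (simp add: slab_integrand_def[abs_def])
  have G_cont: "continuous_on UNIV (\<lambda>r. free_integrand x t (Complex (1 / X x) r))" if "2 \<le> X x" for x t
    using that by (intro continuous_on_chord free_hol) auto
  have lim: "(\<lambda>x. LINT \<rho>|lborel. f x \<rho>) \<longlonglongrightarrow> (LINT \<rho>|lborel. h \<rho>)"
  proof (rule integral_dominated_convergence)
    show "integrable lborel (\<lambda>\<rho>. exp (1 * \<beta> + 1 ^ 3) * ((1 + \<bar>\<rho>\<bar>) * exp (- (1 / 20) * \<rho>\<^sup>2)))"
      by (rule scaled_gaussian_integrable) simp
    show "f x \<in> borel_measurable lborel" for x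
    proof (cases "2 \<le> X x")
      case True
      have "(\<lambda>\<rho>. G x \<rho>) \<in> borel_measurable borel"
        unfolding G_def using True
        by (intro borel_measurable_continuous_onI continuous_on_compose2[OF G_cont[OF True]] continuous_intros) auto
      then show ?thesis using True unfolding f_def by simp
    next
      case False
      then have "f x = (\<lambda>_. 0)" by (auto simp: f_def fun_eq_iff)
      then show ?thesis by simp
    qed
    show "h \<in> borel_measurable lborel" unfolding h_def complex_eq
      by (simp, intro borel_measurable_continuous_onI continuous_intros) auto
    show "AE \<rho> in lborel. norm (f x \<rho>) \<le> exp (1 * \<beta> + 1 ^ 3) * ((1 + \<bar>\<rho>\<bar>) * exp (- (1 / 20) * \<rho>\<^sup>2))" for x
    proof (rule AE_I2)
      fix \<rho>
      show "norm (f x \<rho>) \<le> exp (1 * \<beta> + 1 ^ 3) * ((1 + \<bar>\<rho>\<bar>) * exp (- (1 / 20) * \<rho>\<^sup>2))"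
      proof (cases "2 \<le> X x \<and> \<rho> \<in> {- (X x * \<Lambda> x)..X x * \<Lambda> x}")
        case True
        have "X x * \<Lambda> x \<le> X x * 4" using True Lam by (intro mult_left_mono) auto
        then have "\<bar>\<rho>\<bar> \<le> 4 * X x" using True unfolding atLeastAtMost_iff abs_le_iff by linarith
        then show ?thesis
          using scaled_free_integrand_bound[of "X x" x 1 \<rho> \<beta>] X3 True by (simp add: f_def G_def)
      next
        case False
        then have "f x \<rho> = 0" by (auto simp: f_def)
        then show ?thesis by simp
      qed
    qed
    show "AE \<rho> in lborel. (\<lambda>x. f x \<rho>) \<longlonglongrightarrow> h \<rho>"
    proof (rule AE_I2)
      fix \<rho>
      have "(\<lambda>x. G x \<rho>) \<longlonglongrightarrow> h \<rho>"
        unfolding G_def h_def X_def by (rule scaled_free_integrand_limit) auto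
      moreover have "\<forall>\<^sub>F x in sequentially. \<bar>\<rho>\<bar> \<le> X x" using Xinf by (auto simp: filterlim_at_top)
      with good have "\<forall>\<^sub>F x in sequentially. G x \<rho> = f x \<rho>"
      proof eventually_elim
        case (elim x)
        have "X x \<le> X x * \<Lambda> x" using mult_left_mono[of 1 "\<Lambda> x" "X x"] elim Lam3[of x] by simp
        then have "\<rho> \<in> {- (X x * \<Lambda> x)..X x * \<Lambda> x}"
          using elim(2) unfolding atLeastAtMost_iff by linarith
        then show ?case using elim by (simp add: f_def)
      qed
      ultimately show "(\<lambda>x. f x \<rho>) \<longlonglongrightarrow> h \<rho>" by (rule Lim_transform_eventually)
    qed
  qed
  let ?u = "\<lambda>x. X x * lattice_field (\<lambda>_. 0) (int x) (real x + X x * \<beta>)"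
  have "(\<lambda>x. of_real (?u x) - 1 / (2 * pi) * (LINT \<rho>|lborel. f x \<rho>)) \<longlonglongrightarrow> 0"
  proof (rule Lim_null_comparison)
    show "(\<lambda>x. X x * (4 * exp (1 / X x * (real x + X x * \<beta>)) * (3 / 4) ^ (2 * x))) \<longlonglongrightarrow> 0"
      unfolding X_def by (rule chord_remainder) simp
    \<comment> \<open>This makes \<open>X * X + \<beta>\<close> nonnegative, hence also the time
      \<open>t\<close>.\<close>
    have "\<forall>\<^sub>F x in sequentially. 2 + \<bar>\<beta>\<bar> \<le> X x" using Xinf by (auto simp: filterlim_at_top)
    then show "\<forall>\<^sub>F x in sequentially. norm (of_real (?u x) - 1 / (2 * pi) * (LINT \<rho>|lborel. f x \<rho>))
        \<le> X x * (4 * exp (1 / X x * (real x + X x * \<beta>)) * (3 / 4) ^ (2 * x))"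
    proof eventually_elim
      case (elim x)
      then have X2: "2 \<le> X x" by simp
      have "0 \<le> X x * (X x * X x + \<beta>)"
      proof (rule mult_nonneg_nonneg)
        have "1 * X x \<le> X x * X x" using X2 by (intro mult_right_mono) auto
        then show "0 \<le> X x * X x + \<beta>" using elim X2 by linarith
      qed (use X2 in simp)
      then have t: "0 \<le> real x + X x * \<beta>"
        unfolding X3[of x, symmetric] by (simp add: power3_eq_cube distrib_left)
      let ?a = "1 / X x"
      let ?F = "\<lambda>r. free_integrand x (real x + X x * \<beta>) (Complex ?a r)"
      have "of_real (X x) * integral {- \<Lambda> x..\<Lambda> x} ?F = (LINT \<rho>|lborel. f x \<rho>)"
      proof -
        have "f x = (\<lambda>\<rho>. indicator {- (X x * \<Lambda> x)..X x * \<Lambda> x} \<rho> *\<^sub>R ?F (\<rho> / X x))"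
          using X2 by (auto simp: f_def G_def fun_eq_iff)
        then show ?thesis
          using X2 by (subst scaled_chord_integral) (auto intro!: continuous_on_subset[OF G_cont])
      qed
      then have "of_real (?u x) - 1 / (2 * pi) * (LINT \<rho>|lborel. f x \<rho>)
         = of_real (X x) * (of_real (lattice_field (\<lambda>_. 0) (int x) (real x + X x * \<beta>)) - 1 / (2 * pi) * integral {- \<Lambda> x..\<Lambda> x} ?F)"
        by (simp add: algebra_simps)
      also have "norm \<dots> = X x * norm (of_real (lattice_field (\<lambda>_. 0) (int x) (real x + X x * \<beta>)) - 1 / (2 * pi) * integral {- \<Lambda> x..\<Lambda> x} ?F)"
        using X2 by (simp add: norm_mult)
      also have "\<dots> \<le> X x * (4 * exp (?a * (real x + X x * \<beta>)) * (3 / 4) ^ (2 * x))"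
      proof (intro mult_left_mono)
        show "norm (of_real (lattice_field (\<lambda>_. 0) (int x) (real x + X x * \<beta>)) - 1 / (2 * pi) * integral {- \<Lambda> x..\<Lambda> x} ?F)
            \<le> 4 * exp (?a * (real x + X x * \<beta>)) * (3 / 4) ^ (2 * x)"
          using lattice_field_chord[of "\<lambda>_. 0" 0 x ?a "real x + X x * \<beta>"] X2 t
          by (simp add: slab_integrand_def \<Lambda>_def divide_less_eq)
      qed (use X2 in simp)
      finally show ?case .
    qed
  qed
  from tendsto_add[OF this tendsto_mult_left[OF lim, of "1 / (2 * pi)"]]
  have "(\<lambda>x. complex_of_real (?u x)) \<longlonglongrightarrow> of_real (Ai (- 2 * \<beta>))"
    unfolding h_def by (subst (asm) Ai_as_limit_integral) auto
  then have "?u \<longlonglongrightarrow> Ai (- 2 * \<beta>)" by (simp only: tendsto_of_real_iff)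
  then show ?thesis by (simp add: X_def)
qed

section \<open>Mean field\<close>

context random_mass
begin

text \<open>The growth of the second moment is absorbed by half of the Gaussian decay of the free
  integrand once \<open>B\<close> is large; this covers the frequencies near and above the upper band edge,
  where only \<open>Re (decay_root s) \<ge> B / X\<close> is available.\<close>

lemma sqrt_second_moment_bound:
  assumes B: "B \<ge> 1" "400 * C \<le> B ^ 3" "2 * B \<le> X" and C: "C \<ge> 0" "v * real l \<le> C"
    and s: "s = Complex (B / X) (\<rho> / X)" and \<rho>: "\<bar>\<rho>\<bar> \<le> 4 * X"
    and \<kappa>: "\<kappa> = (norm s / (Re (decay_root s) / 2))\<^sup>2"
  shows "sqrt (3 / 5 * ((1 + 5 * \<kappa> * v) ^ l - 1))
    \<le> (sqrt (80 * C * exp (100 * C)) * B + exp (10 * C)) / X * ((1 + \<bar>\<rho>\<bar>) * exp (B / 40 * \<rho>\<^sup>2))"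
proof -
  have X: "X > 0" using B by linarith
  have Re_s: "Re s > 0" using B X by (simp add: s)
  have \<kappa>0: "\<kappa> \<ge> 0" by (simp add: \<kappa>)
  have b: "Re (decay_root s) > 0" by (rule Re_decay_root_pos[OF Re_s])
  have \<kappa>_eq: "\<kappa> = 4 * (norm s)\<^sup>2 / (Re (decay_root s))\<^sup>2" by (simp add: \<kappa> power_divide)
  have ns: "(norm s)\<^sup>2 = (B\<^sup>2 + \<rho>\<^sup>2) / X\<^sup>2" by (simp add: s cmod_power2 power_divide add_divide_distrib)
  have "(1 + 5 * \<kappa> * v) ^ l \<le> exp (5 * \<kappa> * v) ^ l"
    using \<kappa>0 v_nonneg by (intro power_mono) (auto simp: exp_ge_add_one_self)
  also have "\<dots> = exp (5 * \<kappa> * (v * real l))" by (simp add: mult_ac flip: exp_of_nat_mult)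
  also have "\<dots> \<le> exp (5 * \<kappa> * C)" using \<kappa>0 C by (simp add: mult_left_mono)
  finally have pw: "(1 + 5 * \<kappa> * v) ^ l \<le> exp (5 * \<kappa> * C)" .
  have one: "1 \<le> (1 + 5 * \<kappa> * v) ^ l" using \<kappa>0 v_nonneg by (intro one_le_power) auto
  have "3 / 5 * (p - 1) \<le> q - 1" if "p \<le> q" "1 \<le> p" for p q :: real
    using that by simp
  then have pw1: "3 / 5 * ((1 + 5 * \<kappa> * v) ^ l - 1) \<le> exp (5 * \<kappa> * C) - 1" using pw one by blast
  have e1: "1 \<le> exp (B / 40 * \<rho>\<^sup>2)" using B by simp
  define R where "R = (1 + \<bar>\<rho>\<bar>) * exp (B / 40 * \<rho>\<^sup>2) / X"
  have R: "0 \<le> R" using X by (simp add: R_def)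
  have "sqrt (3 / 5 * ((1 + 5 * \<kappa> * v) ^ l - 1)) \<le> sqrt (80 * C * exp (100 * C)) * B * R + exp (10 * C) * R"
  proof (cases "\<bar>\<rho>\<bar> \<le> X")
    case True
    \<comment> \<open>Away from the band edge \<open>\<kappa>\<close> is at most a multiple of
      \<open>(norm s)\<^sup>2\<close>, so the root of the second moment is of the order of
      \<open>norm s\<close> and supplies the factor \<open>1 / X\<close>.\<close>
    have "1 / 2 \<le> Re (decay_root s)"
      using True X by (intro low_frequency_bounds[OF Re_s]) (simp add: s abs_divide)
    then have "(1 / 2)\<^sup>2 \<le> (Re (decay_root s))\<^sup>2" by (intro power_mono) auto
    then have "4 * (norm s)\<^sup>2 / (Re (decay_root s))\<^sup>2 \<le> 4 * (norm s)\<^sup>2 / (1 / 2)\<^sup>2"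
      by (intro divide_left_mono mult_pos_pos) (use b in auto)
    then have \<kappa>1: "\<kappa> \<le> 16 * (norm s)\<^sup>2" by (simp add: \<kappa>_eq power2_eq_square)
    have "B\<^sup>2 \<le> (X / 2)\<^sup>2" "\<rho>\<^sup>2 \<le> X\<^sup>2"
      using B True by (auto intro!: power_mono simp: abs_le_square_iff[symmetric])
    then have "(norm s)\<^sup>2 \<le> 5 / 4" using X by (simp add: ns power_divide divide_le_eq)
    then have \<kappa>2: "\<kappa> \<le> 20" using \<kappa>1 by simp
    have "exp (5 * \<kappa> * C) - 1 \<le> (5 * \<kappa> * C) * exp (5 * \<kappa> * C)"
    proof -
      have "1 - 5 * \<kappa> * C \<le> exp (- (5 * \<kappa> * C))" using exp_ge_add_one_self[of "- (5 * \<kappa> * C)"] by simp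
      then have "(1 - 5 * \<kappa> * C) * exp (5 * \<kappa> * C) \<le> exp (- (5 * \<kappa> * C)) * exp (5 * \<kappa> * C)" by (rule mult_right_mono) simp
      moreover have "exp (- z) * exp z = 1" for z :: real by (simp flip: exp_add)
      ultimately show ?thesis by (simp add: left_diff_distrib)
    qed
    also have "\<dots> \<le> (5 * (16 * (norm s)\<^sup>2) * C) * exp (100 * C)"
    proof (rule mult_mono)
      show "5 * \<kappa> * C \<le> 5 * (16 * (norm s)\<^sup>2) * C" using \<kappa>1 C by (intro mult_right_mono mult_left_mono) auto
      have "5 * \<kappa> * C \<le> 5 * 20 * C" using \<kappa>2 C by (intro mult_right_mono mult_left_mono) auto
      then show "exp (5 * \<kappa> * C) \<le> exp (100 * C)" by simp
    qed (use C in auto)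
    also have "\<dots> = 80 * C * exp (100 * C) * (norm s)\<^sup>2" by simp
    finally have "3 / 5 * ((1 + 5 * \<kappa> * v) ^ l - 1) \<le> 80 * C * exp (100 * C) * (norm s)\<^sup>2"
      by (rule order_trans[OF pw1])
    then have "sqrt (3 / 5 * ((1 + 5 * \<kappa> * v) ^ l - 1)) \<le> sqrt (80 * C * exp (100 * C) * (norm s)\<^sup>2)"
      by (rule real_sqrt_le_mono)
    also have "\<dots> = sqrt (80 * C * exp (100 * C)) * norm s" unfolding real_sqrt_mult by simp
    also have "\<dots> \<le> sqrt (80 * C * exp (100 * C)) * (B * R)"
    proof (intro mult_left_mono)
      have "norm s \<le> \<bar>B / X\<bar> + \<bar>\<rho> / X\<bar>" unfolding s by (rule order_trans[OF cmod_le]) simp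
      also have "\<dots> = (B + \<bar>\<rho>\<bar>) / X" using B X by (simp add: abs_divide add_divide_distrib)
      also have "\<dots> \<le> (B * ((1 + \<bar>\<rho>\<bar>) * exp (B / 40 * \<rho>\<^sup>2))) / X"
      proof (intro divide_right_mono)
        have "B + \<bar>\<rho>\<bar> \<le> B * (1 + \<bar>\<rho>\<bar>)" using mult_right_mono[of 1 B "\<bar>\<rho>\<bar>"] B by (simp add: distrib_left)
        also have "\<dots> = B * ((1 + \<bar>\<rho>\<bar>) * 1)" by simp
        also have "\<dots> \<le> B * ((1 + \<bar>\<rho>\<bar>) * exp (B / 40 * \<rho>\<^sup>2))" using B e1 by (intro mult_left_mono) auto
        finally show "B + \<bar>\<rho>\<bar> \<le> B * ((1 + \<bar>\<rho>\<bar>) * exp (B / 40 * \<rho>\<^sup>2))" .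
      qed (use X in simp)
      finally show "norm s \<le> B * R" by (simp add: R_def)
    qed (use C in simp)
    finally show ?thesis using R by (simp add: mult.assoc) (smt (verit) exp_gt_zero mult_nonneg_nonneg)
  next
    case False
    have "B / X \<le> Re (decay_root s)" using Re_le_Re_decay_root[OF Re_s] by (simp add: s)
    then have "(B / X)\<^sup>2 \<le> (Re (decay_root s))\<^sup>2" using B X by (intro power_mono) auto
    then have "\<kappa> \<le> 4 * (norm s)\<^sup>2 / (B / X)\<^sup>2"
      unfolding \<kappa>_eq using B X b by (intro divide_left_mono mult_pos_pos) auto
    also have "\<dots> = 4 + 4 * \<rho>\<^sup>2 / B\<^sup>2" using B X by (simp add: ns power_divide field_simps)
    finally have \<kappa>1: "\<kappa> \<le> 4 + 4 * \<rho>\<^sup>2 / B\<^sup>2" .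
    \<comment> \<open>This fixes the size of \<open>B\<close>: the second moment then grows at rate
      \<open>B / 20\<close> in \<open>\<rho>\<^sup>2\<close> and its root at rate
      \<open>B / 40\<close>, half of the decay in
      \<open>scaled_free_integrand_bound\<close>.\<close>
    have "20 * C / B\<^sup>2 \<le> B / 20"
      using B by (simp add: divide_le_eq power2_eq_square power3_eq_cube)
    then have "20 * C / B\<^sup>2 * \<rho>\<^sup>2 \<le> B / 20 * \<rho>\<^sup>2" by (intro mult_right_mono) auto
    moreover have "5 * \<kappa> * C \<le> 5 * (4 + 4 * \<rho>\<^sup>2 / B\<^sup>2) * C" using \<kappa>1 C by (intro mult_right_mono mult_left_mono) auto
    moreover have "5 * (4 + 4 * \<rho>\<^sup>2 / B\<^sup>2) * C = 20 * C + 20 * C / B\<^sup>2 * \<rho>\<^sup>2" by (simp add: algebra_simps)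
    ultimately have "exp (5 * \<kappa> * C) \<le> exp (2 * (10 * C + B / 40 * \<rho>\<^sup>2))" by simp
    also have "\<dots> = (exp (10 * C + B / 40 * \<rho>\<^sup>2))\<^sup>2" by (rule exp_double)
    finally have "3 / 5 * ((1 + 5 * \<kappa> * v) ^ l - 1) \<le> (exp (10 * C + B / 40 * \<rho>\<^sup>2))\<^sup>2"
      using pw1 by argo
    then have "sqrt (3 / 5 * ((1 + 5 * \<kappa> * v) ^ l - 1)) \<le> sqrt ((exp (10 * C + B / 40 * \<rho>\<^sup>2))\<^sup>2)"
      by (rule real_sqrt_le_mono)
    also have "\<dots> = exp (10 * C) * (1 * exp (B / 40 * \<rho>\<^sup>2))" by (simp add: exp_add)
    \<comment> \<open>In this range \<open>\<bar>\<rho>\<bar>\<close> exceeds \<open>X\<close>, so a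
      factor \<open>1 / X\<close> can be gained for the price of
      \<open>1 + \<bar>\<rho>\<bar>\<close>, which the Gaussian absorbs.\<close>
    also have "\<dots> \<le> exp (10 * C) * ((1 + \<bar>\<rho>\<bar>) / X * exp (B / 40 * \<rho>\<^sup>2))"
      using False X by (intro mult_left_mono mult_right_mono) (auto simp: le_divide_eq)
    also have "\<dots> = exp (10 * C) * R" by (simp add: R_def)
    finally show ?thesis using R B C by (smt (verit) mult_nonneg_nonneg real_sqrt_ge_zero exp_ge_zero)
  qed
  also have "\<dots> = (sqrt (80 * C * exp (100 * C)) * B + exp (10 * C)) / X * ((1 + \<bar>\<rho>\<bar>) * exp (B / 40 * \<rho>\<^sup>2))"
  proof -
    have "p * (q / X) + e * (q / X) = (p + e) / X * q" for p q e :: real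
      by (simp add: add_divide_distrib distrib_right)
    then show ?thesis by (simp only: R_def)
  qed
  finally show ?thesis .
qed

end

text \<open>Cauchy-Schwarz in the form \<open>f \<le> r / 2 + f\<^sup>2 / (2 * r)\<close>,
  integrated term by term.\<close>

lemma (in prob_space) nn_integral_le_sqrt:
  assumes [measurable]: "f \<in> borel_measurable M" and nonneg: "\<And>x. 0 \<le> f x"
    and second: "(\<integral>\<^sup>+x. ennreal ((f x)\<^sup>2) \<partial>M) \<le> ennreal c" and r: "sqrt c \<le> r" "0 \<le> c" "0 < r"
  shows "(\<integral>\<^sup>+x. ennreal (f x) \<partial>M) \<le> ennreal r"
proof -
  have "c \<le> r\<^sup>2" using r by (metis real_sqrt_le_iff real_sqrt_pow2_iff power_mono real_sqrt_ge_zero)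
  have "(\<integral>\<^sup>+x. ennreal (f x) \<partial>M) \<le> (\<integral>\<^sup>+x. ennreal (r / 2) + ennreal (1 / (2 * r)) * ennreal ((f x)\<^sup>2) \<partial>M)"
  proof (rule nn_integral_mono)
    fix x
    have "0 \<le> (f x - r)\<^sup>2" by simp
    then have "2 * r * f x \<le> r\<^sup>2 + (f x)\<^sup>2" by (simp add: power2_diff mult_ac)
    then have "f x \<le> r / 2 + 1 / (2 * r) * (f x)\<^sup>2" using r by (simp add: field_simps power2_eq_square)
    then have "ennreal (f x) \<le> ennreal (r / 2 + 1 / (2 * r) * (f x)\<^sup>2)" by (rule ennreal_leI)
    also have "\<dots> = ennreal (r / 2) + ennreal (1 / (2 * r)) * ennreal ((f x)\<^sup>2)"
      using r by (simp flip: ennreal_mult ennreal_plus)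
    finally show "ennreal (f x) \<le> ennreal (r / 2) + ennreal (1 / (2 * r)) * ennreal ((f x)\<^sup>2)" .
  qed
  also have "\<dots> = ennreal (r / 2) + ennreal (1 / (2 * r)) * (\<integral>\<^sup>+x. ennreal ((f x)\<^sup>2) \<partial>M)"
    by (simp add: nn_integral_add nn_integral_cmult emeasure_space_1)
  also have "\<dots> \<le> ennreal (r / 2) + ennreal (1 / (2 * r)) * ennreal (r\<^sup>2)"
    using second \<open>c \<le> r\<^sup>2\<close> by (intro add_left_mono mult_left_mono) (auto intro: order_trans ennreal_leI)
  also have "\<dots> = ennreal (r / 2 + 1 / (2 * r) * r\<^sup>2)"
    using r by (simp flip: ennreal_mult ennreal_plus)
  also have "r / 2 + 1 / (2 * r) * r\<^sup>2 = r" using r by (simp add: power2_eq_square)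
  finally show ?thesis .
qed

text \<open>The bound of the homogeneous integrand times that of the root second moment, with
  \<open>1 / X\<close> taken out. Each contributes one factor \<open>1 + \<bar>\<rho>\<bar>\<close>,
  and \<open>B / 40\<close> is the rate \<open>B / 20\<close> less the \<open>B / 40\<close> spent
  on the disorder.\<close>

definition error_const :: "real \<Rightarrow> real \<Rightarrow> real \<Rightarrow> real" where
  "error_const B C \<beta> = exp (B * \<beta> + B ^ 3) * (sqrt (80 * C * exp (100 * C)) * B + exp (10 * C))
     * (LINT \<rho>|lborel. (1 + \<bar>\<rho>\<bar>)\<^sup>2 * exp (- (B / 40) * \<rho>\<^sup>2))"

lemma squared_gaussian_integrable:
  fixes c :: real
  assumes "c > 0"
  shows "integrable lborel (\<lambda>\<rho>. (1 + \<bar>\<rho>\<bar>)\<^sup>2 * exp (- c * \<rho>\<^sup>2))"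
proof -
  have "integrable lborel (\<lambda>\<rho>. \<bar>\<rho>\<bar> ^ 0 * exp (- c * \<rho>\<^sup>2) + 2 * (\<bar>\<rho>\<bar> ^ 1 * exp (- c * \<rho>\<^sup>2)) + \<bar>\<rho>\<bar> ^ 2 * exp (- c * \<rho>\<^sup>2))"
    by (intro Bochner_Integration.integrable_add integrable_mult_right gaussian_moment_integrable assms)
  then show ?thesis by (simp add: power2_sum algebra_simps)
qed

text \<open>Both fields are chord integrals with the same homogeneous factor, so along each sample
  their difference is the integral of \<open>G\<close> times the deviation of the transmission
  factor from 1, up to two chord remainders. After Fubini the expectation acts on that deviation
  alone. Bounding the mean of the modulus also yields integrability.\<close>

lemma (in random_mass) mean_field_error:
  fixes l x :: nat and P :: "'w measure" and \<nu> :: "int \<Rightarrow> 'w \<Rightarrow> real"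
  assumes P: "prob_space P" and indep: "prob_space.indep_vars P (\<lambda>_. borel) \<nu> {1..int l}"
    and law: "\<And>k. k \<in> {1..int l} \<Longrightarrow> distr P borel (\<nu> k) = N" and l: "l \<ge> 1" "l \<le> x"
    and X: "X ^ 3 = real x" and B: "B \<ge> 1" "400 * C \<le> B ^ 3" "2 * B \<le> X"
    and C: "C \<ge> 0" "v * real l \<le> C" and t: "t = real x + X * \<beta>" "0 \<le> t"
  shows "(\<integral>\<^sup>+\<omega>. ennreal \<bar>X * (lattice_field (masses l (\<lambda>y. \<nu> y \<omega>)) (int x) t - lattice_field (\<lambda>_. 0) (int x) t)\<bar> \<partial>P)
    \<le> ennreal (error_const B C \<beta> / X + 2 * (X * (4 * exp (B / X * t) * (3 / 4) ^ (2 * x))))"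
proof -
  interpret P: prob_space P by (rule P)
  interpret PL: pair_sigma_finite P lborel ..
  let ?m = "\<lambda>\<omega>. masses l (\<lambda>y. \<nu> y \<omega>)"
  have Xpos: "X > 0" using B by linarith
  define a where "a = B / X"
  have a: "0 < a" "a < 4" using B Xpos by (auto simp: a_def divide_less_eq)
  define \<Lambda> where "\<Lambda> = sqrt (16 - a\<^sup>2)"
  have Lam: "\<Lambda> \<le> 4"
  proof -
    have "\<Lambda> \<le> sqrt (4\<^sup>2)" unfolding \<Lambda>_def by (intro real_sqrt_le_mono) simp
    then show ?thesis by simp
  qed
  define sc where "sc \<rho> = Complex a (\<rho> / X)" for \<rho>
  define I where "I = {- (X * \<Lambda>)..X * \<Lambda>}"
  define G where "G \<rho> = indicator I \<rho> *\<^sub>R free_integrand x t (sc \<rho>)" for \<rho>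
  \<comment> \<open>The deviation from 1, not the transmission factor itself as in the earlier
    lemmas.\<close>
  define T where "T \<omega> \<rho> = slab_trans (?m \<omega>) l (sc \<rho>) l - 1" for \<omega> \<rho>
  let ?rem = "X * (4 * exp (a * t) * (3 / 4) ^ (2 * x))"
  have rv [measurable]: "\<nu> k \<in> borel_measurable P" if "k \<in> {1..int l}" for k
    using indep that unfolding P.indep_vars_def by auto
  have m_meas: "(\<lambda>p. ?m (f p) y) \<in> borel_measurable M'" if [measurable]: "f \<in> measurable M' P" for M' f y
  proof (cases "y \<in> {1..int l}")
    case True
    then show ?thesis unfolding masses_def by simp
  next
    case False
    then have "(\<lambda>p. ?m (f p) y) = (\<lambda>_. 0)" by (auto simp: masses_def)
    then show ?thesis by simp
  qed
  have sc_cont: "continuous_on UNIV (\<lambda>\<rho>. f (sc \<rho>))" if "f holomorphic_on {s. Re s > 0}" for f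
    unfolding sc_def by (rule continuous_on_compose2[OF continuous_on_chord[OF that a(1), of UNIV]])
      (use Xpos in \<open>auto intro!: continuous_intros\<close>)
  have sc_meas [measurable]: "(\<lambda>\<rho>. f (sc \<rho>)) \<in> borel_measurable borel" if "f holomorphic_on {s. Re s > 0}" for f
    by (rule borel_measurable_continuous_onI[OF sc_cont[OF that]])
  have free_hol: "free_integrand x t holomorphic_on {s. Re s > 0}"
    using slab_integrand_holomorphic[of "\<lambda>_. 0" 0 x t] by (simp add: slab_integrand_def[abs_def])
  have [measurable]: "G \<in> borel_measurable borel"
    unfolding G_def I_def using sc_meas[OF free_hol] by measurable
  have T_meas [measurable]: "(\<lambda>p. T (fst p) (snd p)) \<in> borel_measurable (P \<Otimes>\<^sub>M lborel)"
  proof -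
    have "(\<lambda>p. slab_trans (?m (fst p)) l (sc (snd p)) l) \<in> borel_measurable (P \<Otimes>\<^sub>M lborel)"
    proof (rule borel_measurable_slab)
      show "(\<lambda>p. sc (snd p)) \<in> borel_measurable (P \<Otimes>\<^sub>M lborel)"
        using sc_meas[of "\<lambda>s. s"] by (auto intro!: measurable_compose[OF measurable_snd] holomorphic_intros)
      show "(\<lambda>p. decay_root (sc (snd p))) \<in> borel_measurable (P \<Otimes>\<^sub>M lborel)"
        using sc_meas[OF decay_root_holomorphic] by (auto intro!: measurable_compose[OF measurable_snd])
    qed (rule m_meas, simp)
    then show ?thesis unfolding T_def by simp
  qed
  have T_meas': "(\<lambda>\<omega>. T \<omega> \<rho>) \<in> borel_measurable P" for \<rho>
  proof -
    have "(\<lambda>\<omega>. slab_trans (?m \<omega>) l (sc \<rho>) l) \<in> borel_measurable P"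
      using m_meas[of "\<lambda>\<omega>. \<omega>" P] by (intro borel_measurable_slab) auto
    then show ?thesis unfolding T_def by simp
  qed
  have m_ge: "?m \<omega> y \<ge> - 1 / 2" for \<omega> y by (rule masses_ge)
  have pointwise: "ennreal \<bar>X * (lattice_field (?m \<omega>) (int x) t - lattice_field (\<lambda>_. 0) (int x) t)\<bar>
      \<le> (\<integral>\<^sup>+\<rho>. ennreal (norm (G \<rho> * T \<omega> \<rho>)) \<partial>lborel) + ennreal (2 * ?rem)" for \<omega>
  proof -
    let ?F = "slab_integrand (?m \<omega>) l x t" and ?Ffree = "slab_integrand (\<lambda>_. 0) 0 x t"
    let ?J = "\<lambda>F. integral {- \<Lambda>..\<Lambda>} (\<lambda>r. F (Complex a r))"
    let ?d = "lattice_field (?m \<omega>) (int x) t" and ?dfree = "lattice_field (\<lambda>_. 0) (int x) t"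
    have hol: "?F holomorphic_on {s. Re s > 0}" "?Ffree holomorphic_on {s. Re s > 0}"
      by (rule slab_integrand_holomorphic, rule m_ge) (rule slab_integrand_holomorphic, simp)
    have e1: "norm (of_real ?d - 1 / (2 * pi) * ?J ?F) \<le> 4 * exp (a * t) * (3 / 4) ^ (2 * x)"
      unfolding \<Lambda>_def using a t l by (intro lattice_field_chord m_ge) (auto simp: masses_def)
    have e2: "norm (of_real ?dfree - 1 / (2 * pi) * ?J ?Ffree) \<le> 4 * exp (a * t) * (3 / 4) ^ (2 * x)"
      unfolding \<Lambda>_def using a t by (intro lattice_field_chord) auto
    have cont: "continuous_on {- \<Lambda>..\<Lambda>} (\<lambda>r. ?F (Complex a r) - ?Ffree (Complex a r))"
      by (intro continuous_on_diff continuous_on_chord hol a)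
    have int: "?J ?F - ?J ?Ffree = integral {- \<Lambda>..\<Lambda>} (\<lambda>r. ?F (Complex a r) - ?Ffree (Complex a r))"
      by (intro Henstock_Kurzweil_Integration.integral_diff[symmetric] integrable_continuous_real continuous_on_chord hol a)
    have eq: "of_real X * (?J ?F - ?J ?Ffree) = (LINT \<rho>|lborel. G \<rho> * T \<omega> \<rho>)"
      unfolding int scaled_chord_integral[OF Xpos cont] G_def T_def I_def sc_def
      by (intro Bochner_Integration.integral_cong) (auto simp: slab_integrand_def algebra_simps)
    \<comment> \<open>If the product is not integrable, its Bochner integral is 0 by convention and
      the inequality is trivial.\<close>
    have norm_le: "ennreal (norm (LINT \<rho>|lborel. G \<rho> * T \<omega> \<rho>)) \<le> (\<integral>\<^sup>+\<rho>. ennreal (norm (G \<rho> * T \<omega> \<rho>)) \<partial>lborel)"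
      by (cases "integrable lborel (\<lambda>\<rho>. G \<rho> * T \<omega> \<rho>)")
         (auto intro: integral_norm_bound_ennreal simp: not_integrable_integral_eq)
    have "\<bar>X * (?d - ?dfree)\<bar> \<le> norm (of_real X * (?J ?F - ?J ?Ffree)) + 2 * ?rem"
    proof -
      let ?e = "of_real ?d - 1 / (2 * pi) * ?J ?F" and ?efree = "of_real ?dfree - 1 / (2 * pi) * ?J ?Ffree"
      have "complex_of_real (X * (?d - ?dfree)) = 1 / (2 * pi) * (of_real X * (?J ?F - ?J ?Ffree)) + of_real X * ?e - of_real X * ?efree"
        by (simp add: algebra_simps)
      then have "norm (complex_of_real (X * (?d - ?dfree))) \<le> norm (1 / (2 * pi) * (of_real X * (?J ?F - ?J ?Ffree))) + norm (of_real X * ?e) + norm (of_real X * ?efree)"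
        by (simp only:) (rule order_trans[OF norm_triangle_ineq4 add_right_mono[OF norm_triangle_ineq]])
      moreover have "norm (complex_of_real (X * (?d - ?dfree))) = \<bar>X * (?d - ?dfree)\<bar>" by (rule norm_of_real)
      moreover have "norm (1 / (2 * pi) * (of_real X * (?J ?F - ?J ?Ffree))) \<le> 1 * norm (of_real X * (?J ?F - ?J ?Ffree))"
      proof -
        have "norm (complex_of_real (1 / (2 * pi))) \<le> 1"
          unfolding norm_of_real using pi_gt3 by simp
        then show ?thesis by (subst norm_mult) (rule mult_right_mono, simp_all)
      qed
      moreover have "norm (of_real X * ?e) \<le> ?rem" unfolding norm_mult using e1 Xpos by (simp add: mult_left_mono)
      moreover have "norm (of_real X * ?efree) \<le> ?rem" unfolding norm_mult using e2 Xpos by (simp add: mult_left_mono)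
      ultimately show ?thesis by linarith
    qed
    then have "ennreal \<bar>X * (?d - ?dfree)\<bar> \<le> ennreal (norm (LINT \<rho>|lborel. G \<rho> * T \<omega> \<rho>) + 2 * ?rem)"
      unfolding eq by (rule ennreal_leI)
    also have "\<dots> = ennreal (norm (LINT \<rho>|lborel. G \<rho> * T \<omega> \<rho>)) + ennreal (2 * ?rem)"
      using Xpos by (intro ennreal_plus) auto
    also have "\<dots> \<le> (\<integral>\<^sup>+\<rho>. ennreal (norm (G \<rho> * T \<omega> \<rho>)) \<partial>lborel) + ennreal (2 * ?rem)"
      by (intro add_right_mono norm_le)
    finally show ?thesis .
  qed
  define K where "K = sqrt (80 * C * exp (100 * C)) * B + exp (10 * C)"
  define K0 where "K0 = exp (B * \<beta> + B ^ 3)"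
  have K: "K > 0" "K0 > 0" using B C by (auto simp: K_def K0_def intro!: add_nonneg_pos)
  have inner: "(\<integral>\<^sup>+\<omega>. ennreal (norm (G \<rho> * T \<omega> \<rho>)) \<partial>P)
      \<le> ennreal (K0 * K / X * ((1 + \<bar>\<rho>\<bar>)\<^sup>2 * exp (- (B / 40) * \<rho>\<^sup>2)))" for \<rho>
  proof (cases "\<rho> \<in> I")
    case False
    then show ?thesis by (simp add: G_def)
  next
    case True
    have "X * \<Lambda> \<le> X * 4" using Lam Xpos by (intro mult_left_mono) auto
    then have \<rho>: "\<bar>\<rho>\<bar> \<le> 4 * X" using True unfolding I_def atLeastAtMost_iff abs_le_iff by linarith
    have Re_sc: "Re (sc \<rho>) > 0" using a by (simp add: sc_def)
    define \<kappa> where "\<kappa> = (norm (sc \<rho>) / (Re (decay_root (sc \<rho>)) / 2))\<^sup>2"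
    have \<kappa>0: "\<kappa> \<ge> 0" by (simp add: \<kappa>_def)
    let ?r = "K / X * ((1 + \<bar>\<rho>\<bar>) * exp (B / 40 * \<rho>\<^sup>2))"
    have "(\<integral>\<^sup>+\<omega>. ennreal (norm (T \<omega> \<rho>)) \<partial>P) \<le> ennreal ?r"
    proof (rule P.nn_integral_le_sqrt)
      show "(\<integral>\<^sup>+\<omega>. ennreal ((norm (T \<omega> \<rho>))\<^sup>2) \<partial>P) \<le> ennreal (3 / 5 * ((1 + 5 * \<kappa> * v) ^ l - 1))"
        unfolding T_def by (rule independent_transmission_second_moment[OF P indep law l(1) Re_sc \<kappa>_def])
      show "sqrt (3 / 5 * ((1 + 5 * \<kappa> * v) ^ l - 1)) \<le> ?r"
        unfolding K_def by (rule sqrt_second_moment_bound[OF B C _ \<rho> \<kappa>_def]) (simp add: sc_def a_def)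
      show "0 \<le> 3 / 5 * ((1 + 5 * \<kappa> * v) ^ l - 1)" using \<kappa>0 v_nonneg by (simp add: one_le_power)
      have "0 < 1 + \<bar>\<rho>\<bar>" by simp
      then show "0 < ?r" using K Xpos by (intro mult_pos_pos divide_pos_pos) auto
    qed (use T_meas' in auto)
    then have "(\<integral>\<^sup>+\<omega>. ennreal (norm (G \<rho>)) * ennreal (norm (T \<omega> \<rho>)) \<partial>P) \<le> ennreal (norm (G \<rho>)) * ennreal ?r"
      using T_meas'[of \<rho>] by (simp add: nn_integral_cmult mult_left_mono)
    also have "\<dots> = ennreal (norm (G \<rho>) * ?r)" using K Xpos by (intro ennreal_mult[symmetric]) simp_all
    also have "\<dots> \<le> ennreal ((K0 * ((1 + \<bar>\<rho>\<bar>) * exp (- (B / 20) * \<rho>\<^sup>2))) * ?r)"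
    proof (intro ennreal_leI mult_right_mono)
      show "norm (G \<rho>) \<le> K0 * ((1 + \<bar>\<rho>\<bar>) * exp (- (B / 20) * \<rho>\<^sup>2))"
        using scaled_free_integrand_bound[OF Xpos X B(1) B(3) \<rho>, of \<beta>] True
        by (simp add: G_def sc_def a_def t K0_def)
    qed (use K Xpos in simp)
    also have "(K0 * ((1 + \<bar>\<rho>\<bar>) * exp (- (B / 20) * \<rho>\<^sup>2))) * ?r = K0 * K / X * ((1 + \<bar>\<rho>\<bar>)\<^sup>2 * exp (- (B / 40) * \<rho>\<^sup>2))"
    proof -
      have "exp (- (B / 20) * \<rho>\<^sup>2) * exp (B / 40 * \<rho>\<^sup>2) = exp (- (B / 40) * \<rho>\<^sup>2)" by (simp flip: exp_add)
      then show ?thesis by (simp add: power2_eq_square mult_ac)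
    qed
    finally show ?thesis by (simp add: norm_mult ennreal_mult)
  qed
  have "(\<integral>\<^sup>+\<omega>. ennreal \<bar>X * (lattice_field (?m \<omega>) (int x) t - lattice_field (\<lambda>_. 0) (int x) t)\<bar> \<partial>P)
      \<le> (\<integral>\<^sup>+\<omega>. (\<integral>\<^sup>+\<rho>. ennreal (norm (G \<rho> * T \<omega> \<rho>)) \<partial>lborel) + ennreal (2 * ?rem) \<partial>P)"
    by (rule nn_integral_mono) (rule pointwise)
  also have "\<dots> = (\<integral>\<^sup>+\<omega>. (\<integral>\<^sup>+\<rho>. ennreal (norm (G \<rho> * T \<omega> \<rho>)) \<partial>lborel) \<partial>P) + ennreal (2 * ?rem)"
  proof -
    have "(\<lambda>\<omega>. \<integral>\<^sup>+\<rho>. ennreal (norm (G \<rho> * T \<omega> \<rho>)) \<partial>lborel) \<in> borel_measurable P"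
      using T_meas by (intro lborel.borel_measurable_nn_integral) (simp add: case_prod_unfold)
    then show ?thesis by (simp add: nn_integral_add P.emeasure_space_1)
  qed
  also have "(\<integral>\<^sup>+\<omega>. (\<integral>\<^sup>+\<rho>. ennreal (norm (G \<rho> * T \<omega> \<rho>)) \<partial>lborel) \<partial>P)
      = (\<integral>\<^sup>+\<rho>. (\<integral>\<^sup>+\<omega>. ennreal (norm (G \<rho> * T \<omega> \<rho>)) \<partial>P) \<partial>lborel)"
    using T_meas by (intro PL.Fubini'[symmetric]) (simp add: case_prod_unfold)
  also have "\<dots> \<le> (\<integral>\<^sup>+\<rho>. ennreal (K0 * K / X * ((1 + \<bar>\<rho>\<bar>)\<^sup>2 * exp (- (B / 40) * \<rho>\<^sup>2))) \<partial>lborel)"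
    by (rule nn_integral_mono) (rule inner)
  also have "\<dots> = ennreal (LINT \<rho>|lborel. K0 * K / X * ((1 + \<bar>\<rho>\<bar>)\<^sup>2 * exp (- (B / 40) * \<rho>\<^sup>2)))"
    using K Xpos B by (intro nn_integral_eq_integral integrable_mult_right squared_gaussian_integrable) auto
  also have "(LINT \<rho>|lborel. K0 * K / X * ((1 + \<bar>\<rho>\<bar>)\<^sup>2 * exp (- (B / 40) * \<rho>\<^sup>2))) = error_const B C \<beta> / X"
    by (simp add: error_const_def K_def K0_def)
  also have "ennreal (error_const B C \<beta> / X) + ennreal (2 * ?rem) = ennreal (error_const B C \<beta> / X + 2 * ?rem)"
  proof (rule ennreal_plus[symmetric])
    have "0 \<le> (LINT \<rho>|lborel. (1 + \<bar>\<rho>\<bar>)\<^sup>2 * exp (- (B / 40) * \<rho>\<^sup>2))"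
      by (rule Bochner_Integration.integral_nonneg) simp
    then show "0 \<le> error_const B C \<beta> / X"
      using K Xpos unfolding error_const_def K_def[symmetric] K0_def[symmetric] by simp
  qed (use Xpos in simp)
  finally show ?thesis by (simp add: a_def add_right_mono)
qed

theorem theorem3p2:
  fixes N :: "real measure"
    and P :: "nat \<Rightarrow> 'a measure"
    and \<nu> :: "nat \<Rightarrow> int \<Rightarrow> 'a \<Rightarrow> real"
    and u :: "nat \<Rightarrow> 'a \<Rightarrow> int \<Rightarrow> real \<Rightarrow> real"
    and \<sigma> :: "nat \<Rightarrow> real"
    and L x :: "nat \<Rightarrow> int"
    and c C \<beta> :: real
  assumes law: "prob_space N" "sets N = sets borel"
    and moments: "integrable N (\<lambda>y. y\<^sup>2)" "(LINT y|N. y) = 0" "(LINT y|N. y\<^sup>2) = 1"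
    and prob: "\<And>n. prob_space (P n)"
    and indep: "\<And>n. prob_space.indep_vars (P n) (\<lambda>_. borel) (\<nu> n) {1..L n}"
    and identical: "\<And>n k. k \<in> {1..L n} \<Longrightarrow> distr (P n) borel (\<nu> n k) = N"
    and positive: "\<And>n \<omega> k. \<omega> \<in> space (P n) \<Longrightarrow>
          1 + mass_defect (\<sigma> n) (L n) (\<lambda>j. \<nu> n j \<omega>) k > 0"
    and solution: "\<And>n \<omega>. \<omega> \<in> space (P n) \<Longrightarrow>
          lattice_solution 0 (mass_defect (\<sigma> n) (L n) (\<lambda>j. \<nu> n j \<omega>)) (u n \<omega>)"
    and sigma: "\<And>n. \<sigma> n > 0" "\<sigma> \<longlonglongrightarrow> 0"
    and L: "\<And>n. L n \<ge> 1"
    and regime: "0 < c" "c \<le> C" "\<And>n. c \<le> (\<sigma> n)\<^sup>2 * of_int (L n)" "\<And>n. (\<sigma> n)\<^sup>2 * of_int (L n) \<le> C"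
    and x: "\<And>n. x n > L n"
  shows "(\<lambda>n. (LINT \<omega>|P n. u n \<omega> (x n) (of_int (x n) + root 3 (of_int (x n)) * \<beta>))
              - 1 / root 3 (of_int (x n)) * Ai (- 2 * \<beta>))
         \<in> o(\<lambda>n. 1 / root 3 (of_int (x n)))"
proof -
  interpret N: prob_space N by (rule law)
  note [measurable_cong] = law(2)
  \<comment> \<open>\<open>N\<close> is supported in \<open>1 + \<sigma> 0 * y > 0\<close> only up
    to a null set. \<open>h\<close> agrees with the identity almost everywhere and satisfies
    \<open>\<sigma> 0 * h y > - 1\<close> at every point, so
    \<open>\<sigma> n * h y \<ge> - 1 / 2\<close> once
    \<open>\<sigma> n \<le> \<sigma> 0 / 2\<close>. Thus positivity of the masses for the index 0
    provides the mass bound for all late indices.\<close>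
  define h where "h y = (if 1 + \<sigma> 0 * y > 0 then y else 0)" for y
  have h_meas [measurable]: "h \<in> borel_measurable borel" unfolding h_def[abs_def] by measurable
  have rv: "\<nu> n k \<in> borel_measurable (P n)" if "k \<in> {1..L n}" for n k
    using indep[of n] that unfolding prob_space.indep_vars_def[OF prob[of n]] by auto
  have AE_N: "AE y in N. 1 + \<sigma> 0 * y > 0"
  proof -
    have one: "1 \<in> {1..L 0}" using L[of 0] by simp
    have "AE \<omega> in P 0. 1 + \<sigma> 0 * \<nu> 0 1 \<omega> > 0"
      using positive[of _ 0 1] one by (intro AE_I2) (simp add: mass_defect_def)
    then have "AE y in distr (P 0) borel (\<nu> 0 1). 1 + \<sigma> 0 * y > 0"
      by (subst AE_distr_iff[OF rv[OF one]]) auto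
    then show ?thesis unfolding identical[OF one] .
  qed
  then have AE_h: "AE y in N. h y = y" by eventually_elim (simp add: h_def)
  have int1: "integrable N (\<lambda>y. y)"
  proof (rule Bochner_Integration.integrable_bound)
    show "integrable N (\<lambda>y. 1 + y\<^sup>2)" using moments(1) by simp
    have "\<bar>y\<bar> \<le> 1 + y\<^sup>2" for y :: real
    proof -
      have "2 * \<bar>y\<bar> \<le> 1 + y\<^sup>2" using sum_squares_bound[of 1 "\<bar>y\<bar>"] by simp
      moreover have "\<bar>y\<bar> \<le> 2 * \<bar>y\<bar>" by simp
      ultimately show ?thesis by (rule order_trans[rotated])
    qed
    then show "AE y in N. norm y \<le> norm (1 + y\<^sup>2)" by (auto intro: order_trans[OF _ abs_ge_self])
  qed simp
  have h_int: "integrable N h" "integrable N (\<lambda>y. (h y)\<^sup>2)"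
    by (rule integrable_cong_AE_imp[OF int1], simp, use AE_h in eventually_elim, simp)
       (rule integrable_cong_AE_imp[OF moments(1)], simp, use AE_h in eventually_elim, simp)
  have h_mom: "(LINT y|N. h y) = 0" "(LINT y|N. (h y)\<^sup>2) = 1"
  proof -
    have "(LINT y|N. h y) = (LINT y|N. y)" using AE_h by (intro integral_cong_AE) auto
    then show "(LINT y|N. h y) = 0" using moments by simp
    have "(LINT y|N. (h y)\<^sup>2) = (LINT y|N. y\<^sup>2)" using AE_h by (intro integral_cong_AE) auto
    then show "(LINT y|N. (h y)\<^sup>2) = 1" using moments by simp
  qed
  \<comment> \<open>Depends on \<open>C\<close> alone, so \<open>error_const\<close> does not vary
    with \<open>n\<close>. The maximum with 1 turns \<open>400 * C \<le> B\<close> into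
    \<open>400 * C \<le> B ^ 3\<close>.\<close>
  define B where "B = max 1 (400 * C)"
  have C0: "C \<ge> 0" using regime by simp
  have B: "B \<ge> 1" "400 * C \<le> B ^ 3"
  proof -
    show B1: "B \<ge> 1" by (simp add: B_def)
    have "400 * C \<le> B" by (simp add: B_def)
    also have "B ^ 1 \<le> B ^ 3" using B1 by (intro power_increasing) auto
    then have "B \<le> B ^ 3" by simp
    finally show "400 * C \<le> B ^ 3" .
  qed
  define k where "k n = nat (x n)" for n
  define l where "l n = nat (L n)" for n
  have k: "of_int (x n) = real (k n)" "x n = int (k n)" and l: "int (l n) = L n" "l n \<ge> 1" "l n \<le> k n" for n
    using L[of n] x[of n] by (auto simp: k_def l_def)
  define X where "X n = root 3 (real (k n))" for n
  define t where "t n = real (k n) + X n * \<beta>" for n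
  define E where "E n = (LINT \<omega>|P n. u n \<omega> (x n) (t n))" for n
  define H where "H n = lattice_field (\<lambda>_. 0) (int (k n)) (t n)" for n
  define rem where "rem n = X n * (4 * exp (B / X n * t n) * (3 / 4) ^ (2 * k n))" for n
  have X3: "X n ^ 3 = real (k n)" for n by (simp add: X_def odd_real_root_pow)
  \<comment> \<open>From \<open>x > L \<ge> c / \<sigma>\<^sup>2\<close>, with the lower constant of
    the regime.\<close>
  have k_inf: "filterlim k sequentially sequentially"
  proof -
    have "((\<lambda>n. (\<sigma> n)\<^sup>2 / c) \<longlongrightarrow> 0\<^sup>2 / c) sequentially" using regime(1) by (intro tendsto_intros sigma) auto
    then have lim_inv: "filterlim (\<lambda>n. inverse ((\<sigma> n)\<^sup>2 / c)) at_top sequentially"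
      using regime(1) sigma(1)
      by (intro filterlim_inverse_at_top always_eventually allI divide_pos_pos zero_less_power) simp_all
    have k_ge: "inverse ((\<sigma> n)\<^sup>2 / c) \<le> real (k n)" for n
    proof -
      have "c / (\<sigma> n)\<^sup>2 \<le> of_int (L n)" using regime(3)[of n] sigma(1)[of n] by (simp add: divide_le_eq mult.commute)
      also have "\<dots> \<le> real (k n)" using x[of n] unfolding k(1)[symmetric] by simp
      finally show ?thesis by simp
    qed
    show ?thesis
      unfolding filterlim_sequentially_iff_filterlim_real
      by (rule filterlim_at_top_mono[OF lim_inv]) (use k_ge in simp)
  qed
  have X_inf: "filterlim X at_top sequentially"
    unfolding X_def by (rule filterlim_compose[OF filterlim_root3 k_inf])
  have error: "\<bar>X n * (E n - H n)\<bar> \<le> error_const B C \<beta> / X n + 2 * rem n"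
    if good: "\<sigma> n \<le> \<sigma> 0 / 2" "2 * B \<le> X n" "2 + \<bar>\<beta>\<bar> \<le> X n" for n
  proof -
    interpret P: prob_space "P n" by (rule prob)
    interpret R: random_mass N "\<lambda>y. \<sigma> n * h y" "(\<sigma> n)\<^sup>2"
    proof
      show "- 1 / 2 \<le> \<sigma> n * h y" for y
      proof (cases "1 + \<sigma> 0 * y > 0")
        case True
        have "- 1 / 2 \<le> \<sigma> n * y"
        proof (cases "0 \<le> y")
          case True
          then have "0 \<le> \<sigma> n * y" using sigma(1)[of n] by simp
          then show ?thesis by simp
        next
          case False
          then have "\<sigma> 0 / 2 * y \<le> \<sigma> n * y" using good(1) by (intro mult_right_mono_neg) auto
          moreover have "- 1 / 2 \<le> \<sigma> 0 / 2 * y" using \<open>1 + \<sigma> 0 * y > 0\<close> by simp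
          ultimately show ?thesis by simp
        qed
        then show ?thesis using True by (simp add: h_def)
      qed (simp add: h_def)
    qed (use law(2) h_int h_mom in \<open>simp_all add: power_mult_distrib\<close>)
    let ?mass = "\<lambda>\<omega>. mass_defect (\<sigma> n) (L n) (\<lambda>j. \<nu> n j \<omega>)"
    let ?masses = "\<lambda>\<omega>. R.masses (l n) (\<lambda>y. \<nu> n y \<omega>)"
    let ?U = "\<lambda>\<omega>. lattice_field (?masses \<omega>) (int (k n)) (t n)"
    have X2: "X n \<ge> 2" using good(3) by simp
    have t0: "0 \<le> t n"
    proof -
      have "0 \<le> X n * (X n * X n + \<beta>)"
      proof (rule mult_nonneg_nonneg)
        have "1 * X n \<le> X n * X n" using X2 by (intro mult_right_mono) auto
        then show "0 \<le> X n * X n + \<beta>" using good(3) by linarith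
      qed (use X2 in simp)
      then show ?thesis unfolding t_def X3[of n, symmetric] by (simp add: power3_eq_cube distrib_left)
    qed
    have u_eq: "u n \<omega> (x n) (t n) = lattice_field (?mass \<omega>) (int (k n)) (t n)" if \<omega>: "\<omega> \<in> space (P n)" for \<omega>
    proof -
      \<comment> \<open>The 1 accounts for all sites outside the slab; inside there are finitely
        many positive masses. The minimum may depend on the sample.\<close>
      define \<delta> where "\<delta> = Min (insert 1 ((\<lambda>y. 1 + ?mass \<omega> y) ` {1..L n}))"
      have "\<delta> > 0" unfolding \<delta>_def using positive[OF \<omega>] by (subst Min_gr_iff) auto
      moreover have "\<delta> \<le> 1 + ?mass \<omega> y" for y
        unfolding \<delta>_def by (rule Min_le) (auto simp: mass_defect_def)
      ultimately show ?thesis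
        unfolding k(2) by (rule lattice_solution_unique[OF solution[OF \<omega>] _ _ t0])
    qed
    have meas: "(\<lambda>\<omega>. lattice_field (f \<omega>) y s) \<in> borel_measurable (P n)"
      if "\<And>\<omega> y. f \<omega> y = (if y \<in> {1..L n} then w (\<nu> n y \<omega>) else 0)" "w \<in> borel_measurable borel" for f w y s
    proof (rule borel_measurable_lattice_field)
      fix z
      show "(\<lambda>\<omega>. f \<omega> z) \<in> borel_measurable (P n)"
      proof (cases "z \<in> {1..L n}")
        case True
        then show ?thesis using rv[OF True] that(2) by (simp add: that(1))
      next
        case False
        then have "(\<lambda>\<omega>. f \<omega> z) = (\<lambda>_. 0)" by (auto simp: that(1))
        then show ?thesis by simp
      qed
    qed
    have mass_meas: "(\<lambda>\<omega>. lattice_field (?mass \<omega>) (int (k n)) (t n)) \<in> borel_measurable (P n)"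
      by (rule meas[where w1 = "\<lambda>y. \<sigma> n * y"]) (simp_all add: mass_defect_def)
    have masses_meas [measurable]: "?U \<in> borel_measurable (P n)"
      by (rule meas[where w1 = "\<lambda>y. \<sigma> n * h y"]) (simp_all add: R.masses_def l)
    have "AE \<omega> in P n. \<forall>j\<in>{1..L n}. h (\<nu> n j \<omega>) = \<nu> n j \<omega>"
    proof (rule AE_finite_allI)
      fix j assume j: "j \<in> {1..L n}"
      have "AE y in distr (P n) borel (\<nu> n j). h y = y" unfolding identical[OF j] by (rule AE_h)
      then show "AE \<omega> in P n. h (\<nu> n j \<omega>) = \<nu> n j \<omega>" by (rule AE_distrD[OF rv[OF j]])
    qed simp
    then have "AE \<omega> in P n. lattice_field (?mass \<omega>) (int (k n)) (t n) = ?U \<omega>"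
    proof eventually_elim
      case (elim \<omega>)
      then have "?mass \<omega> = ?masses \<omega>" by (auto simp: fun_eq_iff mass_defect_def R.masses_def l)
      then show ?case by simp
    qed
    \<comment> \<open>Passing from \<open>u\<close> to the series is valid at every sample point and
      gives a measurable integrand; passing from the true masses to those cut off by
      \<open>h\<close> is valid almost surely.\<close>
    then have E_eq: "E n = (LINT \<omega>|P n. ?U \<omega>)"
      unfolding E_def using mass_meas masses_meas
      by (subst Bochner_Integration.integral_cong[OF refl u_eq]) (auto intro!: integral_cong_AE)
    have bound: "(\<integral>\<^sup>+\<omega>. ennreal \<bar>X n * (?U \<omega> - H n)\<bar> \<partial>P n) \<le> ennreal (error_const B C \<beta> / X n + 2 * rem n)"
      unfolding H_def rem_def
    proof (rule R.mean_field_error[OF prob])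
      show "prob_space.indep_vars (P n) (\<lambda>_. borel) (\<nu> n) {1..int (l n)}" using indep[of n] by (simp add: l)
      show "distr (P n) borel (\<nu> n k) = N" if "k \<in> {1..int (l n)}" for k using identical that by (simp add: l)
      show "(\<sigma> n)\<^sup>2 * real (l n) \<le> C" using regime(4)[of n] by (simp flip: l(1))
      show "t n = real (k n) + X n * \<beta>" by (simp add: t_def)
    qed (use l B C0 X3 good t0 in auto)
    \<comment> \<open>Integrability is a by-product of the finite bound. It is required before the
      expectation may be split into the mean field and the homogeneous field.\<close>
    have int: "integrable (P n) (\<lambda>\<omega>. X n * (?U \<omega> - H n))"
      using bound by (intro integrableI_bounded) (auto simp: less_top[symmetric] top_unique)
    have nonneg: "0 \<le> error_const B C \<beta> / X n + 2 * rem n"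
    proof -
      have "0 \<le> (LINT \<rho>|lborel. (1 + \<bar>\<rho>\<bar>)\<^sup>2 * exp (- (B / 40) * \<rho>\<^sup>2))"
        by (rule Bochner_Integration.integral_nonneg) simp
      then have "0 \<le> error_const B C \<beta>" unfolding error_const_def using B C0 by simp
      then show ?thesis using X2 by (simp add: rem_def)
    qed
    have "integrable (P n) (\<lambda>\<omega>. (1 / X n) * (X n * (?U \<omega> - H n)) + H n)"
      using int by (intro Bochner_Integration.integrable_add integrable_mult_right) auto
    then have "integrable (P n) ?U" using X2 by simp
    then have scaled: "X n * (E n - H n) = (LINT \<omega>|P n. X n * (?U \<omega> - H n))"
      unfolding E_eq by (simp add: P.prob_space)
    have "ennreal \<bar>X n * (E n - H n)\<bar> \<le> (\<integral>\<^sup>+\<omega>. ennreal \<bar>X n * (?U \<omega> - H n)\<bar> \<partial>P n)"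
      unfolding scaled using integral_norm_bound_ennreal[OF int] unfolding real_norm_def .
    also note bound
    finally show ?thesis using nonneg by (simp add: ennreal_le_iff)
  qed
  have "(\<lambda>n. X n * (E n - H n)) \<longlonglongrightarrow> 0"
  proof (rule Lim_null_comparison)
    have "\<forall>\<^sub>F n in sequentially. \<sigma> n < \<sigma> 0 / 2"
      using sigma by (intro order_tendstoD(2)[OF sigma(2)]) simp
    moreover have "\<forall>\<^sub>F n in sequentially. max (2 * B) (2 + \<bar>\<beta>\<bar>) \<le> X n"
      using X_inf unfolding filterlim_at_top by blast
    ultimately show "\<forall>\<^sub>F n in sequentially. norm (X n * (E n - H n)) \<le> error_const B C \<beta> / X n + 2 * rem n"
      by eventually_elim (use error in simp)
    have "(\<lambda>n. error_const B C \<beta> / X n) \<longlonglongrightarrow> 0"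
      by (rule tendsto_divide_0[OF tendsto_const filterlim_at_top_imp_at_infinity[OF X_inf]])
    moreover have "rem \<longlonglongrightarrow> 0"
      unfolding rem_def[abs_def] t_def X_def
      by (rule filterlim_compose[OF chord_remainder k_inf]) (use B in simp)
    ultimately have "(\<lambda>n. error_const B C \<beta> / X n + 2 * rem n) \<longlonglongrightarrow> 0 + 2 * 0" by (intro tendsto_intros)
    then show "(\<lambda>n. error_const B C \<beta> / X n + 2 * rem n) \<longlonglongrightarrow> 0" by simp
  qed
  moreover have "(\<lambda>n. X n * H n) \<longlonglongrightarrow> Ai (- 2 * \<beta>)"
    unfolding H_def t_def X_def by (rule filterlim_compose[OF free_field_asymptotics k_inf])
  ultimately have "(\<lambda>n. X n * (E n - H n) + X n * H n - Ai (- 2 * \<beta>)) \<longlonglongrightarrow> 0 + Ai (- 2 * \<beta>) - Ai (- 2 * \<beta>)"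
    by (intro tendsto_intros)
  then have lim: "(\<lambda>n. X n * E n - Ai (- 2 * \<beta>)) \<longlonglongrightarrow> 0" by (simp add: algebra_simps)
  have X_pos: "X n > 0" for n using l(2,3)[of n] by (simp add: X_def)
  have "(\<lambda>n. E n - 1 / X n * Ai (- 2 * \<beta>)) \<in> o(\<lambda>n. 1 / X n)"
  proof (rule smalloI_tendsto)
    have "(E n - 1 / X n * Ai (- 2 * \<beta>)) / (1 / X n) = X n * E n - Ai (- 2 * \<beta>)" for n
      using X_pos[of n] by (simp add: field_simps)
    then show "((\<lambda>n. (E n - 1 / X n * Ai (- 2 * \<beta>)) / (1 / X n)) \<longlongrightarrow> 0) sequentially" using lim by simp
    have "1 / X n \<noteq> 0" for n using X_pos[of n] by simp
    then show "\<forall>\<^sub>F n in sequentially. 1 / X n \<noteq> 0" by simp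
  qed
  then show ?thesis by (simp only: E_def t_def X_def k(1))
qed

end
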